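(* Let $k$ be a field of characteristic $\neq 2$ and let $A$ be a Hopf algebra over $k$ such that the only Hopf algebra map $A \to H_4$ is the trivial one. For any $a\in \mathcal{Z}\mathcal{P}(A)$ define $$G(a) := \{ (u, \beta) \in \mathrm{Aut}_{\rm Hopf}(A) \times k^* \mid u(a) = \beta^{2} a \}.$$ Then $G(a)$ is a subgroup of $\mathrm{Aut}_{\rm Hopf}(A) \times k^*$ and there exists an isomorphism of groups $$G(a) \cong \mathrm{Aut}_{\rm Hopf}(A_{(a)}), \qquad (u, \beta) \mapsto \psi_{u, \beta},$$ where $\psi_{u,\beta}(z\#h)=u(z)\#v_\beta(h)$ for all $z\in A$, $h\in H_4$.
   Context: $H_4$ is Sweedler's 4-dimensional Hopf algebra over $k$, with basis $\{1,g,x,gx\}$, relations $g^2=1$, $x^2=0$, $xg=-gx$, and $\Delta(g)=g\otimes g$, $\Delta(x)=x\otimes 1+g\otimes x$, $\varepsilon(g)=1$, $\varepsilon(x)=0$. The trivial Hopf algebra map $A\to H_4$ is $z\mapsto\varepsilon(z)1$. $\mathcal{Z}\mathcal{P}(A)=P(A)\cap Z(A)$, where $P(A)=\{z\in A\mid \Delta(z)=z\otimes 1+1\otimes z\}$ and $Z(A)$ is the center of $A$. $\mathrm{Aut}_{\rm Hopf}$ denotes the group of Hopf algebra automorphisms. For $\beta\in k^*$, $v_\beta:H_4\to H_4$ is the Hopf algebra automorphism with $v_\beta(g)=g$, $v_\beta(x)=\beta x$, $v_\beta(gx)=\beta gx$. For $a\in\mathcal{Z}\mathcal{P}(A)$,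 let $f_a:H_4\otimes H_4\to A$ be the linear map with $f_a(s,t)=1$ for $s,t\in\{1,g\}$; $f_a(s,t)=0$ if exactly one of $s,t$ lies in $\{1,g\}$ and the other in $\{x,gx\}$; $f_a(x,x)=f_a(gx,x)=a$ and $f_a(x,gx)=f_a(gx,gx)=-a$. Then $A_{(a)}$ is the Hopf algebra on the vector space $A\otimes H_4$ (write $z\#h$ for $z\otimes h$) with multiplication $(z\#h)(c\#h')=z\,c\,f_a(h_{(1)},h'_{(1)})\#h_{(2)}h'_{(2)}$ (Sweedler notation), unit $1\#1$ and the tensor product coalgebra structure. *)

theory Defs
  imports "HOL-Algebra.Bij" "HOL-Algebra.Algebraic_Closure_Type" "HOL-Library.Poly_Mapping"
begin

section \<open>Tensor products of vector spaces and algebras\<close>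

text \<open>
  The ground field is a type \<open>'k::field\<close>, regarded as a ring structure when it acts on the carrier
  of an \<open>('k, 'a) module\<close> record. The tensor product of \<open>A\<close> and \<open>B\<close> is the quotient of the free
  vector space on pairs, realised by finitely supported functions, by the subspace generated by the
  bilinearity relations; its elements are the cosets of that subspace.
\<close>

abbreviation ground :: "'k::field ring"
  where "ground \<equiv> ring_of_type_algebra"

definition free_scale :: "'k::field \<Rightarrow> ('i \<Rightarrow>\<^sub>0 'k) \<Rightarrow> ('i \<Rightarrow>\<^sub>0 'k)"
  where "free_scale c p = Poly_Mapping.map ((*) c) p"

inductive_set tensor_rel ::
    "('k::field, 'a, 'm) module_scheme \<Rightarrow> ('k, 'b, 'n) module_scheme \<Rightarrow> (('a \<times> 'b) \<Rightarrow>\<^sub>0 'k) set"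
  for A :: "('k::field, 'a, 'm) module_scheme" and B :: "('k, 'b, 'n) module_scheme"
where
  zero: "0 \<in> tensor_rel A B"
| add: "\<lbrakk>p \<in> tensor_rel A B; q \<in> tensor_rel A B\<rbrakk> \<Longrightarrow> p + q \<in> tensor_rel A B"
| scale: "p \<in> tensor_rel A B \<Longrightarrow> free_scale c p \<in> tensor_rel A B"
| add_left: "\<lbrakk>x \<in> carrier A; x' \<in> carrier A; y \<in> carrier B\<rbrakk> \<Longrightarrow>
    Poly_Mapping.single (x \<oplus>\<^bsub>A\<^esub> x', y) 1 - Poly_Mapping.single (x, y) 1
      - Poly_Mapping.single (x', y) 1 \<in> tensor_rel A B"
| add_right: "\<lbrakk>x \<in> carrier A; y \<in> carrier B; y' \<in> carrier B\<rbrakk> \<Longrightarrow>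
    Poly_Mapping.single (x, y \<oplus>\<^bsub>B\<^esub> y') 1 - Poly_Mapping.single (x, y) 1
      - Poly_Mapping.single (x, y') 1 \<in> tensor_rel A B"
| smult_left: "\<lbrakk>x \<in> carrier A; y \<in> carrier B\<rbrakk> \<Longrightarrow>
    Poly_Mapping.single (c \<odot>\<^bsub>A\<^esub> x, y) 1 - free_scale c (Poly_Mapping.single (x, y) 1) \<in> tensor_rel A B"
| smult_right: "\<lbrakk>x \<in> carrier A; y \<in> carrier B\<rbrakk> \<Longrightarrow>
    Poly_Mapping.single (x, c \<odot>\<^bsub>B\<^esub> y) 1 - free_scale c (Poly_Mapping.single (x, y) 1) \<in> tensor_rel A B"

definition tensor_coset ::
    "('k::field, 'a, 'm) module_scheme \<Rightarrow> ('k, 'b, 'n) module_scheme \<Rightarrow>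
      (('a \<times> 'b) \<Rightarrow>\<^sub>0 'k) \<Rightarrow> (('a \<times> 'b) \<Rightarrow>\<^sub>0 'k) set"
  where "tensor_coset A B p = (\<lambda>r. p + r) ` tensor_rel A B"

definition tensor_pure ::
    "('k::field, 'a, 'm) module_scheme \<Rightarrow> ('k, 'b, 'n) module_scheme \<Rightarrow>
      'a \<Rightarrow> 'b \<Rightarrow> (('a \<times> 'b) \<Rightarrow>\<^sub>0 'k) set"
  where "tensor_pure A B x y = tensor_coset A B (Poly_Mapping.single (x, y) 1)"

definition tensor_rep :: "(('a \<times> 'b) \<Rightarrow>\<^sub>0 'k::field) set \<Rightarrow> (('a \<times> 'b) \<Rightarrow>\<^sub>0 'k)"
  where "tensor_rep T = (SOME p. p \<in> T)"

text \<open>The algebra with product \<open>(x \<otimes> y) (x' \<otimes> y') = x x' \<otimes> y y'\<close>.\<close>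

definition tensor ::
    "('k::field, 'a, 'm) module_scheme \<Rightarrow> ('k, 'b, 'n) module_scheme \<Rightarrow>
      ('k, (('a \<times> 'b) \<Rightarrow>\<^sub>0 'k) set) module"
  where "tensor A B =
    \<lparr>carrier = tensor_coset A B ` {p. Poly_Mapping.keys p \<subseteq> carrier A \<times> carrier B},
     monoid.mult = \<lambda>S T. tensor_coset A B
       (\<Sum>i \<in> Poly_Mapping.keys (tensor_rep S). \<Sum>j \<in> Poly_Mapping.keys (tensor_rep T).
          Poly_Mapping.single (fst i \<otimes>\<^bsub>A\<^esub> fst j, snd i \<otimes>\<^bsub>B\<^esub> snd j)
            (Poly_Mapping.lookup (tensor_rep S) i * Poly_Mapping.lookup (tensor_rep T) j)),
     one = tensor_pure A B \<one>\<^bsub>A\<^esub> \<one>\<^bsub>B\<^esub>,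
     ring.zero = tensor_coset A B 0,
     add = \<lambda>S T. tensor_coset A B (tensor_rep S + tensor_rep T),
     module.smult = \<lambda>c T. tensor_coset A B (free_scale c (tensor_rep T))\<rparr>"

text \<open>
  \<open>tensor_lift V F\<close> is the linear map with \<open>x \<otimes> y \<mapsto> F x y\<close>; it is independent of the chosen
  representative whenever \<open>F\<close> is bilinear. Applied to a comultiplication it renders Sweedler
  notation: \<open>tensor_lift V F (\<Delta> z)\<close> is \<open>F z\<^sub>(\<^sub>1\<^sub>) z\<^sub>(\<^sub>2\<^sub>)\<close>.
\<close>

definition tensor_lift ::
    "('k::field, 'v, 'm) module_scheme \<Rightarrow> ('a \<Rightarrow> 'b \<Rightarrow> 'v) \<Rightarrow> (('a \<times> 'b) \<Rightarrow>\<^sub>0 'k) set \<Rightarrow> 'v"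
  where "tensor_lift V F T =
    finsum V (\<lambda>i. Poly_Mapping.lookup (tensor_rep T) i \<odot>\<^bsub>V\<^esub> F (fst i) (snd i))
      (Poly_Mapping.keys (tensor_rep T))"

text \<open>\<open>f \<otimes> g\<close>, where \<open>f\<close> and \<open>g\<close> take values in \<open>A\<close> and \<open>B\<close>.\<close>

definition tensor_map ::
    "('k::field, 'c, 'm) module_scheme \<Rightarrow> ('k, 'd, 'n) module_scheme \<Rightarrow>
      ('a \<Rightarrow> 'c) \<Rightarrow> ('b \<Rightarrow> 'd) \<Rightarrow> (('a \<times> 'b) \<Rightarrow>\<^sub>0 'k) set \<Rightarrow> (('c \<times> 'd) \<Rightarrow>\<^sub>0 'k) set"
  where "tensor_map A B f g = tensor_lift (tensor A B) (\<lambda>x y. tensor_pure A B (f x) (g y))"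

text \<open>The canonical map \<open>(A \<otimes> B) \<otimes> C \<rightarrow> A \<otimes> (B \<otimes> C)\<close>.\<close>

definition tensor_assoc ::
    "('k::field, 'a, 'l) module_scheme \<Rightarrow> ('k, 'b, 'm) module_scheme \<Rightarrow> ('k, 'c, 'n) module_scheme \<Rightarrow>
      (((('a \<times> 'b) \<Rightarrow>\<^sub>0 'k) set \<times> 'c) \<Rightarrow>\<^sub>0 'k) set \<Rightarrow> (('a \<times> (('b \<times> 'c) \<Rightarrow>\<^sub>0 'k) set) \<Rightarrow>\<^sub>0 'k) set"
  where "tensor_assoc A B C =
    tensor_lift (tensor A (tensor B C))
      (\<lambda>t z. tensor_lift (tensor A (tensor B C))
         (\<lambda>x y. tensor_pure A (tensor B C) x (tensor_pure B C y z)) t)"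


section \<open>Hopf algebras\<close>

record (overloaded) ('k::field, 'a) hopf = "('k, 'a) module" +
  comult :: "'a \<Rightarrow> (('a \<times> 'a) \<Rightarrow>\<^sub>0 'k) set"
  counit :: "'a \<Rightarrow> 'k"

definition linear_hom ::
    "('k, 'a, 'm) module_scheme \<Rightarrow> ('k, 'b, 'n) module_scheme \<Rightarrow> ('a \<Rightarrow> 'b) set"
  where "linear_hom V W =
    {f \<in> carrier V \<rightarrow> carrier W.
      (\<forall>x \<in> carrier V. \<forall>y \<in> carrier V. f (x \<oplus>\<^bsub>V\<^esub> y) = f x \<oplus>\<^bsub>W\<^esub> f y) \<and>
      (\<forall>c. \<forall>x \<in> carrier V. f (c \<odot>\<^bsub>V\<^esub> x) = c \<odot>\<^bsub>W\<^esub> f x)}"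

text \<open>
  The antipode is unique if it exists and is preserved by every bialgebra map, so it is not part of
  the data.
\<close>

locale hopf_algebra =
  fixes H :: "('k::field, 'a, 'm) hopf_scheme" (structure)
  assumes ring: "ring H"
    and module: "module (ground :: 'k ring) H"
    and smult_mult_left: "\<lbrakk>x \<in> carrier H; y \<in> carrier H\<rbrakk> \<Longrightarrow> (c \<odot> x) \<otimes> y = c \<odot> (x \<otimes> y)"
    and smult_mult_right: "\<lbrakk>x \<in> carrier H; y \<in> carrier H\<rbrakk> \<Longrightarrow> x \<otimes> (c \<odot> y) = c \<odot> (x \<otimes> y)"
    and comult_linear: "comult H \<in> linear_hom H (tensor H H)"
    and comult_ring_hom: "comult H \<in> ring_hom H (tensor H H)"
    and counit_smult: "x \<in> carrier H \<Longrightarrow> counit H (c \<odot> x) = c * counit H x"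
    and counit_ring_hom: "counit H \<in> ring_hom H ground"
    and coassoc: "x \<in> carrier H \<Longrightarrow>
      tensor_assoc H H H (tensor_map (tensor H H) H (comult H) (\<lambda>y. y) (comult H x)) =
      tensor_map H (tensor H H) (\<lambda>y. y) (comult H) (comult H x)"
    and counit_left: "x \<in> carrier H \<Longrightarrow> tensor_lift H (\<lambda>y z. counit H y \<odot> z) (comult H x) = x"
    and counit_right: "x \<in> carrier H \<Longrightarrow> tensor_lift H (\<lambda>y z. counit H z \<odot> y) (comult H x) = x"
    and antipode: "\<exists>S \<in> linear_hom H H. \<forall>x \<in> carrier H.
      tensor_lift H (\<lambda>y z. S y \<otimes> z) (comult H x) = counit H x \<odot> \<one> \<and>
      tensor_lift H (\<lambda>y z. y \<otimes> S z) (comult H x) = counit H x \<odot> \<one>"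

definition hopf_hom ::
    "('k::field, 'a, 'm) hopf_scheme \<Rightarrow> ('k, 'b, 'n) hopf_scheme \<Rightarrow> ('a \<Rightarrow> 'b) set"
  where "hopf_hom H L =
    {f \<in> ring_hom H L \<inter> linear_hom H L. \<forall>x \<in> carrier H.
      comult L (f x) = tensor_map L L f f (comult H x) \<and> counit L (f x) = counit H x}"

text \<open>As in \<open>AutoGroup\<close>, automorphisms are extensional functions on the carrier.\<close>

definition hopf_aut :: "('k::field, 'a, 'm) hopf_scheme \<Rightarrow> ('a \<Rightarrow> 'a) monoid"
  where "hopf_aut H = (BijGroup (carrier H))\<lparr>carrier := hopf_hom H H \<inter> Bij (carrier H)\<rparr>"

definition ZP :: "('k::field, 'a, 'm) hopf_scheme \<Rightarrow> 'a set"
  where "ZP H = {z \<in> carrier H.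
    comult H z = tensor_pure H H z \<one>\<^bsub>H\<^esub> \<oplus>\<^bsub>tensor H H\<^esub> tensor_pure H H \<one>\<^bsub>H\<^esub> z \<and>
    (\<forall>y \<in> carrier H. z \<otimes>\<^bsub>H\<^esub> y = y \<otimes>\<^bsub>H\<^esub> z)}"


section \<open>Sweedler's Hopf algebra\<close>

text \<open>\<open>H4 p q r s\<close> is \<open>p 1 + q g + r x + s gx\<close>.\<close>

datatype 'k h4 = H4 (co_1: 'k) (co_g: 'k) (co_x: 'k) (co_gx: 'k)

definition h4_g :: "'k::field h4" where "h4_g = H4 0 1 0 0"
definition h4_x :: "'k::field h4" where "h4_x = H4 0 0 1 0"
definition h4_gx :: "'k::field h4" where "h4_gx = H4 0 0 0 1"

definition h4_algebra :: "('k::field, 'k h4) module"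
  where "h4_algebra =
    \<lparr>carrier = UNIV,
     monoid.mult = \<lambda>s t. H4
       (co_1 s * co_1 t + co_g s * co_g t)
       (co_1 s * co_g t + co_g s * co_1 t)
       (co_1 s * co_x t + co_g s * co_gx t + co_x s * co_1 t - co_gx s * co_g t)
       (co_1 s * co_gx t + co_g s * co_x t + co_gx s * co_1 t - co_x s * co_g t),
     one = H4 1 0 0 0,
     ring.zero = H4 0 0 0 0,
     add = \<lambda>s t. H4 (co_1 s + co_1 t) (co_g s + co_g t) (co_x s + co_x t) (co_gx s + co_gx t),
     module.smult = \<lambda>c s. H4 (c * co_1 s) (c * co_g s) (c * co_x s) (c * co_gx s)\<rparr>"

lemma h4_relations:
  "h4_g \<otimes>\<^bsub>h4_algebra\<^esub> h4_g = \<one>\<^bsub>h4_algebra\<^esub>"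
  "h4_x \<otimes>\<^bsub>h4_algebra\<^esub> h4_x = \<zero>\<^bsub>h4_algebra\<^esub>"
  "h4_g \<otimes>\<^bsub>h4_algebra\<^esub> h4_x = h4_gx"
  "h4_x \<otimes>\<^bsub>h4_algebra\<^esub> h4_g = (- 1) \<odot>\<^bsub>h4_algebra\<^esub> h4_gx"
  by (simp_all add: h4_algebra_def h4_g_def h4_x_def h4_gx_def)

text \<open>On \<open>gx\<close>, multiplicativity forces \<open>\<Delta>(gx) = \<Delta>(g) \<Delta>(x) = gx \<otimes> g + 1 \<otimes> gx\<close>.\<close>

definition h4_comult :: "'k::field h4 \<Rightarrow> (('k h4 \<times> 'k h4) \<Rightarrow>\<^sub>0 'k) set"
  where "h4_comult s =
    (let W = tensor h4_algebra h4_algebra; t = tensor_pure h4_algebra h4_algebra;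
         e = \<one>\<^bsub>h4_algebra\<^esub>
     in co_1 s \<odot>\<^bsub>W\<^esub> t e e \<oplus>\<^bsub>W\<^esub> co_g s \<odot>\<^bsub>W\<^esub> t h4_g h4_g
        \<oplus>\<^bsub>W\<^esub> co_x s \<odot>\<^bsub>W\<^esub> (t h4_x e \<oplus>\<^bsub>W\<^esub> t h4_g h4_x)
        \<oplus>\<^bsub>W\<^esub> co_gx s \<odot>\<^bsub>W\<^esub> (t h4_gx h4_g \<oplus>\<^bsub>W\<^esub> t e h4_gx))"

definition sweedler :: "('k::field, 'k h4) hopf"
  where "sweedler = module.extend h4_algebra
    \<lparr>comult = h4_comult, counit = \<lambda>s. co_1 s + co_g s\<rparr>"

definition h4_v :: "'k::field \<Rightarrow> 'k h4 \<Rightarrow> 'k h4"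
  where "h4_v \<beta> s = H4 (co_1 s) (co_g s) (\<beta> * co_x s) (\<beta> * co_gx s)"


section \<open>The Hopf algebra $A_{(a)}$\<close>

definition cocycle :: "('k::field, 'a, 'm) hopf_scheme \<Rightarrow> 'a \<Rightarrow> 'k h4 \<Rightarrow> 'k h4 \<Rightarrow> 'a"
  where "cocycle A a s t =
    ((co_1 s + co_g s) * (co_1 t + co_g t)) \<odot>\<^bsub>A\<^esub> \<one>\<^bsub>A\<^esub> \<oplus>\<^bsub>A\<^esub>
    ((co_x s + co_gx s) * (co_x t - co_gx t)) \<odot>\<^bsub>A\<^esub> a"

definition crossed_mult ::
    "('k::field, 'a, 'm) hopf_scheme \<Rightarrow> 'a \<Rightarrow> (('a \<times> 'k h4) \<Rightarrow>\<^sub>0 'k) set \<Rightarrow>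
      (('a \<times> 'k h4) \<Rightarrow>\<^sub>0 'k) set \<Rightarrow> (('a \<times> 'k h4) \<Rightarrow>\<^sub>0 'k) set"
  where "crossed_mult A a S T =
    (let V = tensor A sweedler in
     tensor_lift V (\<lambda>z h. tensor_lift V (\<lambda>c h'.
       tensor_lift V (\<lambda>h1 h2. tensor_lift V (\<lambda>h1' h2'.
         tensor_pure A sweedler (z \<otimes>\<^bsub>A\<^esub> c \<otimes>\<^bsub>A\<^esub> cocycle A a h1 h1') (h2 \<otimes>\<^bsub>sweedler\<^esub> h2'))
       (comult sweedler h')) (comult sweedler h)) T) S)"

text \<open>The tensor product of the coalgebras \<open>C\<close> and \<open>D\<close>.\<close>

definition tensor_comult ::
    "('k::field, 'a, 'm) hopf_scheme \<Rightarrow> ('k, 'b, 'n) hopf_scheme \<Rightarrow> (('a \<times> 'b) \<Rightarrow>\<^sub>0 'k) set \<Rightarrow>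
      (((('a \<times> 'b) \<Rightarrow>\<^sub>0 'k) set \<times> (('a \<times> 'b) \<Rightarrow>\<^sub>0 'k) set) \<Rightarrow>\<^sub>0 'k) set"
  where "tensor_comult C D =
    (let V = tensor C D; W = tensor V V in
     tensor_lift W (\<lambda>x y. tensor_lift W (\<lambda>x1 x2. tensor_lift W (\<lambda>y1 y2.
       tensor_pure V V (tensor_pure C D x1 y1) (tensor_pure C D x2 y2))
     (comult D y)) (comult C x)))"

definition tensor_counit ::
    "('k::field, 'a, 'm) hopf_scheme \<Rightarrow> ('k, 'b, 'n) hopf_scheme \<Rightarrow> (('a \<times> 'b) \<Rightarrow>\<^sub>0 'k) set \<Rightarrow> 'k"
  where "tensor_counit C D =
    tensor_lift (ring.extend ground \<lparr>module.smult = (*)\<rparr>) (\<lambda>x y. counit C x * counit D y)"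

definition crossed ::
    "('k::field, 'a, 'm) hopf_scheme \<Rightarrow> 'a \<Rightarrow> ('k, (('a \<times> 'k h4) \<Rightarrow>\<^sub>0 'k) set) hopf"
  where "crossed A a = module.extend
    (tensor A sweedler \<lparr>monoid.mult := crossed_mult A a, one := tensor_pure A sweedler \<one>\<^bsub>A\<^esub> \<one>\<^bsub>sweedler\<^esub>\<rparr>)
    \<lparr>comult = tensor_comult A sweedler, counit = tensor_counit A sweedler\<rparr>"


definition G_carrier :: "('k::field, 'a, 'm) hopf_scheme \<Rightarrow> 'a \<Rightarrow> (('a \<Rightarrow> 'a) \<times> 'k) set"
  where "G_carrier A a =
    {(u, \<beta>). u \<in> carrier (hopf_aut A) \<and> \<beta> \<in> carrier (units_of ground) \<and> u a = \<beta>\<^sup>2 \<odot>\<^bsub>A\<^esub> a}"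

end

theory Submission
  imports Defs
begin

text \<open>
  The crossed product \<open>C = A\<^sub>(\<^sub>a\<^sub>)\<close> is \<open>A \<otimes> H\<^sub>4\<close> with the relation \<open>x\<^sup>2 = 0\<close> deformed to
  \<open>x\<^sup>2 = a\<close>. A map \<open>u \<otimes> v\<^sub>\<beta>\<close> respects this relation if and only if \<open>u a = \<beta>\<^sup>2 a\<close>, so the pairs
  in \<open>G(a)\<close> act on \<open>C\<close> by Hopf automorphisms (\<open>psi_hopf_hom\<close>), compatibly with composition.

  Conversely, let \<open>f\<close> be an automorphism of \<open>C\<close>. Besides the inclusion of \<open>A\<close> there are
  the Hopf map \<open>\<pi>(z # h) = \<epsilon>(z) h\<close> onto \<open>H\<^sub>4\<close> and the linear map \<open>E(z # h) = \<epsilon>(h) z\<close> onto \<open>A\<close>.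
  Since \<open>C\<close> is a tensor product of coalgebras, every \<open>T \<in> C\<close> satisfies
  \<open>T = E(T\<^sub>1) # \<pi>(T\<^sub>2) = E(T\<^sub>2) # \<pi>(T\<^sub>1)\<close> (\<open>reassemble\<close>, \<open>reassemble_flipped\<close>), and these two
  identities determine \<open>f\<close>. For \<open>z \<in> A\<close> the map \<open>z \<mapsto> \<pi>(f z)\<close> is a Hopf map from \<open>A\<close> to \<open>H\<^sub>4\<close>,
  hence trivial; the first identity then shows \<open>f z \<in> A\<close> (\<open>hopf_endo_preserves_A\<close>). The same holds for the
  inverse, so \<open>f\<close> restricts to an automorphism \<open>u\<close> of \<open>A\<close> (\<open>aut_restricts_to_A\<close>). The elements \<open>\<pi>(f g)\<close> and
  \<open>\<pi>(f x)\<close> are group-like and skew primitive in \<open>H\<^sub>4\<close>; bijectivity and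
  characteristic different from 2 leave only \<open>g\<close> and \<open>\<beta> x\<close>. Comparing the two identities for \<open>f x\<close> shows
  that \<open>f g = g\<close> and \<open>f x = \<beta> x\<close> hold in \<open>C\<close> itself (\<open>aut_is_psi\<close>), and squaring the latter
  gives \<open>u a = \<beta>\<^sup>2 a\<close>.

  The computations rest on the universal property of the tensor product (\<open>tensor_lift_linear\<close>,
  \<open>tensor_lift_pure\<close>, \<open>tensor_ext\<close>): Sweedler sums are lifts of bilinear maps, and identities between
  linear maps are verified on pure tensors.
\<close>


section \<open>Vector spaces and bilinear maps\<close>

lemma ground_simps [simp]:
  "carrier (ground :: 'k::field ring) = UNIV"
  "x \<otimes>\<^bsub>(ground :: 'k ring)\<^esub> y = x * y"
  "x \<oplus>\<^bsub>(ground :: 'k ring)\<^esub> y = x + y"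
  "\<one>\<^bsub>(ground :: 'k ring)\<^esub> = 1"
  "\<zero>\<^bsub>(ground :: 'k ring)\<^esub> = 0"
  by (simp_all add: ring_of_type_algebra_def)

locale vspace =
  fixes V :: "('k::field, 'v, 'm) module_scheme" (structure)
  assumes module_ground: "module (ground :: 'k ring) V"

sublocale vspace \<subseteq> abelian_group V
  using module_ground by (rule module.axioms)

context vspace
begin

lemma smult_closed [simp, intro]: "x \<in> carrier V \<Longrightarrow> c \<odot> x \<in> carrier V"
  using module.smult_closed[OF module_ground] by simp

lemma smult_l_distr: "x \<in> carrier V \<Longrightarrow> (c + d) \<odot> x = c \<odot> x \<oplus> d \<odot> x"
  using module.smult_l_distr[OF module_ground] by simp

lemma smult_r_distr:
  "x \<in> carrier V \<Longrightarrow> y \<in> carrier V \<Longrightarrow> c \<odot> (x \<oplus> y) = c \<odot> x \<oplus> c \<odot> y"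
  using module.smult_r_distr[OF module_ground] by simp

lemma smult_smult: "x \<in> carrier V \<Longrightarrow> c \<odot> (d \<odot> x) = (c * d) \<odot> x"
  using module.smult_assoc1[OF module_ground] by simp

lemma smult_one [simp]: "x \<in> carrier V \<Longrightarrow> 1 \<odot> x = x"
  using module.smult_one[OF module_ground] by simp

lemma smult_0 [simp]: "x \<in> carrier V \<Longrightarrow> 0 \<odot> x = \<zero>"
  using module.smult_l_null[OF module_ground] by simp

lemma smult_zero [simp]: "c \<odot> \<zero> = \<zero>"
  using module.smult_r_null[OF module_ground] by simp

lemma minus_eq_smult: "x \<in> carrier V \<Longrightarrow> \<ominus> x = (- 1) \<odot> x"
  by (metis a_inv_closed add.inv_equality smult_0 smult_closed smult_l_distr smult_one
      ab_group_add_class.ab_left_minus)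

end

lemma vspaceI:
  fixes V :: "('k::field, 'v, 'm) module_scheme" (structure)
  assumes "abelian_group V"
    and "\<And>c x. x \<in> carrier V \<Longrightarrow> c \<odot> x \<in> carrier V"
    and "\<And>c d x. x \<in> carrier V \<Longrightarrow> (c + d) \<odot> x = c \<odot> x \<oplus> d \<odot> x"
    and "\<And>c x y. x \<in> carrier V \<Longrightarrow> y \<in> carrier V \<Longrightarrow> c \<odot> (x \<oplus> y) = c \<odot> x \<oplus> c \<odot> y"
    and "\<And>c d x. x \<in> carrier V \<Longrightarrow> (c * d) \<odot> x = c \<odot> (d \<odot> x)"
    and "\<And>x. x \<in> carrier V \<Longrightarrow> 1 \<odot> x = x"
  shows "vspace V"
  using assms by (auto intro!: vspace.intro moduleI fieldE(1)[OF field_from_type_algebra])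

lemma linear_homI:
  assumes "\<And>x. x \<in> carrier V \<Longrightarrow> f x \<in> carrier W"
    and "\<And>x y. x \<in> carrier V \<Longrightarrow> y \<in> carrier V \<Longrightarrow> f (x \<oplus>\<^bsub>V\<^esub> y) = f x \<oplus>\<^bsub>W\<^esub> f y"
    and "\<And>c x. x \<in> carrier V \<Longrightarrow> f (c \<odot>\<^bsub>V\<^esub> x) = c \<odot>\<^bsub>W\<^esub> f x"
  shows "f \<in> linear_hom V W"
  using assms by (auto simp: linear_hom_def)

lemma linear_hom_closed: "f \<in> linear_hom V W \<Longrightarrow> x \<in> carrier V \<Longrightarrow> f x \<in> carrier W"
  by (auto simp: linear_hom_def)

lemma linear_hom_add:
  "f \<in> linear_hom V W \<Longrightarrow> x \<in> carrier V \<Longrightarrow> y \<in> carrier V \<Longrightarrow> f (x \<oplus>\<^bsub>V\<^esub> y) = f x \<oplus>\<^bsub>W\<^esub> f y"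
  by (auto simp: linear_hom_def)

lemma linear_hom_smult:
  "f \<in> linear_hom V W \<Longrightarrow> x \<in> carrier V \<Longrightarrow> f (c \<odot>\<^bsub>V\<^esub> x) = c \<odot>\<^bsub>W\<^esub> f x"
  by (auto simp: linear_hom_def)

lemmas linear_homD = linear_hom_closed linear_hom_add linear_hom_smult

lemma linear_hom_zero:
  assumes "vspace V" "vspace W" "f \<in> linear_hom V W"
  shows "f \<zero>\<^bsub>V\<^esub> = \<zero>\<^bsub>W\<^esub>"
proof -
  interpret V: vspace V by fact
  interpret W: vspace W by fact
  have "f (0 \<odot>\<^bsub>V\<^esub> \<zero>\<^bsub>V\<^esub>) = 0 \<odot>\<^bsub>W\<^esub> f \<zero>\<^bsub>V\<^esub>"
    using linear_hom_smult[OF assms(3)] by blast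
  then show ?thesis
    using linear_hom_closed[OF assms(3), of "\<zero>\<^bsub>V\<^esub>"] by simp
qed

lemma linear_hom_id: "(\<lambda>x. x) \<in> linear_hom V V"
  by (simp add: linear_hom_def)

lemma linear_hom_comp:
  "f \<in> linear_hom V W \<Longrightarrow> g \<in> linear_hom U V \<Longrightarrow> (\<lambda>x. f (g x)) \<in> linear_hom U W"
  by (auto simp: linear_hom_def Pi_iff)

lemma linear_hom_cong:
  assumes "vspace V" "f \<in> linear_hom V W" "\<And>x. x \<in> carrier V \<Longrightarrow> g x = f x"
  shows "g \<in> linear_hom V W"
proof -
  interpret V: vspace V by fact
  show ?thesis using assms(2,3) by (auto simp: linear_hom_def Pi_iff)
qed

lemma linear_hom_sum:
  assumes "vspace W" "f \<in> linear_hom V W" "g \<in> linear_hom V W"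
  shows "(\<lambda>x. f x \<oplus>\<^bsub>W\<^esub> g x) \<in> linear_hom V W"
proof -
  interpret W: vspace W by fact
  show ?thesis
    using assms(2,3) by (auto simp: linear_hom_def Pi_iff W.smult_r_distr W.add.m_ac)
qed

lemma linear_hom_scaled:
  assumes "vspace W" "f \<in> linear_hom V W"
  shows "(\<lambda>x. c \<odot>\<^bsub>W\<^esub> f x) \<in> linear_hom V W"
proof -
  interpret W: vspace W by fact
  show ?thesis
    using assms(2) by (auto simp: linear_hom_def Pi_iff W.smult_r_distr W.smult_smult mult.commute)
qed

definition bilinear ::
    "('k::field, 'a, 'l) module_scheme \<Rightarrow> ('k, 'b, 'm) module_scheme \<Rightarrow> ('k, 'c, 'n) module_scheme \<Rightarrow>
      ('a \<Rightarrow> 'b \<Rightarrow> 'c) \<Rightarrow> bool"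
  where "bilinear A B V F \<longleftrightarrow>
    (\<forall>x \<in> carrier A. F x \<in> linear_hom B V) \<and> (\<forall>y \<in> carrier B. (\<lambda>x. F x y) \<in> linear_hom A V)"

lemma bilinearI:
  assumes "\<And>x. x \<in> carrier A \<Longrightarrow> (\<lambda>y. F x y) \<in> linear_hom B V"
    and "\<And>y. y \<in> carrier B \<Longrightarrow> (\<lambda>x. F x y) \<in> linear_hom A V"
  shows "bilinear A B V F"
  using assms by (simp add: bilinear_def)

lemma bilinear_right: "bilinear A B V F \<Longrightarrow> x \<in> carrier A \<Longrightarrow> F x \<in> linear_hom B V"
  by (simp add: bilinear_def)

lemma bilinear_left: "bilinear A B V F \<Longrightarrow> y \<in> carrier B \<Longrightarrow> (\<lambda>x. F x y) \<in> linear_hom A V"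
  by (simp add: bilinear_def)

lemma bilinear_closed:
  "bilinear A B V F \<Longrightarrow> x \<in> carrier A \<Longrightarrow> y \<in> carrier B \<Longrightarrow> F x y \<in> carrier V"
  by (meson bilinear_right linear_hom_closed)


section \<open>The tensor product and its universal property\<close>

lemma lookup_free_scale [simp]:
  "Poly_Mapping.lookup (free_scale c p) i = c * Poly_Mapping.lookup p i"
  by (simp add: free_scale_def Poly_Mapping.map.rep_eq when_def)

lemma free_scale_simps [simp]:
  "free_scale c (p + q) = free_scale c p + free_scale c q"
  "free_scale c (p - q) = free_scale c p - free_scale c q"
  "free_scale c 0 = 0"
  "free_scale 1 p = p"
  "free_scale c (free_scale d p) = free_scale (c * d) p"
  "free_scale c (Poly_Mapping.single i d) = Poly_Mapping.single i (c * d)"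
  by (auto intro!: poly_mapping_eqI
      simp: lookup_add lookup_minus lookup_single when_def algebra_simps)

lemma free_scale_add: "free_scale (c + d) p = free_scale c p + free_scale d p"
  by (auto intro!: poly_mapping_eqI simp: lookup_add algebra_simps)

lemma free_scale_minus: "free_scale (- 1) p = - p"
  by (auto intro!: poly_mapping_eqI)

lemma keys_free_scale: "Poly_Mapping.keys (free_scale c p) \<subseteq> Poly_Mapping.keys p"
  by (auto simp: in_keys_iff)

lemma tensor_rel_uminus: "p \<in> tensor_rel A B \<Longrightarrow> - p \<in> tensor_rel A B"
  by (metis free_scale_minus tensor_rel.scale)

lemma tensor_rel_diff:
  "p \<in> tensor_rel A B \<Longrightarrow> q \<in> tensor_rel A B \<Longrightarrow> p - q \<in> tensor_rel A B"
  using tensor_rel.add[OF _ tensor_rel_uminus] by fastforce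

text \<open>Membership of the difference in the subspace of relations replaces every argument about the chosen
  representatives: sums and scalar multiples of cosets can be computed on any representatives.\<close>

lemma tensor_coset_eq_iff: "tensor_coset A B p = tensor_coset A B q \<longleftrightarrow> p - q \<in> tensor_rel A B"
proof
  assume "tensor_coset A B p = tensor_coset A B q"
  moreover have "p + 0 \<in> tensor_coset A B p"
    unfolding tensor_coset_def using tensor_rel.zero by blast
  ultimately show "p - q \<in> tensor_rel A B"
    by (auto simp: tensor_coset_def)
next
  assume pq: "p - q \<in> tensor_rel A B"
  have "p + r = q + ((p - q) + r)" "q + r = p + (r - (p - q))" for r
    by simp_all
  then show "tensor_coset A B p = tensor_coset A B q"
    unfolding tensor_coset_def using tensor_rel.add[OF pq] tensor_rel_diff[OF _ pq]
    by (metis (no_types, lifting) image_iff subset_antisym subsetI)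
qed

lemma tensor_rep_coset: "tensor_rep (tensor_coset A B p) - p \<in> tensor_rel A B"
proof -
  have "p + 0 \<in> tensor_coset A B p"
    unfolding tensor_coset_def using tensor_rel.zero by blast
  then have "tensor_rep (tensor_coset A B p) \<in> tensor_coset A B p"
    unfolding tensor_rep_def by (rule someI)
  then show ?thesis
    by (auto simp: tensor_coset_def)
qed

definition tensor_support ::
    "('k::field, 'a, 'm) module_scheme \<Rightarrow> ('k, 'b, 'n) module_scheme \<Rightarrow> (('a \<times> 'b) \<Rightarrow>\<^sub>0 'k) set"
  where "tensor_support A B = {p. Poly_Mapping.keys p \<subseteq> carrier A \<times> carrier B}"

lemma tensor_support_closed [simp, intro]:
  "p \<in> tensor_support A B \<Longrightarrow> q \<in> tensor_support A B \<Longrightarrow> p + q \<in> tensor_support A B"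
  "p \<in> tensor_support A B \<Longrightarrow> q \<in> tensor_support A B \<Longrightarrow> p - q \<in> tensor_support A B"
  "p \<in> tensor_support A B \<Longrightarrow> - p \<in> tensor_support A B"
  "p \<in> tensor_support A B \<Longrightarrow> free_scale c p \<in> tensor_support A B"
  "x \<in> carrier A \<Longrightarrow> y \<in> carrier B \<Longrightarrow> Poly_Mapping.single (x, y) c \<in> tensor_support A B"
  "0 \<in> tensor_support A B"
  using keys_add[of p q] keys_diff[of p q] keys_free_scale[of c p]
  by (auto simp: tensor_support_def)

lemma tensor_coset_closed [simp]:
  "p \<in> tensor_support A B \<Longrightarrow> tensor_coset A B p \<in> carrier (tensor A B)"
  by (simp add: tensor_def tensor_support_def)

lemma tensor_carrierE:
  assumes "T \<in> carrier (tensor A B)"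
  obtains p where "p \<in> tensor_support A B" "T = tensor_coset A B p"
  using assms by (auto simp: tensor_def tensor_support_def)

lemma tensor_coset_add:
  "tensor_coset A B p \<oplus>\<^bsub>tensor A B\<^esub> tensor_coset A B q = tensor_coset A B (p + q)"
proof -
  have "tensor_rep (tensor_coset A B p) + tensor_rep (tensor_coset A B q) - (p + q) =
      (tensor_rep (tensor_coset A B p) - p) + (tensor_rep (tensor_coset A B q) - q)"
    by simp
  also have "\<dots> \<in> tensor_rel A B"
    by (intro tensor_rel.add tensor_rep_coset)
  finally show ?thesis
    by (simp add: tensor_def tensor_coset_eq_iff)
qed

lemma tensor_coset_smult: "c \<odot>\<^bsub>tensor A B\<^esub> tensor_coset A B p = tensor_coset A B (free_scale c p)"
  by (simp add: tensor_def tensor_coset_eq_iff tensor_rel.scale tensor_rep_coset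
      flip: free_scale_simps(2))

lemma tensor_zero: "\<zero>\<^bsub>tensor A B\<^esub> = tensor_coset A B 0"
  by (simp add: tensor_def)

lemma vspace_tensor: "vspace (tensor A B)"
proof (rule vspaceI)
  show "abelian_group (tensor A B)"
  proof (rule abelian_groupI)
    fix S assume "S \<in> carrier (tensor A B)"
    then obtain p where p: "p \<in> tensor_support A B" "S = tensor_coset A B p"
      by (rule tensor_carrierE)
    have "tensor_coset A B (- p) \<oplus>\<^bsub>tensor A B\<^esub> S = \<zero>\<^bsub>tensor A B\<^esub>"
      by (simp add: p tensor_coset_add tensor_zero)
    then show "\<exists>T \<in> carrier (tensor A B). T \<oplus>\<^bsub>tensor A B\<^esub> S = \<zero>\<^bsub>tensor A B\<^esub>"
      using p by (metis tensor_coset_closed tensor_support_closed(3))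
  qed (auto elim!: tensor_carrierE simp: tensor_coset_add tensor_zero add_ac)
qed (auto elim!: tensor_carrierE simp: tensor_coset_add tensor_coset_smult free_scale_add)

lemma tensor_pure_closed [simp]:
  "x \<in> carrier A \<Longrightarrow> y \<in> carrier B \<Longrightarrow> tensor_pure A B x y \<in> carrier (tensor A B)"
  by (simp add: tensor_pure_def)

lemma bilinear_tensor_pure:
  assumes "vspace A" "vspace B"
  shows "bilinear A B (tensor A B) (tensor_pure A B)"
proof -
  interpret A: vspace A by fact
  interpret B: vspace B by fact
  show ?thesis
    by (intro bilinearI linear_homI)
      (simp_all add: tensor_pure_def tensor_coset_add tensor_coset_smult tensor_coset_eq_iff
        diff_diff_eq[symmetric] tensor_rel.intros[simplified])
qed

lemma tensor_induct [consumes 1, case_names pure smult add zero]: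
  assumes "T \<in> carrier (tensor A B)"
    and pure: "\<And>x y. x \<in> carrier A \<Longrightarrow> y \<in> carrier B \<Longrightarrow> P (tensor_pure A B x y)"
    and smult: "\<And>c S. S \<in> carrier (tensor A B) \<Longrightarrow> P S \<Longrightarrow> P (c \<odot>\<^bsub>tensor A B\<^esub> S)"
    and add: "\<And>S T. S \<in> carrier (tensor A B) \<Longrightarrow> T \<in> carrier (tensor A B) \<Longrightarrow> P S \<Longrightarrow> P T \<Longrightarrow>
      P (S \<oplus>\<^bsub>tensor A B\<^esub> T)"
    and zero: "P \<zero>\<^bsub>tensor A B\<^esub>"
  shows "P T"
proof -
  interpret W: vspace "tensor A B" by (rule vspace_tensor)
  obtain p where p: "p \<in> tensor_support A B" "T = tensor_coset A B p"
    using assms(1) by (rule tensor_carrierE)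
  have *: "P (tensor_coset A B (\<Sum>i\<in>K. Poly_Mapping.single i (c i)))
      \<and> (\<Sum>i\<in>K. Poly_Mapping.single i (c i)) \<in> tensor_support A B"
    if "finite K" "K \<subseteq> carrier A \<times> carrier B" for K c
    using that
  proof induction
    case empty
    show ?case using zero by (simp add: tensor_zero)
  next
    case (insert i K)
    obtain x y where i: "i = (x, y)" "x \<in> carrier A" "y \<in> carrier B"
      using insert.prems by auto
    have "tensor_coset A B (Poly_Mapping.single i (c i)) = c i \<odot>\<^bsub>tensor A B\<^esub> tensor_pure A B x y"
      by (simp add: tensor_pure_def tensor_coset_smult i)
    then have 1: "P (tensor_coset A B (Poly_Mapping.single i (c i)))"
      using smult[OF _ pure] i by simp
    have 2: "Poly_Mapping.single i (c i) \<in> tensor_support A B"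
      unfolding i(1) using i by blast
    show ?case
      using insert add[OF _ _ 1] 2
      by (simp flip: tensor_coset_add)
  qed
  have "p = (\<Sum>i\<in>Poly_Mapping.keys p. Poly_Mapping.single i (Poly_Mapping.lookup p i))"
    by (intro poly_mapping_eqI)
      (auto simp: lookup_sum lookup_single when_def in_keys_iff)
  with *[of "Poly_Mapping.keys p" "Poly_Mapping.lookup p"] p show ?thesis
    by (simp add: tensor_support_def)
qed

lemma tensor_ext:
  assumes "vspace V" "f \<in> linear_hom (tensor A B) V" "g \<in> linear_hom (tensor A B) V"
    and "\<And>x y. x \<in> carrier A \<Longrightarrow> y \<in> carrier B \<Longrightarrow> f (tensor_pure A B x y) = g (tensor_pure A B x y)"
    and "T \<in> carrier (tensor A B)"
  shows "f T = g T"
  using assms(5)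
  by (induction rule: tensor_induct)
    (simp_all add: assms(4) linear_homD[OF assms(2)] linear_homD[OF assms(3)]
      linear_hom_zero[OF vspace_tensor assms(1,2)] linear_hom_zero[OF vspace_tensor assms(1,3)])

text \<open>The value of the linear extension of \<open>F\<close> to the free vector space.\<close>

definition free_eval :: "('k::field, 'v, 'm) module_scheme \<Rightarrow> ('i \<Rightarrow> 'v) \<Rightarrow> ('i \<Rightarrow>\<^sub>0 'k) \<Rightarrow> 'v"
  where "free_eval V F p =
    finsum V (\<lambda>i. Poly_Mapping.lookup p i \<odot>\<^bsub>V\<^esub> F i) (Poly_Mapping.keys p)"

context vspace
begin

lemma free_eval_superset:
  assumes "finite K" "Poly_Mapping.keys p \<subseteq> K" "F \<in> K \<rightarrow> carrier V"
  shows "free_eval V F p = finsum V (\<lambda>i. Poly_Mapping.lookup p i \<odot> F i) K"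
  unfolding free_eval_def
  by (rule add.finprod_mono_neutral_cong_left)
    (use assms in \<open>auto simp: in_keys_iff Pi_iff\<close>)

lemma free_eval_closed:
  assumes "Poly_Mapping.keys p \<subseteq> S" "F \<in> S \<rightarrow> carrier V"
  shows "free_eval V F p \<in> carrier V"
  unfolding free_eval_def by (rule finsum_closed) (use assms in auto)

lemma free_eval_add:
  assumes "Poly_Mapping.keys p \<subseteq> S" "Poly_Mapping.keys q \<subseteq> S" "F \<in> S \<rightarrow> carrier V"
  shows "free_eval V F (p + q) = free_eval V F p \<oplus> free_eval V F q"
proof -
  let ?K = "Poly_Mapping.keys p \<union> Poly_Mapping.keys q"
  have K: "finite ?K" "F \<in> ?K \<rightarrow> carrier V"
    using assms by auto
  have "free_eval V F (p + q) =
      finsum V (\<lambda>i. Poly_Mapping.lookup p i \<odot> F i \<oplus> Poly_Mapping.lookup q i \<odot> F i) ?K"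
    unfolding free_eval_superset[OF K(1) keys_add K(2)]
    by (rule finsum_cong') (use K(2) in \<open>auto simp: lookup_add smult_l_distr Pi_iff\<close>)
  also have "\<dots> = free_eval V F p \<oplus> free_eval V F q"
    using K(2) by (subst finsum_addf)
      (auto simp: Pi_iff free_eval_superset[OF K(1) Un_upper1 K(2)]
        free_eval_superset[OF K(1) Un_upper2 K(2)])
  finally show ?thesis .
qed

lemma finsum_smult:
  assumes "finite K" "G \<in> K \<rightarrow> carrier V"
  shows "finsum V (\<lambda>i. c \<odot> G i) K = c \<odot> finsum V G K"
  using assms by (induction K) (auto simp: Pi_iff smult_r_distr)

lemma free_eval_scale:
  assumes "Poly_Mapping.keys p \<subseteq> S" "F \<in> S \<rightarrow> carrier V"
  shows "free_eval V F (free_scale c p) = c \<odot> free_eval V F p"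
proof -
  have F: "F \<in> Poly_Mapping.keys p \<rightarrow> carrier V"
    using assms by auto
  have "free_eval V F (free_scale c p) =
      finsum V (\<lambda>i. c \<odot> (Poly_Mapping.lookup p i \<odot> F i)) (Poly_Mapping.keys p)"
    unfolding free_eval_superset[OF finite_keys keys_free_scale F]
    by (rule finsum_cong') (use F in \<open>auto simp: smult_smult Pi_iff\<close>)
  also have "\<dots> = c \<odot> free_eval V F p"
    unfolding free_eval_def by (rule finsum_smult) (use F in auto)
  finally show ?thesis .
qed

lemma free_eval_single:
  assumes "F i \<in> carrier V"
  shows "free_eval V F (Poly_Mapping.single i c) = c \<odot> F i"
  using free_eval_superset[of "{i}" "Poly_Mapping.single i c" F] assms
  by (simp add: finsum_insert)

lemma free_eval_diff:
  assumes "Poly_Mapping.keys p \<subseteq> S" "Poly_Mapping.keys q \<subseteq> S" "F \<in> S \<rightarrow> carrier V"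
  shows "free_eval V F (p - q) = free_eval V F p \<ominus> free_eval V F q"
proof -
  have "free_eval V F (- q) = \<ominus> free_eval V F q"
    unfolding free_scale_minus[symmetric] minus_eq_smult[OF free_eval_closed[OF assms(2,3)]]
    by (rule free_eval_scale[OF assms(2,3)])
  moreover have "free_eval V F (p + - q) = free_eval V F p \<oplus> free_eval V F (- q)"
    by (rule free_eval_add[OF assms(1) _ assms(3)]) (use assms(2) in simp)
  ultimately show ?thesis
    by (simp add: a_minus_def)
qed

end

text \<open>Bilinearity is exactly what makes the linear extension to the free vector space kill each generator
  of the relations, so that it descends to the tensor product. Relations also stay within
  finite combinations of pairs of carrier elements, which keeps the sums in \<open>V\<close> well behaved.\<close>

lemma free_eval_tensor_rel:
  assumes "vspace A" "vspace B" "vspace V" "bilinear A B V F" "p \<in> tensor_rel A B"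
  shows "p \<in> tensor_support A B \<and> free_eval V (\<lambda>i. F (fst i) (snd i)) p = \<zero>\<^bsub>V\<^esub>"
  using assms(5)
proof induction
  interpret A: vspace A by fact
  interpret B: vspace B by fact
  interpret V: vspace V by fact
  let ?F = "\<lambda>i. F (fst i) (snd i)"
  note F = bilinear_right[OF assms(4), THEN linear_hom_add] bilinear_left[OF assms(4), THEN linear_hom_add]
    bilinear_right[OF assms(4), THEN linear_hom_smult] bilinear_left[OF assms(4), THEN linear_hom_smult]
    bilinear_closed[OF assms(4)]
  have FS: "?F \<in> carrier A \<times> carrier B \<rightarrow> carrier V"
    using F(5) by auto
  have ev:
    "\<And>p q. p \<in> tensor_support A B \<Longrightarrow> q \<in> tensor_support A B \<Longrightarrow>
      free_eval V ?F (p + q) = free_eval V ?F p \<oplus>\<^bsub>V\<^esub> free_eval V ?F q"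
    "\<And>p q. p \<in> tensor_support A B \<Longrightarrow> q \<in> tensor_support A B \<Longrightarrow>
      free_eval V ?F (p - q) = free_eval V ?F p \<ominus>\<^bsub>V\<^esub> free_eval V ?F q"
    "\<And>c p. p \<in> tensor_support A B \<Longrightarrow> free_eval V ?F (free_scale c p) = c \<odot>\<^bsub>V\<^esub> free_eval V ?F p"
    "\<And>x y c. x \<in> carrier A \<Longrightarrow> y \<in> carrier B \<Longrightarrow>
      free_eval V ?F (Poly_Mapping.single (x, y) c) = c \<odot>\<^bsub>V\<^esub> F x y"
    using V.free_eval_add[OF _ _ FS] V.free_eval_diff[OF _ _ FS] V.free_eval_scale[OF _ FS]
      V.free_eval_single[of ?F] F(5)
    by (auto simp: tensor_support_def)
  have cancel: "u \<ominus>\<^bsub>V\<^esub> u = \<zero>\<^bsub>V\<^esub>" if "u \<in> carrier V" for u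
    using that by (simp add: a_minus_def V.r_neg)
  have cancel2: "u \<oplus>\<^bsub>V\<^esub> v \<ominus>\<^bsub>V\<^esub> u \<ominus>\<^bsub>V\<^esub> v = \<zero>\<^bsub>V\<^esub>"
    if "u \<in> carrier V" "v \<in> carrier V" for u v
  proof -
    have "u \<oplus>\<^bsub>V\<^esub> v \<ominus>\<^bsub>V\<^esub> u \<ominus>\<^bsub>V\<^esub> v = (u \<oplus>\<^bsub>V\<^esub> v) \<ominus>\<^bsub>V\<^esub> (u \<oplus>\<^bsub>V\<^esub> v)"
      using that by (simp add: a_minus_def V.a_assoc V.minus_add)
    then show ?thesis
      using that cancel[of "u \<oplus>\<^bsub>V\<^esub> v"] by simp
  qed
  {
    case zero
    show ?case by (simp add: free_eval_def)
  next
    case (add p q)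
    then show ?case by (simp add: ev)
  next
    case (scale p c)
    then show ?case by (simp add: ev)
  next
    case (add_left x x' y)
    then show ?case by (simp add: ev F cancel2)
  next
    case (add_right x y y')
    then show ?case by (simp add: ev F cancel2)
  next
    case (smult_left x y c)
    then show ?case by (simp add: ev F cancel)
  next
    case (smult_right x y c)
    then show ?case by (simp add: ev F cancel)
  }
qed

lemma tensor_lift_coset:
  assumes "vspace A" "vspace B" "vspace V" "bilinear A B V F" "p \<in> tensor_support A B"
  shows "tensor_lift V F (tensor_coset A B p) = free_eval V (\<lambda>i. F (fst i) (snd i)) p"
proof -
  interpret V: vspace V by fact
  let ?F = "\<lambda>i. F (fst i) (snd i)"
  let ?r = "tensor_rep (tensor_coset A B p) - p"
  have FS: "?F \<in> carrier A \<times> carrier B \<rightarrow> carrier V"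
    using bilinear_closed[OF assms(4)] by auto
  have "free_eval V ?F (?r + p) = free_eval V ?F ?r \<oplus>\<^bsub>V\<^esub> free_eval V ?F p"
    by (rule V.free_eval_add[OF _ _ FS])
      (use free_eval_tensor_rel[OF assms(1-4) tensor_rep_coset] assms(5) in \<open>auto simp: tensor_support_def\<close>)
  then show ?thesis
    using free_eval_tensor_rel[OF assms(1-4) tensor_rep_coset] V.free_eval_closed[OF _ FS] assms(5)
    by (simp add: tensor_support_def tensor_lift_def free_eval_def[symmetric])
qed

lemma tensor_lift_linear:
  assumes "vspace A" "vspace B" "vspace V" "bilinear A B V F"
  shows "tensor_lift V F \<in> linear_hom (tensor A B) V"
proof -
  interpret V: vspace V by fact
  have FS: "(\<lambda>i. F (fst i) (snd i)) \<in> carrier A \<times> carrier B \<rightarrow> carrier V"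
    using bilinear_closed[OF assms(4)] by auto
  have ts: "p \<in> tensor_support A B \<equiv> Poly_Mapping.keys p \<subseteq> carrier A \<times> carrier B" for p
    by (simp add: tensor_support_def)
  have ev: "free_eval V (\<lambda>i. F (fst i) (snd i)) p \<in> carrier V" if "p \<in> tensor_support A B" for p
    using that V.free_eval_closed[OF _ FS] by (simp add: tensor_support_def)
  show ?thesis
  proof (intro linear_homI)
    show "tensor_lift V F T \<in> carrier V" if "T \<in> carrier (tensor A B)" for T
      using that ev
      by (auto elim!: tensor_carrierE simp: tensor_lift_coset[OF assms])
    show "tensor_lift V F (S \<oplus>\<^bsub>tensor A B\<^esub> T) = tensor_lift V F S \<oplus>\<^bsub>V\<^esub> tensor_lift V F T"
      if "S \<in> carrier (tensor A B)" "T \<in> carrier (tensor A B)" for S T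
      using that V.free_eval_add[OF _ _ FS, folded ts]
      by (auto elim!: tensor_carrierE simp: tensor_lift_coset[OF assms] tensor_coset_add)
    show "tensor_lift V F (c \<odot>\<^bsub>tensor A B\<^esub> T) = c \<odot>\<^bsub>V\<^esub> tensor_lift V F T"
      if "T \<in> carrier (tensor A B)" for c T
      using that V.free_eval_scale[OF _ FS, folded ts]
      by (auto elim!: tensor_carrierE simp: tensor_lift_coset[OF assms] tensor_coset_smult)
  qed
qed

lemma tensor_lift_pure:
  assumes "vspace A" "vspace B" "vspace V" "bilinear A B V F" "x \<in> carrier A" "y \<in> carrier B"
  shows "tensor_lift V F (tensor_pure A B x y) = F x y"
proof -
  interpret V: vspace V by fact
  show ?thesis
    using bilinear_closed[OF assms(4-6)] assms(5,6)
    by (simp add: tensor_pure_def tensor_lift_coset[OF assms(1-4)] V.free_eval_single)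
qed


lemma linear_hom_const_zero:
  assumes "vspace W"
  shows "(\<lambda>x. \<zero>\<^bsub>W\<^esub>) \<in> linear_hom V W"
proof -
  interpret W: vspace W by fact
  show ?thesis by (simp add: linear_hom_def)
qed

lemma linear_hom_bilinear_left:
  "bilinear A B V F \<Longrightarrow> g \<in> linear_hom Z A \<Longrightarrow> y \<in> carrier B \<Longrightarrow> (\<lambda>z. F (g z) y) \<in> linear_hom Z V"
  using linear_hom_comp[OF bilinear_left] by fast

lemma linear_hom_bilinear_right:
  "bilinear A B V F \<Longrightarrow> x \<in> carrier A \<Longrightarrow> g \<in> linear_hom Z B \<Longrightarrow> (\<lambda>z. F x (g z)) \<in> linear_hom Z V"
  using linear_hom_comp[OF bilinear_right] by fast

lemma bilinear_comp:
  assumes "f \<in> linear_hom V W" "bilinear A B V F"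
  shows "bilinear A B W (\<lambda>x y. f (F x y))"
  using linear_hom_comp[OF assms(1) bilinear_left[OF assms(2)]]
    linear_hom_comp[OF assms(1) bilinear_right[OF assms(2)]]
  by (simp add: bilinear_def)

lemma bilinear_precomp:
  assumes "bilinear A' B' V F" "f \<in> linear_hom A A'" "g \<in> linear_hom B B'"
  shows "bilinear A B V (\<lambda>x y. F (f x) (g y))"
  by (intro bilinearI linear_hom_bilinear_left[OF assms(1)] linear_hom_bilinear_right[OF assms(1)]
      assms linear_hom_closed[OF assms(2)] linear_hom_closed[OF assms(3)])

lemma bilinear_cong:
  assumes "vspace A" "vspace B" "bilinear A B V F"
    and "\<And>x y. x \<in> carrier A \<Longrightarrow> y \<in> carrier B \<Longrightarrow> G x y = F x y"
  shows "bilinear A B V G"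
  by (intro bilinearI)
    (use assms linear_hom_cong[OF assms(2) bilinear_right[OF assms(3)]]
      linear_hom_cong[OF assms(1) bilinear_left[OF assms(3)]] in auto)

lemma bilinear_flip: "bilinear A B V F \<Longrightarrow> bilinear B A V (\<lambda>x y. F y x)"
  by (simp add: bilinear_def)

lemma tensor_lift_closed:
  assumes "vspace A" "vspace B" "vspace V" "bilinear A B V F" "T \<in> carrier (tensor A B)"
  shows "tensor_lift V F T \<in> carrier V"
  using linear_hom_closed[OF tensor_lift_linear[OF assms(1-4)] assms(5)] .

lemma tensor_lift_unique:
  assumes "vspace A" "vspace B" "vspace V" "bilinear A B V F" "f \<in> linear_hom (tensor A B) V"
    and "\<And>x y. x \<in> carrier A \<Longrightarrow> y \<in> carrier B \<Longrightarrow> F x y = f (tensor_pure A B x y)"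
    and "T \<in> carrier (tensor A B)"
  shows "tensor_lift V F T = f T"
  by (rule tensor_ext[OF assms(3) tensor_lift_linear[OF assms(1-4)] assms(5) _ assms(7)])
    (simp add: tensor_lift_pure[OF assms(1-4)] assms(6))

lemma tensor_lift_cong:
  assumes "vspace A" "vspace B" "vspace V" "bilinear A B V G"
    and "\<And>x y. x \<in> carrier A \<Longrightarrow> y \<in> carrier B \<Longrightarrow> F x y = G x y"
    and "T \<in> carrier (tensor A B)"
  shows "tensor_lift V F T = tensor_lift V G T"
proof (rule tensor_lift_unique[OF assms(1-3) _ tensor_lift_linear[OF assms(1-4)] _ assms(6)])
  show "bilinear A B V F"
    by (rule bilinear_cong[OF assms(1,2,4,5)])
qed (simp add: tensor_lift_pure[OF assms(1-4)] assms(5))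

lemma linear_hom_tensor_lift:
  assumes "vspace A" "vspace B" "vspace V" "vspace W" "bilinear A B V F" "f \<in> linear_hom V W"
    and "T \<in> carrier (tensor A B)"
  shows "f (tensor_lift V F T) = tensor_lift W (\<lambda>x y. f (F x y)) T"
  by (rule tensor_lift_unique[symmetric, OF assms(1,2,4) bilinear_comp[OF assms(6,5)]
        linear_hom_comp[OF assms(6) tensor_lift_linear[OF assms(1-3,5)]] _ assms(7)])
    (simp add: tensor_lift_pure[OF assms(1-3,5)])

lemma tensor_lift_tensor_pure:
  assumes "vspace A" "vspace B" "T \<in> carrier (tensor A B)"
  shows "tensor_lift (tensor A B) (tensor_pure A B) T = T"
  by (rule tensor_lift_unique[OF assms(1,2) vspace_tensor bilinear_tensor_pure[OF assms(1,2)]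
        linear_hom_id _ assms(3)]) simp

text \<open>This gives linearity of nested Sweedler sums in each variable: the outer variables of such a sum
  are parameters of the inner lift. The proof runs over \<open>T\<close>, because linear maps in the parameter are
  closed under linear combinations.\<close>

lemma linear_hom_tensor_lift_param:
  assumes "vspace A" "vspace B" "vspace V" "vspace Z"
    and bil: "\<And>z. z \<in> carrier Z \<Longrightarrow> bilinear A B V (F z)"
    and par: "\<And>x y. x \<in> carrier A \<Longrightarrow> y \<in> carrier B \<Longrightarrow> (\<lambda>z. F z x y) \<in> linear_hom Z V"
    and T: "T \<in> carrier (tensor A B)"
  shows "(\<lambda>z. tensor_lift V (F z) T) \<in> linear_hom Z V"
  using T
proof (induction rule: tensor_induct)
  case (pure x y)
  then show ?case
    by (intro linear_hom_cong[OF assms(4) par]) (simp_all add: tensor_lift_pure[OF assms(1-3) bil])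
next
  case (smult c S)
  show ?case
    by (rule linear_hom_cong[OF assms(4) linear_hom_scaled[OF assms(3) smult.IH]])
      (simp add: linear_hom_smult[OF tensor_lift_linear[OF assms(1-3) bil]] smult.hyps)
next
  case (add S T)
  show ?case
    by (rule linear_hom_cong[OF assms(4) linear_hom_sum[OF assms(3) add.IH]])
      (simp add: linear_hom_add[OF tensor_lift_linear[OF assms(1-3) bil]] add.hyps)
next
  case zero
  show ?case
    by (rule linear_hom_cong[OF assms(4) linear_hom_const_zero[OF assms(3)]])
      (simp add: linear_hom_zero[OF vspace_tensor assms(3) tensor_lift_linear[OF assms(1-3) bil]])
qed

lemma bilinear_tensor_pure_comp:
  assumes "vspace A'" "vspace B'" "f \<in> linear_hom A A'" "g \<in> linear_hom B B'"
  shows "bilinear A B (tensor A' B') (\<lambda>x y. tensor_pure A' B' (f x) (g y))"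
  by (rule bilinear_precomp[OF bilinear_tensor_pure[OF assms(1,2)] assms(3,4)])

lemma tensor_map_linear:
  assumes "vspace A" "vspace B" "vspace A'" "vspace B'" "f \<in> linear_hom A A'" "g \<in> linear_hom B B'"
  shows "tensor_map A' B' f g \<in> linear_hom (tensor A B) (tensor A' B')"
  unfolding tensor_map_def
  by (rule tensor_lift_linear[OF assms(1,2) vspace_tensor bilinear_tensor_pure_comp[OF assms(3-6)]])

lemma tensor_map_pure:
  assumes "vspace A" "vspace B" "vspace A'" "vspace B'" "f \<in> linear_hom A A'" "g \<in> linear_hom B B'"
    and "x \<in> carrier A" "y \<in> carrier B"
  shows "tensor_map A' B' f g (tensor_pure A B x y) = tensor_pure A' B' (f x) (g y)"
  unfolding tensor_map_def
  by (rule tensor_lift_pure[OF assms(1,2) vspace_tensor bilinear_tensor_pure_comp[OF assms(3-6)] assms(7,8)])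

lemma tensor_lift_tensor_map:
  assumes "vspace A" "vspace B" "vspace A'" "vspace B'" "vspace V"
    and "f \<in> linear_hom A A'" "g \<in> linear_hom B B'" "bilinear A' B' V F"
    and "T \<in> carrier (tensor A B)"
  shows "tensor_lift V F (tensor_map A' B' f g T) = tensor_lift V (\<lambda>x y. F (f x) (g y)) T"
proof (rule tensor_lift_unique[symmetric, OF assms(1,2,5) _ _ _ assms(9)])
  show "bilinear A B V (\<lambda>x y. F (f x) (g y))"
    by (rule bilinear_precomp[OF assms(8,6,7)])
  show "(\<lambda>T. tensor_lift V F (tensor_map A' B' f g T)) \<in> linear_hom (tensor A B) V"
    by (intro linear_hom_comp[OF tensor_lift_linear[OF assms(3-5,8)]] tensor_map_linear assms)
qed (simp add: tensor_map_pure[OF assms(1-4,6,7)] tensor_lift_pure[OF assms(3-5,8)]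
      linear_hom_closed[OF assms(6)] linear_hom_closed[OF assms(7)])

lemma tensor_map_tensor_map:
  assumes "vspace A" "vspace B" "vspace A'" "vspace B'" "vspace A''" "vspace B''"
    and "f \<in> linear_hom A A'" "g \<in> linear_hom B B'" "f' \<in> linear_hom A' A''" "g' \<in> linear_hom B' B''"
    and "T \<in> carrier (tensor A B)"
  shows "tensor_map A'' B'' f' g' (tensor_map A' B' f g T) =
    tensor_map A'' B'' (\<lambda>x. f' (f x)) (\<lambda>x. g' (g x)) T"
  unfolding tensor_map_def[of A'' B'']
  by (rule tensor_lift_tensor_map[OF assms(1-4) vspace_tensor assms(7,8)
        bilinear_tensor_pure_comp[OF assms(5,6,9,10)] assms(11)])

lemma tensor_map_cong:
  assumes "vspace A" "vspace B" "vspace A'" "vspace B'" "f \<in> linear_hom A A'" "g \<in> linear_hom B B'"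
    and "\<And>x. x \<in> carrier A \<Longrightarrow> f' x = f x" "\<And>x. x \<in> carrier B \<Longrightarrow> g' x = g x"
    and "T \<in> carrier (tensor A B)"
  shows "tensor_map A' B' f' g' T = tensor_map A' B' f g T"
  unfolding tensor_map_def
  by (rule tensor_lift_cong[OF assms(1,2) vspace_tensor bilinear_tensor_pure_comp[OF assms(3-6)] _ assms(9)])
    (simp add: assms)

lemma tensor_map_id:
  assumes "vspace A" "vspace B" "T \<in> carrier (tensor A B)"
  shows "tensor_map A B (\<lambda>x. x) (\<lambda>x. x) T = T"
  unfolding tensor_map_def using tensor_lift_tensor_pure[OF assms] .

section \<open>Dependence on the linear structure only\<close>

text \<open>The same vector space occurs in several records, for instance as \<^const>\<open>h4_algebra\<close> and
  \<^const>\<open>sweedler\<close>, or as a tensor product and a crossed product, and the tensor products formed from these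
  records carry the same linear structure. The facts below move between them.\<close>

definition same_space ::
    "('k, 'a, 'm) module_scheme \<Rightarrow> ('k, 'a, 'n) module_scheme \<Rightarrow> bool"
  where "same_space V W \<longleftrightarrow>
    carrier V = carrier W \<and> add V = add W \<and> ring.zero V = ring.zero W \<and> module.smult V = module.smult W"

lemma same_space_refl: "same_space V V"
  by (simp add: same_space_def)

lemma same_space_sym: "same_space V W \<Longrightarrow> same_space W V"
  by (simp add: same_space_def)

lemma same_space_vspace:
  assumes "same_space V W" "vspace V"
  shows "vspace W"
proof -
  interpret V: vspace V by fact
  note [simp] = assms(1)[unfolded same_space_def, THEN conjunct1, symmetric]
    assms(1)[unfolded same_space_def, THEN conjunct2, THEN conjunct1, symmetric]
    assms(1)[unfolded same_space_def, THEN conjunct2, THEN conjunct2, THEN conjunct1, symmetric]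
    assms(1)[unfolded same_space_def, THEN conjunct2, THEN conjunct2, THEN conjunct2, symmetric]
  show ?thesis
    by (intro vspaceI abelian_groupI)
      (auto simp: V.a_ac V.smult_l_distr V.smult_r_distr V.smult_smult intro: V.l_neg)
qed

lemma same_space_linear_hom:
  "same_space V V' \<Longrightarrow> same_space W W' \<Longrightarrow> linear_hom V W = linear_hom V' W'"
  by (simp add: same_space_def linear_hom_def)

lemma same_space_bilinear:
  "same_space A A' \<Longrightarrow> same_space B B' \<Longrightarrow> same_space V V' \<Longrightarrow> bilinear A B V F = bilinear A' B' V' F"
  using same_space_linear_hom[of A A' V V'] same_space_linear_hom[of B B' V V']
  by (simp add: bilinear_def same_space_def)

lemma same_space_tensor_rel_subset:
  assumes "p \<in> tensor_rel A B" "same_space A A'" "same_space B B'"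
  shows "p \<in> tensor_rel A' B'"
  using assms
  by induction (auto simp: same_space_def intro: tensor_rel.intros[simplified])

lemma same_space_tensor_rel:
  assumes "same_space A A'" "same_space B B'"
  shows "tensor_rel A B = tensor_rel A' B'"
  using same_space_tensor_rel_subset[OF _ assms]
    same_space_tensor_rel_subset[OF _ assms[THEN same_space_sym]]
  by blast

lemma same_space_tensor:
  assumes "same_space A A'" "same_space B B'"
  shows "tensor_coset A B = tensor_coset A' B'" "tensor_pure A B = tensor_pure A' B'"
    "same_space (tensor A B) (tensor A' B')"
proof -
  show 1: "tensor_coset A B = tensor_coset A' B'"
    by (simp add: fun_eq_iff tensor_coset_def same_space_tensor_rel[OF assms])
  then show "tensor_pure A B = tensor_pure A' B'"
    by (simp add: fun_eq_iff tensor_pure_def)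
  show "same_space (tensor A B) (tensor A' B')"
    using assms 1 by (simp add: same_space_def tensor_def)
qed

lemma same_space_tensor_lift:
  assumes "same_space V W"
  shows "tensor_lift V F = tensor_lift W F"
  by (rule ext) (use assms in \<open>simp add: tensor_lift_def finsum_def finprod_def same_space_def\<close>)


section \<open>Groups of Hopf algebra automorphisms\<close>

text \<open>Closure of the operations is all that composing and inverting Hopf maps uses, so the automorphism
  group of a crossed product is available once its operations are known to stay in the carrier.\<close>

locale prehopf =
  fixes H :: "('k::field, 'a, 'm) hopf_scheme" (structure)
  assumes vspace: "vspace H"
    and mult_closed: "x \<in> carrier H \<Longrightarrow> y \<in> carrier H \<Longrightarrow> x \<otimes> y \<in> carrier H"
    and one_closed: "\<one> \<in> carrier H"
    and comult_closed: "x \<in> carrier H \<Longrightarrow> comult H x \<in> carrier (tensor H H)"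

lemma hopf_homI:
  assumes "f \<in> linear_hom H L"
    and "\<And>x y. x \<in> carrier H \<Longrightarrow> y \<in> carrier H \<Longrightarrow> f (x \<otimes>\<^bsub>H\<^esub> y) = f x \<otimes>\<^bsub>L\<^esub> f y"
    and "f \<one>\<^bsub>H\<^esub> = \<one>\<^bsub>L\<^esub>"
    and "\<And>x. x \<in> carrier H \<Longrightarrow> comult L (f x) = tensor_map L L f f (comult H x)"
    and "\<And>x. x \<in> carrier H \<Longrightarrow> counit L (f x) = counit H x"
  shows "f \<in> hopf_hom H L"
  using assms by (auto simp: hopf_hom_def linear_hom_def ring_hom_def)

lemma hopf_homD:
  assumes "f \<in> hopf_hom H L"
  shows "f \<in> linear_hom H L"
    and "\<And>x y. x \<in> carrier H \<Longrightarrow> y \<in> carrier H \<Longrightarrow> f (x \<otimes>\<^bsub>H\<^esub> y) = f x \<otimes>\<^bsub>L\<^esub> f y"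
    and "f \<one>\<^bsub>H\<^esub> = \<one>\<^bsub>L\<^esub>"
    and "\<And>x. x \<in> carrier H \<Longrightarrow> comult L (f x) = tensor_map L L f f (comult H x)"
    and "\<And>x. x \<in> carrier H \<Longrightarrow> counit L (f x) = counit H x"
    and "\<And>x. x \<in> carrier H \<Longrightarrow> f x \<in> carrier L"
  using assms by (auto simp: hopf_hom_def linear_hom_def ring_hom_def)

lemma hopf_hom_comp:
  assumes "prehopf H" "prehopf L" "prehopf M" "f \<in> hopf_hom H L" "g \<in> hopf_hom L M"
  shows "(\<lambda>x. g (f x)) \<in> hopf_hom H M"
proof -
  note vs = assms(1-3)[THEN prehopf.vspace]
  note f = hopf_homD[OF assms(4)] and g = hopf_homD[OF assms(5)]
  show ?thesis
    by (rule hopf_homI[OF linear_hom_comp[OF g(1) f(1)]])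
      (simp_all add: f(2-) g(2-) prehopf.comult_closed[OF assms(1)]
        tensor_map_tensor_map[OF vs(1,1,2,2,3,3) f(1,1) g(1,1)])
qed

lemma hopf_hom_cong:
  assumes "prehopf H" "prehopf L" "f \<in> hopf_hom H L" "\<And>x. x \<in> carrier H \<Longrightarrow> g x = f x"
  shows "g \<in> hopf_hom H L"
proof -
  interpret H: prehopf H by fact
  note vs = assms(1,2)[THEN prehopf.vspace]
  note f = hopf_homD[OF assms(3)]
  show ?thesis
    by (rule hopf_homI[OF linear_hom_cong[OF vs(1) f(1) assms(4)]])
      (simp_all add: f(2-) assms(4) H.mult_closed H.one_closed H.comult_closed
        tensor_map_cong[OF vs(1,1,2,2) f(1,1) assms(4) assms(4)])
qed

lemma hopf_hom_id:
  assumes "prehopf H"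
  shows "(\<lambda>x. x) \<in> hopf_hom H H"
proof -
  interpret H: prehopf H by fact
  show ?thesis
    by (rule hopf_homI[OF linear_hom_id]) (simp_all add: tensor_map_id H.vspace H.comult_closed)
qed

text \<open>Comultiplicativity of the inverse \<open>g\<close> follows by applying \<open>g \<otimes> g\<close> to
  \<open>\<Delta>(f(g x)) = (f \<otimes> f) \<Delta>(g x)\<close>.\<close>

lemma hopf_hom_inverse:
  assumes "prehopf H" "prehopf L" "f \<in> hopf_hom H L"
    and g: "\<And>y. y \<in> carrier L \<Longrightarrow> g y \<in> carrier H" "\<And>y. y \<in> carrier L \<Longrightarrow> f (g y) = y"
      "\<And>x. x \<in> carrier H \<Longrightarrow> g (f x) = x"
  shows "g \<in> hopf_hom L H"
proof -
  interpret H: prehopf H by fact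
  interpret L: prehopf L by fact
  interpret VH: vspace H by (rule H.vspace)
  note f = hopf_homD[OF assms(3)]
  have g_linear: "g \<in> linear_hom L H"
  proof (rule linear_homI)
    fix x y assume "x \<in> carrier L" "y \<in> carrier L"
    then show "g (x \<oplus>\<^bsub>L\<^esub> y) = g x \<oplus>\<^bsub>H\<^esub> g y"
      using g(3)[of "g x \<oplus>\<^bsub>H\<^esub> g y"] by (simp add: g(1,2) linear_hom_add[OF f(1)])
  next
    fix c x assume "x \<in> carrier L"
    then show "g (c \<odot>\<^bsub>L\<^esub> x) = c \<odot>\<^bsub>H\<^esub> g x"
      using g(3)[of "c \<odot>\<^bsub>H\<^esub> g x"] by (simp add: g(1,2) linear_hom_smult[OF f(1)])
  qed (rule g(1))
  show ?thesis
  proof (rule hopf_homI[OF g_linear])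
    fix x y assume "x \<in> carrier L" "y \<in> carrier L"
    then show "g (x \<otimes>\<^bsub>L\<^esub> y) = g x \<otimes>\<^bsub>H\<^esub> g y"
      using g(3)[of "g x \<otimes>\<^bsub>H\<^esub> g y"] by (simp add: g(1,2) f(2) H.mult_closed)
  next
    show "g \<one>\<^bsub>L\<^esub> = \<one>\<^bsub>H\<^esub>"
      using g(3)[OF H.one_closed] f(3) by simp
  next
    fix x assume x: "x \<in> carrier L"
    have c: "comult H (g x) \<in> carrier (tensor H H)"
      by (simp add: H.comult_closed g(1) x)
    have "tensor_map H H g g (comult L x) = tensor_map H H g g (comult L (f (g x)))"
      by (simp add: g(2) x)
    also have "\<dots> = tensor_map H H (\<lambda>x. g (f x)) (\<lambda>x. g (f x)) (comult H (g x))"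
      by (simp add: f(4) g(1) x c
          tensor_map_tensor_map[OF H.vspace H.vspace L.vspace L.vspace H.vspace H.vspace f(1,1) g_linear g_linear])
    also have "\<dots> = comult H (g x)"
      using tensor_map_cong[OF H.vspace H.vspace H.vspace H.vspace linear_hom_id linear_hom_id g(3) g(3) c]
      by (simp add: tensor_map_id[OF H.vspace H.vspace c])
    finally show "comult H (g x) = tensor_map H H g g (comult L x)" ..
    show "counit H (g x) = counit L x"
      using f(5)[OF g(1)[OF x]] by (simp add: g(2) x)
  qed
qed

lemma subgroup_hopf_aut:
  assumes "prehopf H"
  shows "subgroup (hopf_hom H H \<inter> Bij (carrier H)) (BijGroup (carrier H))"
proof (rule subgroup.intro)
  interpret H: prehopf H by fact
  let ?S = "carrier H"
  show "hopf_hom H H \<inter> Bij ?S \<subseteq> carrier (BijGroup ?S)"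
    by (simp add: BijGroup_def)
  show "\<one>\<^bsub>BijGroup ?S\<^esub> \<in> hopf_hom H H \<inter> Bij ?S"
    using hopf_hom_cong[OF assms assms hopf_hom_id[OF assms]] id_Bij[of ?S]
    by (simp add: BijGroup_def)
  fix f assume f: "f \<in> hopf_hom H H \<inter> Bij ?S"
  then have b: "bij_betw f ?S ?S"
    by (simp add: Bij_def)
  have "restrict (inv_into ?S f) ?S \<in> hopf_hom H H"
    by (rule hopf_hom_inverse[OF assms assms, of f])
      (use f b hopf_homD(6)[of f H H] in
        \<open>auto simp: bij_betw_inv_into_left bij_betw_inv_into_right Bij_inv_into_mem\<close>)
  then show "inv\<^bsub>BijGroup ?S\<^esub> f \<in> hopf_hom H H \<inter> Bij ?S"
    using f inv_BijGroup[of f ?S] restrict_inv_into_Bij[of f ?S] by simp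
  fix g assume g: "g \<in> hopf_hom H H \<inter> Bij ?S"
  have "compose ?S f g \<in> hopf_hom H H"
    by (rule hopf_hom_cong[OF assms assms hopf_hom_comp[OF assms assms assms, of g f]])
      (use f g in \<open>auto simp: compose_def\<close>)
  then show "f \<otimes>\<^bsub>BijGroup ?S\<^esub> g \<in> hopf_hom H H \<inter> Bij ?S"
    using f g compose_Bij[of f ?S g] by (simp add: BijGroup_def)
qed

lemma group_hopf_aut: "prehopf H \<Longrightarrow> group (hopf_aut H)"
  unfolding hopf_aut_def
  by (rule subgroup.subgroup_is_group[OF subgroup_hopf_aut group_BijGroup])

lemma carrier_hopf_aut: "carrier (hopf_aut H) = hopf_hom H H \<inter> Bij (carrier H)"
  by (simp add: hopf_aut_def)

lemma one_hopf_aut: "\<one>\<^bsub>hopf_aut H\<^esub> = (\<lambda>x \<in> carrier H. x)"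
  by (simp add: hopf_aut_def BijGroup_def)

lemma mult_hopf_aut:
  "f \<in> carrier (hopf_aut H) \<Longrightarrow> g \<in> carrier (hopf_aut H) \<Longrightarrow>
    f \<otimes>\<^bsub>hopf_aut H\<^esub> g = compose (carrier H) f g"
  by (simp add: hopf_aut_def BijGroup_def)

lemma hopf_aut_eqI:
  assumes "f \<in> carrier (hopf_aut H)" "g \<in> carrier (hopf_aut H)"
    and "\<And>x. x \<in> carrier H \<Longrightarrow> f x = g x"
  shows "f = g"
  by (rule extensionalityI[of _ "carrier H"])
    (use assms in \<open>auto simp: carrier_hopf_aut Bij_def\<close>)

lemma restrict_in_hopf_aut:
  assumes "prehopf H" "f \<in> hopf_hom H H"
    and "\<And>x. x \<in> carrier H \<Longrightarrow> g x \<in> carrier H"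
    and "\<And>x. x \<in> carrier H \<Longrightarrow> f (g x) = x" "\<And>x. x \<in> carrier H \<Longrightarrow> g (f x) = x"
  shows "restrict f (carrier H) \<in> carrier (hopf_aut H)"
proof -
  have "bij_betw (restrict f (carrier H)) (carrier H) (carrier H)"
    by (rule bij_betw_byWitness[of _ g])
      (use assms(3-5) hopf_homD(6)[OF assms(2)] in auto)
  then show ?thesis
    using hopf_hom_cong[OF assms(1,1,2), of "restrict f (carrier H)"]
    by (simp add: carrier_hopf_aut Bij_def)
qed

lemma hopf_aut_inv_apply:
  assumes "prehopf H" "f \<in> carrier (hopf_aut H)" "x \<in> carrier H"
  shows "(inv\<^bsub>hopf_aut H\<^esub> f) (f x) = x" "f ((inv\<^bsub>hopf_aut H\<^esub> f) x) = x"
proof -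
  interpret G: group "hopf_aut H" by (rule group_hopf_aut[OF assms(1)])
  have i: "inv\<^bsub>hopf_aut H\<^esub> f \<in> carrier (hopf_aut H)"
    using assms(2) by simp
  show "(inv\<^bsub>hopf_aut H\<^esub> f) (f x) = x"
    using fun_cong[OF G.l_inv[OF assms(2)], of x] assms(3)
    by (simp add: mult_hopf_aut[OF i assms(2)] one_hopf_aut compose_def)
  show "f ((inv\<^bsub>hopf_aut H\<^esub> f) x) = x"
    using fun_cong[OF G.r_inv[OF assms(2)], of x] assms(3)
    by (simp add: mult_hopf_aut[OF assms(2) i] one_hopf_aut compose_def)
qed


section \<open>The ground field as a vector space\<close>

definition scalars :: "('k::field, 'k) module"
  where "scalars = ring.extend ground \<lparr>module.smult = (*)\<rparr>"

lemma scalars_simps [simp]: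
  "carrier (scalars :: ('k::field, 'k) module) = UNIV"
  "x \<oplus>\<^bsub>(scalars :: ('k, 'k) module)\<^esub> y = x + y"
  "c \<odot>\<^bsub>(scalars :: ('k, 'k) module)\<^esub> x = c * x"
  "\<zero>\<^bsub>(scalars :: ('k, 'k) module)\<^esub> = 0"
  by (simp_all add: scalars_def ring.defs ring_of_type_algebra_def)

lemma vspace_scalars: "vspace scalars"
proof (rule vspaceI)
  have "\<exists>y. y + x = 0" for x :: "'a::field"
    by (rule exI[of _ "- x"]) simp
  then show "abelian_group (scalars :: ('a::field, 'a) module)"
    by (intro abelian_groupI) (auto simp: add_ac)
qed (auto simp: algebra_simps)

lemma bilinear_smult: "vspace V \<Longrightarrow> bilinear scalars V V (module.smult V)"
  by (intro bilinearI linear_homI)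
    (auto simp: vspace.smult_l_distr vspace.smult_r_distr vspace.smult_closed vspace.smult_smult mult.commute)

lemma bilinear_scalars_mult: "bilinear scalars scalars scalars (*)"
  by (intro bilinearI linear_homI) (auto simp: algebra_simps)


section \<open>Sweedler's Hopf algebra\<close>

lemma sweedler_simps [simp]:
  "carrier (sweedler :: ('k::field, 'k h4) hopf) = UNIV"
  "s \<oplus>\<^bsub>(sweedler :: ('k, 'k h4) hopf)\<^esub> t = H4 (co_1 s + co_1 t) (co_g s + co_g t) (co_x s + co_x t) (co_gx s + co_gx t)"
  "c \<odot>\<^bsub>(sweedler :: ('k, 'k h4) hopf)\<^esub> s = H4 (c * co_1 s) (c * co_g s) (c * co_x s) (c * co_gx s)"
  "\<zero>\<^bsub>(sweedler :: ('k, 'k h4) hopf)\<^esub> = H4 0 0 0 0"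
  "\<one>\<^bsub>(sweedler :: ('k, 'k h4) hopf)\<^esub> = H4 1 0 0 0"
  "s \<otimes>\<^bsub>(sweedler :: ('k, 'k h4) hopf)\<^esub> t = H4
       (co_1 s * co_1 t + co_g s * co_g t)
       (co_1 s * co_g t + co_g s * co_1 t)
       (co_1 s * co_x t + co_g s * co_gx t + co_x s * co_1 t - co_gx s * co_g t)
       (co_1 s * co_gx t + co_g s * co_x t + co_gx s * co_1 t - co_x s * co_g t)"
  "counit sweedler s = co_1 s + co_g s"
  by (simp_all add: sweedler_def h4_algebra_def module.defs)

lemma same_space_sweedler: "same_space h4_algebra sweedler"
  by (simp add: same_space_def sweedler_def h4_algebra_def module.defs)

lemma vspace_sweedler: "vspace (sweedler :: ('k::field, 'k h4) hopf)"
proof (rule vspaceI)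
  have "\<exists>y. y \<oplus>\<^bsub>sweedler\<^esub> x = \<zero>\<^bsub>sweedler\<^esub>" for x :: "'k h4"
    by (rule exI[of _ "H4 (- co_1 x) (- co_g x) (- co_x x) (- co_gx x)"]) simp
  then show "abelian_group (sweedler :: ('k, 'k h4) hopf)"
    by (intro abelian_groupI) (auto simp: add_ac)
qed (auto simp: algebra_simps)

lemma h4_coordinates_linear:
  "co_1 \<in> linear_hom sweedler scalars" "co_g \<in> linear_hom sweedler scalars"
  "co_x \<in> linear_hom sweedler scalars" "co_gx \<in> linear_hom sweedler scalars"
  "counit sweedler \<in> linear_hom sweedler scalars"
  by (auto intro!: linear_homI simp: algebra_simps)

lemma bilinear_sweedler_mult: "bilinear sweedler sweedler sweedler (monoid.mult sweedler)"
  by (intro bilinearI linear_homI) (auto simp: algebra_simps)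

lemma h4_v_linear: "h4_v \<beta> \<in> linear_hom sweedler sweedler"
  by (intro linear_homI) (auto simp: h4_v_def algebra_simps)

lemma sweedler_linear_expand:
  assumes "vspace V" "f \<in> linear_hom sweedler V"
  shows "f s = co_1 s \<odot>\<^bsub>V\<^esub> f (H4 1 0 0 0) \<oplus>\<^bsub>V\<^esub> co_g s \<odot>\<^bsub>V\<^esub> f h4_g \<oplus>\<^bsub>V\<^esub> co_x s \<odot>\<^bsub>V\<^esub> f h4_x
    \<oplus>\<^bsub>V\<^esub> co_gx s \<odot>\<^bsub>V\<^esub> f h4_gx"
proof -
  have "s = co_1 s \<odot>\<^bsub>sweedler\<^esub> H4 1 0 0 0 \<oplus>\<^bsub>sweedler\<^esub> co_g s \<odot>\<^bsub>sweedler\<^esub> h4_g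
      \<oplus>\<^bsub>sweedler\<^esub> co_x s \<odot>\<^bsub>sweedler\<^esub> h4_x \<oplus>\<^bsub>sweedler\<^esub> co_gx s \<odot>\<^bsub>sweedler\<^esub> h4_gx" (is "_ = ?r")
    by (simp add: h4_g_def h4_x_def h4_gx_def)
  then have "f s = f ?r"
    by (rule arg_cong)
  also have "\<dots> = co_1 s \<odot>\<^bsub>V\<^esub> f (H4 1 0 0 0) \<oplus>\<^bsub>V\<^esub> co_g s \<odot>\<^bsub>V\<^esub> f h4_g \<oplus>\<^bsub>V\<^esub> co_x s \<odot>\<^bsub>V\<^esub> f h4_x
      \<oplus>\<^bsub>V\<^esub> co_gx s \<odot>\<^bsub>V\<^esub> f h4_gx"
    by (simp only: linear_hom_add[OF assms(2)] linear_hom_smult[OF assms(2)] sweedler_simps(1) UNIV_I)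
  finally show ?thesis .
qed

lemma sweedler_comult:
  fixes s :: "'k::field h4"
  defines "W \<equiv> tensor sweedler (sweedler :: ('k, 'k h4) hopf)"
    and "t \<equiv> tensor_pure sweedler (sweedler :: ('k, 'k h4) hopf)"
  shows "comult sweedler s = co_1 s \<odot>\<^bsub>W\<^esub> t (H4 1 0 0 0) (H4 1 0 0 0) \<oplus>\<^bsub>W\<^esub> co_g s \<odot>\<^bsub>W\<^esub> t h4_g h4_g
    \<oplus>\<^bsub>W\<^esub> co_x s \<odot>\<^bsub>W\<^esub> (t h4_x (H4 1 0 0 0) \<oplus>\<^bsub>W\<^esub> t h4_g h4_x)
    \<oplus>\<^bsub>W\<^esub> co_gx s \<odot>\<^bsub>W\<^esub> (t h4_gx h4_g \<oplus>\<^bsub>W\<^esub> t (H4 1 0 0 0) h4_gx)"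
proof -
  have ss: "tensor_pure h4_algebra h4_algebra = t" "same_space (tensor h4_algebra h4_algebra) W"
    unfolding W_def t_def by (rule same_space_tensor[OF same_space_sweedler same_space_sweedler])+
  have one: "\<one>\<^bsub>(h4_algebra :: ('k, 'k h4) module)\<^esub> = H4 1 0 0 0"
    by (simp add: h4_algebra_def)
  have "comult (sweedler :: ('k, 'k h4) hopf) = h4_comult"
    by (simp add: sweedler_def module.defs)
  then show ?thesis
    using ss(2) by (simp add: h4_comult_def Let_def ss(1) one same_space_def)
qed

lemma sweedler_comult_closed:
  "comult sweedler s \<in> carrier (tensor sweedler (sweedler :: ('k::field, 'k h4) hopf))"
proof -
  interpret W: vspace "tensor sweedler (sweedler :: ('k, 'k h4) hopf)" by (rule vspace_tensor)
  show ?thesis by (simp add: sweedler_comult)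
qed

lemma sweedler_comult_linear:
  "comult sweedler \<in> linear_hom sweedler (tensor sweedler (sweedler :: ('k::field, 'k h4) hopf))"
proof -
  interpret W: vspace "tensor sweedler (sweedler :: ('k, 'k h4) hopf)" by (rule vspace_tensor)
  show ?thesis
    by (intro linear_homI sweedler_comult_closed)
      (simp_all add: sweedler_comult W.smult_l_distr W.smult_r_distr W.smult_smult W.a_ac)
qed

lemma prehopf_sweedler: "prehopf (sweedler :: ('k::field, 'k h4) hopf)"
  by (intro prehopf.intro) (simp_all add: vspace_sweedler sweedler_comult_closed)

text \<open>Sweedler sums over \<open>H\<^sub>4\<close> become explicit: only the six pure tensors in the comultiplication of the
  basis contribute.\<close>

lemma tensor_lift_sweedler_comult:
  fixes V :: "('k::field, 'v, 'm) module_scheme" (structure)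
  assumes "vspace V" "bilinear sweedler sweedler V F"
  shows "tensor_lift V F (comult sweedler s) =
    co_1 s \<odot> F (H4 1 0 0 0) (H4 1 0 0 0) \<oplus> co_g s \<odot> F h4_g h4_g
    \<oplus> co_x s \<odot> (F h4_x (H4 1 0 0 0) \<oplus> F h4_g h4_x)
    \<oplus> co_gx s \<odot> (F h4_gx h4_g \<oplus> F (H4 1 0 0 0) h4_gx)"
proof -
  interpret W: vspace "tensor sweedler (sweedler :: ('k, 'k h4) hopf)" by (rule vspace_tensor)
  note lin = tensor_lift_linear[OF vspace_sweedler vspace_sweedler assms]
  show ?thesis
    by (simp add: sweedler_comult linear_hom_add[OF lin] linear_hom_smult[OF lin]
        tensor_lift_pure[OF vspace_sweedler vspace_sweedler assms])
qed

lemma h4_v_comult: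
  fixes \<beta> :: "'k::field"
  shows "comult sweedler (h4_v \<beta> s) = tensor_map sweedler sweedler (h4_v \<beta>) (h4_v \<beta>) (comult sweedler s)"
proof -
  interpret W: vspace "tensor sweedler (sweedler :: ('k, 'k h4) hopf)" by (rule vspace_tensor)
  have P: "bilinear sweedler sweedler (tensor sweedler sweedler)
      (tensor_pure sweedler (sweedler :: ('k, 'k h4) hopf))"
    by (rule bilinear_tensor_pure[OF vspace_sweedler vspace_sweedler])
  have v: "h4_v \<beta> (H4 1 0 0 0) = H4 1 0 0 0" "h4_v \<beta> h4_g = h4_g"
    "h4_v \<beta> h4_x = \<beta> \<odot>\<^bsub>sweedler\<^esub> h4_x" "h4_v \<beta> h4_gx = \<beta> \<odot>\<^bsub>sweedler\<^esub> h4_gx"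
    by (simp_all add: h4_v_def h4_g_def h4_x_def h4_gx_def)
  have co: "co_1 (h4_v \<beta> s) = co_1 s" "co_g (h4_v \<beta> s) = co_g s"
    "co_x (h4_v \<beta> s) = co_x s * \<beta>" "co_gx (h4_v \<beta> s) = co_gx s * \<beta>"
    by (simp_all add: h4_v_def mult.commute)
  show ?thesis
    unfolding tensor_map_def
      tensor_lift_sweedler_comult[OF vspace_tensor bilinear_tensor_pure_comp[OF vspace_sweedler vspace_sweedler
        h4_v_linear h4_v_linear]] v
      sweedler_comult[of "h4_v \<beta> s"] co
    by (simp add: linear_hom_smult[OF bilinear_left[OF P]] linear_hom_smult[OF bilinear_right[OF P]]
        W.smult_r_distr W.smult_smult del: sweedler_simps(3))
qed

lemma h4_v_mult: "h4_v \<beta> (s \<otimes>\<^bsub>sweedler\<^esub> t) = h4_v \<beta> s \<otimes>\<^bsub>sweedler\<^esub> h4_v \<beta> t"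
  by (simp add: h4_v_def algebra_simps)

lemma h4_v_1: "h4_v 1 s = s"
  by (simp add: h4_v_def)

lemma h4_v_h4_v: "h4_v \<beta> (h4_v \<gamma> s) = h4_v (\<beta> * \<gamma>) s"
  by (simp add: h4_v_def)


section \<open>Crossed products by the cocycle\<close>

context hopf_algebra
begin

lemma vspace: "vspace H"
  by (rule vspace.intro[OF module])

lemma comult_closed: "x \<in> carrier H \<Longrightarrow> comult H x \<in> carrier (tensor H H)"
  using linear_hom_closed[OF comult_linear] .

lemma mult_closed: "x \<in> carrier H \<Longrightarrow> y \<in> carrier H \<Longrightarrow> x \<otimes> y \<in> carrier H"
  by (rule ring.ring_simprules(5)[OF ring])

lemma one_closed: "\<one> \<in> carrier H"
  by (rule ring.ring_simprules(6)[OF ring])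

lemma prehopf: "prehopf H"
  by (intro prehopf.intro vspace comult_closed mult_closed one_closed)

lemma bilinear_mult: "bilinear H H H (monoid.mult H)"
  by (intro bilinearI linear_homI)
    (simp_all add: mult_closed ring.ring_simprules[OF ring] smult_mult_left smult_mult_right)

lemma counit_linear: "counit H \<in> linear_hom H scalars"
  using counit_ring_hom by (intro linear_homI) (auto simp: ring_hom_def counit_smult)

lemma counit_mult: "x \<in> carrier H \<Longrightarrow> y \<in> carrier H \<Longrightarrow> counit H (x \<otimes> y) = counit H x * counit H y"
  using counit_ring_hom by (auto simp: ring_hom_def)

lemma counit_one: "counit H \<one> = 1"
  using counit_ring_hom by (auto simp: ring_hom_def)

text \<open>The counit axiom applied to \<open>\<Delta> z = z \<otimes> 1 + 1 \<otimes> z\<close> reads \<open>z = \<epsilon>(z) 1 + z\<close>.\<close>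

lemma counit_primitive:
  assumes "z \<in> carrier H"
    "comult H z = tensor_pure H H z \<one> \<oplus>\<^bsub>tensor H H\<^esub> tensor_pure H H \<one> z"
  shows "counit H z = 0"
proof -
  interpret V: vspace H by (rule vspace)
  have b: "bilinear H H H (\<lambda>y z. counit H y \<odot> z)"
    by (rule bilinear_precomp[OF bilinear_smult[OF vspace] counit_linear linear_hom_id])
  have "z = tensor_lift H (\<lambda>y z. counit H y \<odot> z) (comult H z)"
    using counit_left[OF assms(1)] ..
  also have "\<dots> = counit H z \<odot> \<one> \<oplus> z"
    using assms one_closed
    by (simp add: linear_hom_add[OF tensor_lift_linear[OF vspace vspace vspace b]]
        tensor_lift_pure[OF vspace vspace vspace b] counit_one)
  finally have "counit H z \<odot> \<one> = \<zero>"
    using assms(1) one_closed by (metis V.add.l_cancel_one V.smult_closed V.a_comm)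
  then have "counit H (counit H z \<odot> \<one>) = 0"
    using linear_hom_zero[OF vspace vspace_scalars counit_linear] by simp
  then show ?thesis
    using one_closed by (simp add: counit_smult counit_one)
qed

end

text \<open>The counit vanishes on primitive elements. This is what makes \<open>z # h \<mapsto> \<epsilon>(z) h\<close> compatible with the
  relation \<open>x\<^sup>2 = a\<close> of the crossed product.\<close>

locale crossed_product = hopf_algebra A
  for A :: "('k::field, 'a, 'm) hopf_scheme" (structure) +
  fixes a :: 'a
  assumes a_closed: "a \<in> carrier A"
    and counit_a: "counit A a = 0"
begin

abbreviation S :: "('k, 'k h4) hopf" where "S \<equiv> sweedler"
abbreviation C :: "('k, (('a \<times> 'k h4) \<Rightarrow>\<^sub>0 'k) set) hopf" where "C \<equiv> crossed A a"
abbreviation P :: "'a \<Rightarrow> 'k h4 \<Rightarrow> (('a \<times> 'k h4) \<Rightarrow>\<^sub>0 'k) set" where "P \<equiv> tensor_pure A S"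
abbreviation e :: "'k h4" where "e \<equiv> H4 1 0 0 0"

lemma same_space_crossed: "same_space (tensor A S) C"
  by (simp add: same_space_def crossed_def module.defs)

lemma crossed_simps:
  "carrier C = carrier (tensor A S)"
  "monoid.mult C = crossed_mult A a"
  "\<one>\<^bsub>C\<^esub> = P \<one> e"
  "counit C = tensor_lift scalars (\<lambda>x y. counit A x * counit S y)"
  by (simp_all add: crossed_def module.defs tensor_counit_def scalars_def)

lemmas vA = vspace
lemmas vS = vspace_sweedler

lemma vC: "vspace C"
  by (rule same_space_vspace[OF same_space_crossed vspace_tensor])

sublocale A: vspace A by (rule vA)
sublocale C: vspace C by (rule vC)
sublocale CC: vspace "tensor C C" by (rule vspace_tensor)

lemma bilinear_P: "bilinear A S C P"
  using bilinear_tensor_pure[OF vA vS]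
    same_space_bilinear[OF same_space_refl same_space_refl same_space_crossed] by blast

lemma P_closed [simp]: "z \<in> carrier A \<Longrightarrow> P z h \<in> carrier C"
  by (simp add: crossed_simps)

lemma lift_C: "tensor_lift (tensor A S) = tensor_lift C"
  by (rule ext same_space_tensor_lift[OF same_space_crossed])+

lemma lift_CC: "tensor_lift (tensor (tensor A S) (tensor A S)) = tensor_lift (tensor C C)"
  by (rule ext same_space_tensor_lift same_space_tensor same_space_crossed)+

lemma linear_lift: "vspace V \<Longrightarrow> bilinear A S V F \<Longrightarrow> tensor_lift V F \<in> linear_hom C V"
  using tensor_lift_linear[OF vA vS] same_space_linear_hom[OF same_space_crossed same_space_refl] by blast

lemma lift_P: "vspace V \<Longrightarrow> bilinear A S V F \<Longrightarrow> z \<in> carrier A \<Longrightarrow> tensor_lift V F (P z h) = F z h"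
  using tensor_lift_pure[OF vA vS] by simp

lemma crossed_ext:
  assumes "vspace V" "f \<in> linear_hom C V" "g \<in> linear_hom C V"
    and "\<And>z h. z \<in> carrier A \<Longrightarrow> f (P z h) = g (P z h)"
    and "T \<in> carrier C"
  shows "f T = g T"
proof (rule tensor_ext[OF assms(1)])
  show "f \<in> linear_hom (tensor A S) V" "g \<in> linear_hom (tensor A S) V"
    using assms(2,3) same_space_linear_hom[OF same_space_crossed same_space_refl] by blast+
qed (use assms(4,5) in \<open>simp_all add: crossed_simps\<close>)

lemma crossed_ext2:
  assumes "vspace V" "bilinear C C V F" "bilinear C C V G"
    and "\<And>z h c h'. z \<in> carrier A \<Longrightarrow> c \<in> carrier A \<Longrightarrow> F (P z h) (P c h') = G (P z h) (P c h')"
    and "T \<in> carrier C" "U \<in> carrier C"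
  shows "F T U = G T U"
proof (rule crossed_ext[OF assms(1) bilinear_left[OF assms(2,6)] bilinear_left[OF assms(3,6)] _ assms(5)])
  fix z h assume z: "z \<in> carrier A"
  show "F (P z h) U = G (P z h) U"
    by (rule crossed_ext[OF assms(1) bilinear_right[OF assms(2)] bilinear_right[OF assms(3)] _ assms(6)])
      (use z assms(4) in auto)
qed

lemma cocycle_closed [simp]: "cocycle A a s t \<in> carrier A"
  by (simp add: cocycle_def a_closed one_closed)

lemma bilinear_cocycle: "bilinear S S A (cocycle A a)"
proof -
  have "bilinear S S scalars (\<lambda>s t. (co_1 s + co_g s) * (co_1 t + co_g t))"
    "bilinear S S scalars (\<lambda>s t. (co_x s + co_gx s) * (co_x t - co_gx t))"
    by (intro bilinearI linear_homI; simp add: algebra_simps)+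
  note b = this
  have "(\<lambda>c. c \<odot> w) \<in> linear_hom scalars A" if "w \<in> carrier A" for w
    by (rule bilinear_left[OF bilinear_smult[OF vA] that])
  then have "bilinear S S A (\<lambda>s t. ((co_1 s + co_g s) * (co_1 t + co_g t)) \<odot> \<one>)"
    "bilinear S S A (\<lambda>s t. ((co_x s + co_gx s) * (co_x t - co_gx t)) \<odot> a)"
    using bilinear_comp[OF _ b(1)] bilinear_comp[OF _ b(2)] one_closed a_closed by blast+
  then show ?thesis
    unfolding cocycle_def bilinear_def by (auto intro!: linear_hom_sum[OF vA])
qed

lemma counit_cocycle: "counit A (cocycle A a s t) = counit S s * counit S t"
  by (simp add: cocycle_def linear_hom_add[OF counit_linear] counit_smult a_closed one_closed
      counit_a counit_one)

text \<open>The product of \<open>z # h\<close> and \<open>c # h'\<close> is a Sweedler sum over \<open>h\<close> of Sweedler sums over \<open>h'\<close>.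
  Naming its layers lets linearity in each of the four variables be established from the inside out.\<close>

definition cross_summand where
  "cross_summand z c h1 h2 h1' h2' = P (z \<otimes> c \<otimes> cocycle A a h1 h1') (h2 \<otimes>\<^bsub>S\<^esub> h2')"

definition cross_inner where
  "cross_inner z c h' h1 h2 = tensor_lift C (cross_summand z c h1 h2) (comult S h')"

definition cross_pure where
  "cross_pure z h c h' = tensor_lift C (cross_inner z c h') (comult S h)"

lemma bilinear_cross_summand_right:
  assumes "z \<in> carrier A" "c \<in> carrier A"
  shows "bilinear S S C (cross_summand z c h1 h2)"
  unfolding cross_summand_def
  by (intro bilinear_precomp[OF bilinear_P] linear_hom_bilinear_right[OF bilinear_mult]
      bilinear_right[OF bilinear_cocycle] bilinear_right[OF bilinear_sweedler_mult] mult_closed assms)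
    simp_all

lemma bilinear_cross_summand_left:
  assumes "z \<in> carrier A" "c \<in> carrier A"
  shows "bilinear S S C (\<lambda>h1 h2. cross_summand z c h1 h2 h1' h2')"
  unfolding cross_summand_def
  by (intro bilinear_precomp[OF bilinear_P] linear_hom_bilinear_right[OF bilinear_mult]
      bilinear_left[OF bilinear_cocycle] bilinear_left[OF bilinear_sweedler_mult] mult_closed assms)
    simp_all

lemma linear_cross_summand:
  "c \<in> carrier A \<Longrightarrow> (\<lambda>z. cross_summand z c h1 h2 h1' h2') \<in> linear_hom A C"
  "z \<in> carrier A \<Longrightarrow> (\<lambda>c. cross_summand z c h1 h2 h1' h2') \<in> linear_hom A C"
  unfolding cross_summand_def
  by (intro linear_hom_bilinear_left[OF bilinear_P] linear_hom_bilinear_left[OF bilinear_mult]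
      bilinear_left[OF bilinear_mult] bilinear_right[OF bilinear_mult]; simp)+

lemma bilinear_cross_inner:
  assumes "z \<in> carrier A" "c \<in> carrier A"
  shows "bilinear S S C (cross_inner z c h')"
  unfolding cross_inner_def
  by (intro bilinearI linear_hom_tensor_lift_param[OF vS vS vC vS] sweedler_comult_closed
      bilinear_cross_summand_right bilinear_right[OF bilinear_cross_summand_left]
      bilinear_left[OF bilinear_cross_summand_left] assms) simp_all

lemma linear_cross_inner:
  assumes "z \<in> carrier A" "c \<in> carrier A"
  shows "(\<lambda>h'. cross_inner z c h' h1 h2) \<in> linear_hom S C"
    and "(\<lambda>z. cross_inner z c h' h1 h2) \<in> linear_hom A C"
    and "(\<lambda>c. cross_inner z c h' h1 h2) \<in> linear_hom A C"
  unfolding cross_inner_def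
  by (intro linear_hom_comp[OF tensor_lift_linear[OF vS vS vC]] sweedler_comult_linear
      bilinear_cross_summand_right linear_hom_tensor_lift_param[OF vS vS vC vA]
      linear_cross_summand sweedler_comult_closed assms; assumption)+

lemma bilinear_cross_pure:
  assumes "z \<in> carrier A"
  shows "bilinear A S C (cross_pure z h)" "bilinear A S C (\<lambda>c h'. cross_pure c h' z h)"
  unfolding cross_pure_def
  by (intro bilinearI linear_hom_tensor_lift_param[OF vS vS vC] vA vS
      linear_hom_comp[OF tensor_lift_linear[OF vS vS vC]] bilinear_cross_inner linear_cross_inner
      sweedler_comult_linear sweedler_comult_closed assms; (rule assms | assumption)?)+

text \<open>Multilinearity of \<^const>\<open>cross_pure\<close> makes the product independent of the representatives
  that occur in its definition.\<close>

lemma bilinear_crossed_mult: "bilinear C C C (monoid.mult C)"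
  and crossed_mult_pure:
    "z \<in> carrier A \<Longrightarrow> c \<in> carrier A \<Longrightarrow> P z h \<otimes>\<^bsub>C\<^esub> P c h' = cross_pure z h c h'"
proof -
  have eq: "T \<otimes>\<^bsub>C\<^esub> U = tensor_lift C (\<lambda>z h. tensor_lift C (cross_pure z h) U) T" for T U
    by (simp add: crossed_simps crossed_mult_def Let_def lift_C cross_pure_def[abs_def] cross_inner_def[abs_def]
        cross_summand_def[abs_def] del: sweedler_simps)
  have b: "bilinear A S C (\<lambda>z h. tensor_lift C (cross_pure z h) U)" if "U \<in> carrier C" for U
    using that unfolding crossed_simps
    by (intro bilinearI linear_hom_tensor_lift_param[OF vA vS vC] vA vS bilinear_cross_pure
        bilinear_right[OF bilinear_cross_pure(2)] bilinear_left[OF bilinear_cross_pure(2)];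
        simp)
  show "bilinear C C C (monoid.mult C)"
  proof (intro bilinearI)
    fix U assume "U \<in> carrier C"
    then show "(\<lambda>T. T \<otimes>\<^bsub>C\<^esub> U) \<in> linear_hom C C"
      unfolding eq by (intro linear_lift vC b)
  next
    fix T assume "T \<in> carrier C"
    then show "(\<lambda>U. T \<otimes>\<^bsub>C\<^esub> U) \<in> linear_hom C C"
      unfolding eq unfolding crossed_simps(1)
      by (intro linear_hom_tensor_lift_param[OF vA vS vC vC] b linear_lift vC bilinear_cross_pure)
  qed
  show "P z h \<otimes>\<^bsub>C\<^esub> P c h' = cross_pure z h c h'" if "z \<in> carrier A" "c \<in> carrier A"
    using that by (simp add: eq lift_P[OF vC b] lift_P[OF vC bilinear_cross_pure(1)])
qed


lemma crossed_mult_closed: "T \<in> carrier C \<Longrightarrow> U \<in> carrier C \<Longrightarrow> T \<otimes>\<^bsub>C\<^esub> U \<in> carrier C"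
  using bilinear_closed[OF bilinear_crossed_mult] .

lemma sweedler_counit_left: "tensor_lift S (\<lambda>y z. counit S y \<odot>\<^bsub>S\<^esub> z) (comult S s) = s"
  and sweedler_counit_right: "tensor_lift S (\<lambda>y z. counit S z \<odot>\<^bsub>S\<^esub> y) (comult S s) = s"
proof -
  have b: "bilinear S S S (\<lambda>y z. counit S y \<odot>\<^bsub>S\<^esub> z)"
    by (rule bilinear_precomp[OF bilinear_smult[OF vS] h4_coordinates_linear(5) linear_hom_id])
  show "tensor_lift S (\<lambda>y z. counit S y \<odot>\<^bsub>S\<^esub> z) (comult S s) = s"
    unfolding tensor_lift_sweedler_comult[OF vS b] by (simp add: h4_g_def h4_x_def h4_gx_def)
  show "tensor_lift S (\<lambda>y z. counit S z \<odot>\<^bsub>S\<^esub> y) (comult S s) = s"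
    unfolding tensor_lift_sweedler_comult[OF vS bilinear_flip[OF b]]
    by (simp add: h4_g_def h4_x_def h4_gx_def)
qed

lemma smult_P: "z \<in> carrier A \<Longrightarrow> P (c \<odot> z) h = c \<odot>\<^bsub>C\<^esub> P z h"
  "z \<in> carrier A \<Longrightarrow> P z (c \<odot>\<^bsub>S\<^esub> h) = c \<odot>\<^bsub>C\<^esub> P z h"
  using linear_hom_smult[OF bilinear_left[OF bilinear_P]]
    linear_hom_smult[OF bilinear_right[OF bilinear_P]] by simp_all

lemma P_zero [simp]: "P \<zero> h = \<zero>\<^bsub>C\<^esub>"
  using linear_hom_zero[OF vA vC bilinear_left[OF bilinear_P, of h]] by simp

lemma P_zero_right [simp]: "z \<in> carrier A \<Longrightarrow> P z (H4 0 0 0 0) = \<zero>\<^bsub>C\<^esub>"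
  using linear_hom_zero[OF vS vC bilinear_right[OF bilinear_P, of z]] by simp

lemmas mult_one = monoid.r_one[OF ring.is_monoid[OF ring]]

lemmas cross_pure_expand =
  tensor_lift_sweedler_comult[OF vC bilinear_cross_inner, folded cross_pure_def]
  tensor_lift_sweedler_comult[OF vC bilinear_cross_summand_right, folded cross_inner_def]

lemma cross_summand_closed [simp]:
  "z \<in> carrier A \<Longrightarrow> c \<in> carrier A \<Longrightarrow> cross_summand z c h1 h2 h1' h2' \<in> carrier C"
  by (simp add: cross_summand_def mult_closed)

lemma sweedler_P_expand:
  assumes "z \<in> carrier A"
  shows "P z h = co_1 h \<odot>\<^bsub>C\<^esub> P z e \<oplus>\<^bsub>C\<^esub> co_g h \<odot>\<^bsub>C\<^esub> P z h4_g \<oplus>\<^bsub>C\<^esub> co_x h \<odot>\<^bsub>C\<^esub> P z h4_x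
    \<oplus>\<^bsub>C\<^esub> co_gx h \<odot>\<^bsub>C\<^esub> P z h4_gx"
  by (rule sweedler_linear_expand[OF vC bilinear_right[OF bilinear_P assms]])

lemma crossed_mult_left_A:
  assumes "z \<in> carrier A" "c \<in> carrier A"
  shows "P z e \<otimes>\<^bsub>C\<^esub> P c h = P (z \<otimes> c) h"
  using assms
  by (simp add: crossed_mult_pure cross_pure_expand cross_summand_def cocycle_def
      h4_g_def h4_x_def h4_gx_def mult_closed one_closed a_closed ring.ring_simprules[OF ring] mult_one
      sweedler_P_expand[of "z \<otimes> c" h])

text \<open>The crossed product is obtained from \<open>A \<otimes> H\<^sub>4\<close> by deforming \<open>x\<^sup>2 = 0\<close> into \<open>x\<^sup>2 = a\<close>.\<close>

lemma crossed_products: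
  "P \<one> h4_g \<otimes>\<^bsub>C\<^esub> P \<one> h4_x = P \<one> h4_gx"
  "P \<one> h4_x \<otimes>\<^bsub>C\<^esub> P \<one> h4_g = P \<one> ((- 1) \<odot>\<^bsub>S\<^esub> h4_gx)"
  "P \<one> h4_x \<otimes>\<^bsub>C\<^esub> P \<one> h4_x = P a e"
  by (simp_all add: crossed_mult_pure cross_pure_expand cross_summand_def cocycle_def
      h4_g_def h4_x_def h4_gx_def mult_closed one_closed a_closed ring.ring_simprules[OF ring] mult_one)

definition comult_pure where
  "comult_pure x y = tensor_lift (tensor C C) (\<lambda>x1 x2. tensor_lift (tensor C C)
    (\<lambda>y1 y2. tensor_pure C C (P x1 y1) (P x2 y2)) (comult S y)) (comult A x)"

lemma bilinear_P_P:
  assumes "vspace V" "bilinear C C V B"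
  shows "x1 \<in> carrier A \<Longrightarrow> x2 \<in> carrier A \<Longrightarrow> bilinear S S V (\<lambda>y1 y2. B (P x1 y1) (P x2 y2))"
    and "bilinear A A V (\<lambda>x1 x2. B (P x1 y1) (P x2 y2))"
    and "bilinear A A V (\<lambda>x1 x2. tensor_lift V (\<lambda>y1 y2. B (P x1 y1) (P x2 y2)) (comult S y))"
    and "x \<in> carrier A \<Longrightarrow> tensor_lift V (\<lambda>x1 x2. tensor_lift V (\<lambda>y1 y2. B (P x1 y1) (P x2 y2)) (comult S y))
      (comult A x) \<in> carrier V"
proof -
  show 1: "bilinear S S V (\<lambda>y1 y2. B (P x1 y1) (P x2 y2))"
    if "x1 \<in> carrier A" "x2 \<in> carrier A" for x1 x2
    using that by (intro bilinear_precomp[OF assms(2)] bilinear_right[OF bilinear_P])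
  show 2: "bilinear A A V (\<lambda>x1 x2. B (P x1 y1) (P x2 y2))" for y1 y2
    by (intro bilinear_precomp[OF assms(2)] bilinear_left[OF bilinear_P]) simp_all
  show 3: "bilinear A A V (\<lambda>x1 x2. tensor_lift V (\<lambda>y1 y2. B (P x1 y1) (P x2 y2)) (comult S y))"
    by (intro bilinearI linear_hom_tensor_lift_param[OF vS vS assms(1) vA] 1 sweedler_comult_closed
        bilinear_left[OF 2] bilinear_right[OF 2])
  show "tensor_lift V (\<lambda>x1 x2. tensor_lift V (\<lambda>y1 y2. B (P x1 y1) (P x2 y2)) (comult S y))
      (comult A x) \<in> carrier V" if "x \<in> carrier A"
    by (rule tensor_lift_closed[OF vA vA assms(1) 3 comult_closed[OF that]])
qed

lemmas bilinear_CC = bilinear_tensor_pure[OF vC vC]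

lemma bilinear_comult_pure: "bilinear A S (tensor C C) comult_pure"
proof (intro bilinearI)
  fix x assume x: "x \<in> carrier A"
  show "comult_pure x \<in> linear_hom S (tensor C C)"
    unfolding comult_pure_def
    by (intro linear_hom_tensor_lift_param[OF vA vA vspace_tensor vS] bilinear_P_P(3) vspace_tensor
        bilinear_CC comult_closed x linear_hom_comp[OF tensor_lift_linear[OF vS vS vspace_tensor]]
        bilinear_P_P(1) sweedler_comult_linear)
next
  fix y :: "'k h4"
  show "(\<lambda>x. comult_pure x y) \<in> linear_hom A (tensor C C)"
    unfolding comult_pure_def
    by (intro linear_hom_comp[OF tensor_lift_linear[OF vA vA vspace_tensor]] bilinear_P_P(3)
        vspace_tensor bilinear_CC comult_linear)
qed

lemma comult_crossed: "comult C = tensor_lift (tensor C C) comult_pure"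
proof -
  have "tensor_pure (tensor A S) (tensor A S) = tensor_pure C C"
    by (rule same_space_tensor[OF same_space_crossed same_space_crossed])
  moreover have "comult C = tensor_comult A S"
    by (simp add: crossed_def module.defs)
  ultimately show ?thesis
    by (simp only: tensor_comult_def Let_def lift_CC comult_pure_def[abs_def])
qed

lemma comult_crossed_linear: "comult C \<in> linear_hom C (tensor C C)"
  unfolding comult_crossed by (rule linear_lift[OF vspace_tensor bilinear_comult_pure])

lemma comult_crossed_P: "z \<in> carrier A \<Longrightarrow> comult C (P z h) = comult_pure z h"
  unfolding comult_crossed by (rule lift_P[OF vspace_tensor bilinear_comult_pure])

lemma prehopf_crossed: "prehopf C"
  by (intro prehopf.intro vC crossed_mult_closed linear_hom_closed[OF comult_crossed_linear])
    (simp_all add: crossed_simps(3) one_closed)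

text \<open>All computations with the comultiplication of the crossed product go through this rule, which is
  Sweedler notation for a bilinear map evaluated on \<open>\<Delta>(z # h)\<close>.\<close>

lemma lift_comult_P:
  assumes "vspace V" "bilinear C C V B" "z \<in> carrier A"
  shows "tensor_lift V B (comult C (P z h)) =
    tensor_lift V (\<lambda>z1 z2. tensor_lift V (\<lambda>h1 h2. B (P z1 h1) (P z2 h2)) (comult S h)) (comult A z)"
proof -
  note bb = bilinear_P_P[OF vspace_tensor bilinear_CC]
  note lin = tensor_lift_linear[OF vC vC assms(1,2)]
  have "tensor_lift V B (comult_pure z h) = tensor_lift V (\<lambda>z1 z2. tensor_lift V B
      (tensor_lift (tensor C C) (\<lambda>h1 h2. tensor_pure C C (P z1 h1) (P z2 h2)) (comult S h))) (comult A z)"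
    unfolding comult_pure_def
    by (rule linear_hom_tensor_lift[OF vA vA vspace_tensor assms(1) bb(3) lin comult_closed[OF assms(3)]])
  also have "\<dots> = tensor_lift V (\<lambda>z1 z2. tensor_lift V (\<lambda>h1 h2. B (P z1 h1) (P z2 h2)) (comult S h))
      (comult A z)"
  proof (rule tensor_lift_cong[OF vA vA assms(1) bilinear_P_P(3)[OF assms(1,2)] _ comult_closed[OF assms(3)]])
    fix z1 z2 assume z: "z1 \<in> carrier A" "z2 \<in> carrier A"
    have "tensor_lift V B (tensor_lift (tensor C C) (\<lambda>h1 h2. tensor_pure C C (P z1 h1) (P z2 h2)) (comult S h))
        = tensor_lift V (\<lambda>h1 h2. tensor_lift V B (tensor_pure C C (P z1 h1) (P z2 h2))) (comult S h)"
      by (rule linear_hom_tensor_lift[OF vS vS vspace_tensor assms(1) bb(1)[OF z] lin sweedler_comult_closed])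
    then show "tensor_lift V B (tensor_lift (tensor C C) (\<lambda>h1 h2. tensor_pure C C (P z1 h1) (P z2 h2)) (comult S h))
        = tensor_lift V (\<lambda>h1 h2. B (P z1 h1) (P z2 h2)) (comult S h)"
      by (simp add: tensor_lift_pure[OF vC vC assms(1,2)] z)
  qed
  finally show ?thesis
    by (simp add: comult_crossed_P assms(3))
qed

lemma counit_crossed_linear: "counit C \<in> linear_hom C scalars"
  and counit_crossed_P: "z \<in> carrier A \<Longrightarrow> counit C (P z h) = counit A z * counit S h"
proof -
  have b: "bilinear A S scalars (\<lambda>x y. counit A x * counit S y)"
    by (rule bilinear_precomp[OF bilinear_scalars_mult counit_linear h4_coordinates_linear(5)])
  show "counit C \<in> linear_hom C scalars"
    unfolding crossed_simps by (rule linear_lift[OF vspace_scalars b])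
  show "z \<in> carrier A \<Longrightarrow> counit C (P z h) = counit A z * counit S h"
    unfolding crossed_simps by (rule lift_P[OF vspace_scalars b])
qed

end


section \<open>Hopf algebra maps into and out of the crossed product\<close>

context hopf_algebra
begin

lemma comult_one: "comult H \<one> = tensor_pure H H \<one> \<one>"
  using comult_ring_hom by (auto simp: ring_hom_def tensor_def)

text \<open>The counit axioms in the form in which Sweedler sums are contracted: a linear map may be applied
  inside the sum.\<close>

lemma linear_counit_left:
  assumes "vspace V" "f \<in> linear_hom H V" "x \<in> carrier H"
  shows "tensor_lift V (\<lambda>y z. counit H y \<odot>\<^bsub>V\<^esub> f z) (comult H x) = f x"
proof -
  have b: "bilinear H H H (\<lambda>y z. counit H y \<odot> z)"
    by (rule bilinear_precomp[OF bilinear_smult[OF vspace] counit_linear linear_hom_id])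
  have "f x = f (tensor_lift H (\<lambda>y z. counit H y \<odot> z) (comult H x))"
    by (simp add: counit_left assms)
  also have "\<dots> = tensor_lift V (\<lambda>y z. f (counit H y \<odot> z)) (comult H x)"
    by (rule linear_hom_tensor_lift[OF vspace vspace vspace assms(1) b assms(2) comult_closed[OF assms(3)]])
  also have "\<dots> = tensor_lift V (\<lambda>y z. counit H y \<odot>\<^bsub>V\<^esub> f z) (comult H x)"
    by (rule tensor_lift_cong[OF vspace vspace assms(1)
          bilinear_precomp[OF bilinear_smult[OF assms(1)] counit_linear assms(2)]])
      (use assms comult_closed in \<open>auto simp: linear_hom_smult\<close>)
  finally show ?thesis ..
qed

lemma linear_counit_right:
  assumes "vspace V" "f \<in> linear_hom H V" "x \<in> carrier H"
  shows "tensor_lift V (\<lambda>y z. counit H z \<odot>\<^bsub>V\<^esub> f y) (comult H x) = f x"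
proof -
  have b: "bilinear H H H (\<lambda>y z. counit H z \<odot> y)"
    by (rule bilinear_flip[OF bilinear_precomp[OF bilinear_smult[OF vspace] counit_linear linear_hom_id]])
  have "f x = f (tensor_lift H (\<lambda>y z. counit H z \<odot> y) (comult H x))"
    by (simp add: counit_right assms)
  also have "\<dots> = tensor_lift V (\<lambda>y z. f (counit H z \<odot> y)) (comult H x)"
    by (rule linear_hom_tensor_lift[OF vspace vspace vspace assms(1) b assms(2) comult_closed[OF assms(3)]])
  also have "\<dots> = tensor_lift V (\<lambda>y z. counit H z \<odot>\<^bsub>V\<^esub> f y) (comult H x)"
    by (rule tensor_lift_cong[OF vspace vspace assms(1)
          bilinear_flip[OF bilinear_precomp[OF bilinear_smult[OF assms(1)] counit_linear assms(2)]]])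
      (use assms comult_closed in \<open>auto simp: linear_hom_smult\<close>)
  finally show ?thesis ..
qed

end

context crossed_product
begin

definition incl where "incl z = P z e"

lemma incl_linear: "incl \<in> linear_hom A C"
  unfolding incl_def[abs_def] by (rule bilinear_left[OF bilinear_P]) simp

lemma sweedler_comult_one: "comult S e = tensor_pure S S e e"
proof -
  interpret SS: vspace "tensor S S" by (rule vspace_tensor)
  show ?thesis by (simp add: sweedler_comult)
qed

lemma incl_hopf_hom: "incl \<in> hopf_hom A C"
proof (rule hopf_homI[OF incl_linear])
  fix x y assume "x \<in> carrier A" "y \<in> carrier A"
  then show "incl (x \<otimes> y) = incl x \<otimes>\<^bsub>C\<^esub> incl y"
    by (simp add: incl_def crossed_mult_left_A)
next
  show "incl \<one> = \<one>\<^bsub>C\<^esub>"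
    by (simp add: incl_def crossed_simps)
next
  fix x assume x: "x \<in> carrier A"
  have "comult C (incl x) = comult_pure x e"
    by (simp add: incl_def comult_crossed_P x)
  also have "\<dots> = tensor_map C C incl incl (comult A x)"
    unfolding comult_pure_def tensor_map_def
    by (rule tensor_lift_cong[OF vA vA vspace_tensor bilinear_tensor_pure_comp[OF vC vC incl_linear incl_linear]
          _ comult_closed[OF x]])
      (simp add: sweedler_comult_one incl_def
        tensor_lift_pure[OF vS vS vspace_tensor bilinear_P_P(1)[OF vspace_tensor bilinear_CC]])
  finally show "comult C (incl x) = tensor_map C C incl incl (comult A x)" .
  show "counit C (incl x) = counit A x"
    by (simp add: incl_def counit_crossed_P x)
qed

text \<open>The map \<open>z # h \<mapsto> \<epsilon>(h) z\<close> is a coalgebra map, but for \<open>a \<noteq> 0\<close> it is not multiplicative: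
  it sends \<open>x\<^sup>2 = a\<close> to \<open>a\<close> and \<open>x\<close> to \<open>0\<close>. It only serves as a linear retraction of the inclusion of \<open>A\<close>.\<close>

definition coproj where "coproj = tensor_lift A (\<lambda>z h. counit S h \<odot> z)"

lemma bilinear_coordinate:
  assumes "\<phi> \<in> linear_hom S scalars"
  shows "bilinear A S A (\<lambda>z h. \<phi> h \<odot> z)"
  by (rule bilinear_flip[OF bilinear_precomp[OF bilinear_smult[OF vA] assms linear_hom_id]])

lemma coproj_linear: "coproj \<in> linear_hom C A"
  unfolding coproj_def by (rule linear_lift[OF vA bilinear_coordinate[OF h4_coordinates_linear(5)]])

lemma coproj_P: "z \<in> carrier A \<Longrightarrow> coproj (P z h) = counit S h \<odot> z"
  unfolding coproj_def by (rule lift_P[OF vA bilinear_coordinate[OF h4_coordinates_linear(5)]])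

definition proj where "proj = tensor_lift S (\<lambda>z h. counit A z \<odot>\<^bsub>S\<^esub> h)"

lemma bilinear_proj: "bilinear A S S (\<lambda>z h. counit A z \<odot>\<^bsub>S\<^esub> h)"
  by (rule bilinear_precomp[OF bilinear_smult[OF vS] counit_linear linear_hom_id])

lemma proj_linear: "proj \<in> linear_hom C S"
  unfolding proj_def by (rule linear_lift[OF vS bilinear_proj])

lemma proj_P: "z \<in> carrier A \<Longrightarrow> proj (P z h) = counit A z \<odot>\<^bsub>S\<^esub> h"
  unfolding proj_def by (rule lift_P[OF vS bilinear_proj])

text \<open>Multiplicative because the counit of the cocycle is \<open>\<epsilon>(s) \<epsilon>(t)\<close>, as \<open>\<epsilon>(a) = 0\<close>.\<close>

lemma proj_mult:
  assumes "T \<in> carrier C" "U \<in> carrier C"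
  shows "proj (T \<otimes>\<^bsub>C\<^esub> U) = proj T \<otimes>\<^bsub>S\<^esub> proj U"
proof (rule crossed_ext2[OF vS bilinear_comp[OF proj_linear bilinear_crossed_mult]
      bilinear_precomp[OF bilinear_sweedler_mult proj_linear proj_linear] _ assms])
  fix z c h h' assume zc: "z \<in> carrier A" "c \<in> carrier A"
  have "proj (cross_summand z c h1 h2 h1' h2') =
      (counit A z * counit A c * (counit S h1 * counit S h1')) \<odot>\<^bsub>S\<^esub> (h2 \<otimes>\<^bsub>S\<^esub> h2')" for h1 h2 h1' h2'
    using zc by (simp add: cross_summand_def proj_P mult_closed counit_mult counit_cocycle
        del: sweedler_simps)
  then show "proj (P z h \<otimes>\<^bsub>C\<^esub> P c h') = proj (P z h) \<otimes>\<^bsub>S\<^esub> proj (P c h')"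
    using zc by (simp add: crossed_mult_pure cross_pure_expand linear_hom_add[OF proj_linear]
        linear_hom_smult[OF proj_linear] proj_P h4_g_def h4_x_def h4_gx_def algebra_simps)
qed

lemma proj_comult:
  assumes "T \<in> carrier C"
  shows "comult S (proj T) = tensor_map S S proj proj (comult C T)"
proof (rule crossed_ext[OF vspace_tensor linear_hom_comp[OF sweedler_comult_linear proj_linear]
      linear_hom_comp[OF tensor_map_linear[OF vC vC vS vS proj_linear proj_linear] comult_crossed_linear]
      _ assms])
  interpret SS: vspace "tensor S S" by (rule vspace_tensor)
  fix z h assume z: "z \<in> carrier A"
  note bSS = bilinear_tensor_pure[OF vS vS]
  note bp = bilinear_tensor_pure_comp[OF vS vS proj_linear proj_linear]
  have sm: "(\<lambda>w. c \<odot>\<^bsub>tensor S S\<^esub> w) \<in> linear_hom (tensor S S) (tensor S S)" for c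
    by (rule linear_hom_scaled[OF vspace_tensor linear_hom_id])
  have ce: "(\<lambda>w. counit A w \<odot>\<^bsub>tensor S S\<^esub> comult S h) \<in> linear_hom A (tensor S S)"
    by (rule linear_hom_comp[OF bilinear_left[OF bilinear_smult[OF vspace_tensor] sweedler_comult_closed]
          counit_linear])
  have inner: "tensor_lift (tensor S S) (\<lambda>h1 h2. tensor_pure S S (proj (P z1 h1)) (proj (P z2 h2))) (comult S h)
      = counit A z1 \<odot>\<^bsub>tensor S S\<^esub> (counit A z2 \<odot>\<^bsub>tensor S S\<^esub> comult S h)"
    if zz: "z1 \<in> carrier A" "z2 \<in> carrier A" for z1 z2
  proof -
    have "tensor_lift (tensor S S) (\<lambda>h1 h2. tensor_pure S S (proj (P z1 h1)) (proj (P z2 h2))) (comult S h)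
        = (counit A z1 * counit A z2) \<odot>\<^bsub>tensor S S\<^esub> comult S h"
      by (rule tensor_lift_unique[OF vS vS vspace_tensor bilinear_P_P(1)[OF vspace_tensor bp zz] sm _
            sweedler_comult_closed])
        (simp add: proj_P zz linear_hom_smult[OF bilinear_left[OF bSS]] linear_hom_smult[OF bilinear_right[OF bSS]]
          SS.smult_smult mult.commute del: sweedler_simps(3))
    then show ?thesis by (simp add: SS.smult_smult sweedler_comult_closed)
  qed
  have "tensor_map S S proj proj (comult C (P z h)) =
      tensor_lift (tensor S S) (\<lambda>z1 z2. tensor_lift (tensor S S)
        (\<lambda>h1 h2. tensor_pure S S (proj (P z1 h1)) (proj (P z2 h2))) (comult S h)) (comult A z)"
    unfolding tensor_map_def by (rule lift_comult_P[OF vspace_tensor bp z])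
  also have "\<dots> = tensor_lift (tensor S S)
      (\<lambda>z1 z2. counit A z1 \<odot>\<^bsub>tensor S S\<^esub> (counit A z2 \<odot>\<^bsub>tensor S S\<^esub> comult S h)) (comult A z)"
    by (rule tensor_lift_cong[OF vA vA vspace_tensor _ inner comult_closed[OF z]])
      (rule bilinear_precomp[OF bilinear_smult[OF vspace_tensor] counit_linear ce])
  also have "\<dots> = counit A z \<odot>\<^bsub>tensor S S\<^esub> comult S h"
    by (rule linear_counit_left[OF vspace_tensor ce z])
  also have "\<dots> = comult S (proj (P z h))"
    by (simp add: proj_P z linear_hom_smult[OF sweedler_comult_linear] del: sweedler_simps(3))
  finally show "comult S (proj (P z h)) = tensor_map S S proj proj (comult C (P z h))" ..
qed

lemma proj_hopf_hom: "proj \<in> hopf_hom C S"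
proof (rule hopf_homI[OF proj_linear proj_mult _ proj_comult])
  show "proj \<one>\<^bsub>C\<^esub> = \<one>\<^bsub>S\<^esub>"
    by (simp add: crossed_simps(3) proj_P one_closed counit_one)
  show "counit S (proj T) = counit C T" if "T \<in> carrier C" for T
    by (rule crossed_ext[OF vspace_scalars linear_hom_comp[OF h4_coordinates_linear(5) proj_linear]
          counit_crossed_linear _ that])
      (simp add: proj_P counit_crossed_P algebra_simps)
qed

text \<open>The crossed product has the tensor product coalgebra structure, so the counit axioms of both
  factors recover \<open>z # h\<close> from \<open>(z\<^sub>1 # h\<^sub>1) \<otimes> (z\<^sub>2 # h\<^sub>2)\<close> by keeping \<open>z\<^sub>1\<close> and \<open>h\<^sub>2\<close>, and equally
  by keeping \<open>z\<^sub>2\<close> and \<open>h\<^sub>1\<close>. Comparing both ways is what later determines an automorphism.\<close>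

lemma bilinear_reassemble: "bilinear C C C (\<lambda>s t. P (coproj s) (proj t))"
  by (rule bilinear_precomp[OF bilinear_P coproj_linear proj_linear])

lemma reassemble:
  assumes "T \<in> carrier C"
  shows "tensor_lift C (\<lambda>s t. P (coproj s) (proj t)) (comult C T) = T"
proof (rule crossed_ext[OF vC linear_hom_comp[OF tensor_lift_linear[OF vC vC vC bilinear_reassemble]
        comult_crossed_linear] linear_hom_id _ assms])
  fix z h assume z: "z \<in> carrier A"
  have b: "bilinear S S S (\<lambda>y z. counit S y \<odot>\<^bsub>S\<^esub> z)"
    by (rule bilinear_precomp[OF bilinear_smult[OF vS] h4_coordinates_linear(5) linear_hom_id])
  have inner: "tensor_lift C (\<lambda>h1 h2. P (coproj (P z1 h1)) (proj (P z2 h2))) (comult S h)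
      = counit A z2 \<odot>\<^bsub>C\<^esub> P z1 h" if zz: "z1 \<in> carrier A" "z2 \<in> carrier A" for z1 z2
  proof -
    have lin: "(\<lambda>k. counit A z2 \<odot>\<^bsub>C\<^esub> P z1 k) \<in> linear_hom S C"
      by (rule linear_hom_scaled[OF vC bilinear_right[OF bilinear_P zz(1)]])
    have "counit A z2 \<odot>\<^bsub>C\<^esub> P z1 h = counit A z2 \<odot>\<^bsub>C\<^esub> P z1 (tensor_lift S (\<lambda>y z. counit S y \<odot>\<^bsub>S\<^esub> z) (comult S h))"
      by (simp only: sweedler_counit_left)
    also have "\<dots> = tensor_lift C (\<lambda>h1 h2. counit A z2 \<odot>\<^bsub>C\<^esub> P z1 (counit S h1 \<odot>\<^bsub>S\<^esub> h2)) (comult S h)"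
      by (rule linear_hom_tensor_lift[OF vS vS vS vC b lin sweedler_comult_closed])
    also have "\<dots> = tensor_lift C (\<lambda>h1 h2. P (coproj (P z1 h1)) (proj (P z2 h2))) (comult S h)"
      by (rule tensor_lift_cong[OF vS vS vC bilinear_P_P(1)[OF vC bilinear_reassemble zz] _ sweedler_comult_closed])
        (simp add: coproj_P proj_P zz smult_P C.smult_smult mult.commute del: sweedler_simps(3,7))
    finally show ?thesis ..
  qed
  have "tensor_lift C (\<lambda>s t. P (coproj s) (proj t)) (comult C (P z h)) =
      tensor_lift C (\<lambda>z1 z2. counit A z2 \<odot>\<^bsub>C\<^esub> P z1 h) (comult A z)"
    unfolding lift_comult_P[OF vC bilinear_reassemble z]
    by (rule tensor_lift_cong[OF vA vA vC bilinear_flip[OF bilinear_precomp[OF bilinear_smult[OF vC]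
            counit_linear bilinear_left[OF bilinear_P]]] inner comult_closed[OF z]]) simp
  also have "\<dots> = P z h"
    by (rule linear_counit_right[OF vC bilinear_left[OF bilinear_P] z]) simp
  finally show "tensor_lift C (\<lambda>s t. P (coproj s) (proj t)) (comult C (P z h)) = P z h" .
qed

lemma reassemble_flipped:
  assumes "T \<in> carrier C"
  shows "tensor_lift C (\<lambda>s t. P (coproj t) (proj s)) (comult C T) = T"
proof (rule crossed_ext[OF vC linear_hom_comp[OF tensor_lift_linear[OF vC vC vC bilinear_flip[OF bilinear_reassemble]]
        comult_crossed_linear] linear_hom_id _ assms])
  fix z h assume z: "z \<in> carrier A"
  have b: "bilinear S S S (\<lambda>y z. counit S z \<odot>\<^bsub>S\<^esub> y)"
    by (rule bilinear_flip[OF bilinear_precomp[OF bilinear_smult[OF vS] h4_coordinates_linear(5) linear_hom_id]])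
  have inner: "tensor_lift C (\<lambda>h1 h2. P (coproj (P z2 h2)) (proj (P z1 h1))) (comult S h)
      = counit A z1 \<odot>\<^bsub>C\<^esub> P z2 h" if zz: "z1 \<in> carrier A" "z2 \<in> carrier A" for z1 z2
  proof -
    have lin: "(\<lambda>k. counit A z1 \<odot>\<^bsub>C\<^esub> P z2 k) \<in> linear_hom S C"
      by (rule linear_hom_scaled[OF vC bilinear_right[OF bilinear_P zz(2)]])
    have "counit A z1 \<odot>\<^bsub>C\<^esub> P z2 h = counit A z1 \<odot>\<^bsub>C\<^esub> P z2 (tensor_lift S (\<lambda>y z. counit S z \<odot>\<^bsub>S\<^esub> y) (comult S h))"
      by (simp only: sweedler_counit_right)
    also have "\<dots> = tensor_lift C (\<lambda>h1 h2. counit A z1 \<odot>\<^bsub>C\<^esub> P z2 (counit S h2 \<odot>\<^bsub>S\<^esub> h1)) (comult S h)"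
      by (rule linear_hom_tensor_lift[OF vS vS vS vC b lin sweedler_comult_closed])
    also have "\<dots> = tensor_lift C (\<lambda>h1 h2. P (coproj (P z2 h2)) (proj (P z1 h1))) (comult S h)"
      by (rule tensor_lift_cong[OF vS vS vC bilinear_P_P(1)[OF vC bilinear_flip[OF bilinear_reassemble] zz]
            _ sweedler_comult_closed])
        (simp add: coproj_P proj_P zz smult_P C.smult_smult mult.commute del: sweedler_simps(3,7))
    finally show ?thesis ..
  qed
  have "tensor_lift C (\<lambda>s t. P (coproj t) (proj s)) (comult C (P z h)) =
      tensor_lift C (\<lambda>z1 z2. counit A z1 \<odot>\<^bsub>C\<^esub> P z2 h) (comult A z)"
    unfolding lift_comult_P[OF vC bilinear_flip[OF bilinear_reassemble] z]
    by (rule tensor_lift_cong[OF vA vA vC bilinear_precomp[OF bilinear_smult[OF vC]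
            counit_linear bilinear_left[OF bilinear_P]] inner comult_closed[OF z]]) simp
  also have "\<dots> = P z h"
    by (rule linear_counit_left[OF vC bilinear_left[OF bilinear_P] z]) simp
  finally show "tensor_lift C (\<lambda>s t. P (coproj t) (proj s)) (comult C (P z h)) = P z h" .
qed


section \<open>The maps \<open>u \<otimes> v\<^sub>\<beta>\<close>\<close>

definition psi where "psi u \<beta> = tensor_map A S u (h4_v \<beta>)"

lemma psi_linear:
  assumes "u \<in> linear_hom A A"
  shows "psi u \<beta> \<in> linear_hom C C"
  using tensor_map_linear[OF vA vS vA vS assms h4_v_linear]
    same_space_linear_hom[OF same_space_crossed same_space_crossed]
  unfolding psi_def by blast

lemma psi_P: "u \<in> linear_hom A A \<Longrightarrow> z \<in> carrier A \<Longrightarrow> psi u \<beta> (P z h) = P (u z) (h4_v \<beta> h)"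
  unfolding psi_def by (rule tensor_map_pure[OF vA vS vA vS _ h4_v_linear]) simp_all

lemma psi_psi:
  assumes "u \<in> linear_hom A A" "u' \<in> linear_hom A A" "T \<in> carrier C"
  shows "psi u \<beta> (psi u' \<gamma> T) = psi (\<lambda>z. u (u' z)) (\<beta> * \<gamma>) T"
  by (rule crossed_ext[OF vC linear_hom_comp[OF psi_linear[OF assms(1)] psi_linear[OF assms(2)]]
        psi_linear[OF linear_hom_comp[OF assms(1,2)]] _ assms(3)])
    (simp add: psi_P assms(1,2) linear_hom_comp[OF assms(1,2)] linear_hom_closed[OF assms(2)] h4_v_h4_v)

lemma psi_cong:
  assumes "u \<in> linear_hom A A" "\<And>z. z \<in> carrier A \<Longrightarrow> u' z = u z" "T \<in> carrier C"
  shows "psi u' \<beta> T = psi u \<beta> T"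
proof -
  note u' = linear_hom_cong[OF vA assms(1,2)]
  show ?thesis
    by (rule crossed_ext[OF vC psi_linear[OF u'] psi_linear[OF assms(1)] _ assms(3)])
      (simp_all add: psi_P u' assms(1,2))
qed

lemma psi_id:
  assumes "T \<in> carrier C"
  shows "psi (\<lambda>z. z) 1 T = T"
  by (rule crossed_ext[OF vC psi_linear[OF linear_hom_id] linear_hom_id _ assms])
    (simp add: psi_P linear_hom_id h4_v_1)

text \<open>Multiplicativity reduces to \<open>u(f\<^sub>a(s, t)) = f\<^sub>a(v s, v t)\<close>. Scaling \<open>x\<close> by \<open>\<beta>\<close> multiplies the
  coefficient of \<open>a\<close> in the cocycle by \<open>\<beta>\<^sup>2\<close>, which is matched by \<open>u a = \<beta>\<^sup>2 a\<close>.\<close>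

lemma psi_mult:
  assumes u: "u \<in> hopf_hom A A" "u a = \<beta>\<^sup>2 \<odot> a"
    and T: "T \<in> carrier C" "U \<in> carrier C"
  shows "psi u \<beta> (T \<otimes>\<^bsub>C\<^esub> U) = psi u \<beta> T \<otimes>\<^bsub>C\<^esub> psi u \<beta> U"
proof -
  note u' = hopf_homD[OF u(1)]
  note pl = psi_linear[OF u'(1)]
  note v = h4_v_linear[of \<beta>]
  have coc: "u (cocycle A a s t) = cocycle A a (h4_v \<beta> s) (h4_v \<beta> t)" for s t
    by (simp add: cocycle_def linear_hom_add[OF u'(1)] linear_hom_smult[OF u'(1)] u'(3) one_closed
        a_closed u(2) h4_v_def A.smult_smult power2_eq_square algebra_simps)
  have summand: "psi u \<beta> (cross_summand z c h1 h2 h1' h2') =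
      cross_summand (u z) (u c) (h4_v \<beta> h1) (h4_v \<beta> h2) (h4_v \<beta> h1') (h4_v \<beta> h2')"
    if "z \<in> carrier A" "c \<in> carrier A" for z c h1 h2 h1' h2'
    using that by (simp add: cross_summand_def psi_P u'(1) u'(2) mult_closed coc h4_v_mult
        del: sweedler_simps)
  have inner: "psi u \<beta> (cross_inner z c h' h1 h2) =
      cross_inner (u z) (u c) (h4_v \<beta> h') (h4_v \<beta> h1) (h4_v \<beta> h2)"
    if zc: "z \<in> carrier A" "c \<in> carrier A" for z c h' h1 h2
  proof -
    note b = bilinear_cross_summand_right[OF u'(6)[OF zc(1)] u'(6)[OF zc(2)]]
    have "psi u \<beta> (cross_inner z c h' h1 h2) =
        tensor_lift C (\<lambda>h1' h2'. psi u \<beta> (cross_summand z c h1 h2 h1' h2')) (comult S h')"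
      unfolding cross_inner_def
      by (rule linear_hom_tensor_lift[OF vS vS vC vC bilinear_cross_summand_right[OF zc] pl sweedler_comult_closed])
    also have "\<dots> = tensor_lift C (cross_summand (u z) (u c) (h4_v \<beta> h1) (h4_v \<beta> h2))
        (tensor_map S S (h4_v \<beta>) (h4_v \<beta>) (comult S h'))"
      unfolding tensor_lift_tensor_map[OF vS vS vS vS vC v v b sweedler_comult_closed] summand[OF zc] ..
    finally show ?thesis
      by (simp only: cross_inner_def h4_v_comult)
  qed
  have pure: "psi u \<beta> (cross_pure z h c h') = cross_pure (u z) (h4_v \<beta> h) (u c) (h4_v \<beta> h')"
    if zc: "z \<in> carrier A" "c \<in> carrier A" for z c h' h
  proof -
    note b = bilinear_cross_inner[OF u'(6)[OF zc(1)] u'(6)[OF zc(2)]]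
    have "psi u \<beta> (cross_pure z h c h') =
        tensor_lift C (\<lambda>h1 h2. psi u \<beta> (cross_inner z c h' h1 h2)) (comult S h)"
      unfolding cross_pure_def
      by (rule linear_hom_tensor_lift[OF vS vS vC vC bilinear_cross_inner[OF zc] pl sweedler_comult_closed])
    also have "\<dots> = tensor_lift C (cross_inner (u z) (u c) (h4_v \<beta> h'))
        (tensor_map S S (h4_v \<beta>) (h4_v \<beta>) (comult S h))"
      unfolding tensor_lift_tensor_map[OF vS vS vS vS vC v v b sweedler_comult_closed] inner[OF zc] ..
    finally show ?thesis
      by (simp only: cross_pure_def h4_v_comult)
  qed
  show ?thesis
    by (rule crossed_ext2[OF vC bilinear_comp[OF pl bilinear_crossed_mult]
          bilinear_precomp[OF bilinear_crossed_mult pl pl] _ T])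
      (simp add: crossed_mult_pure pure psi_P u'(1,6))
qed

lemma psi_comult:
  assumes u: "u \<in> hopf_hom A A" and T: "T \<in> carrier C"
  shows "comult C (psi u \<beta> T) = tensor_map C C (psi u \<beta>) (psi u \<beta>) (comult C T)"
proof -
  note u' = hopf_homD[OF u]
  note pl = psi_linear[OF u'(1), of \<beta>]
  note v = h4_v_linear[of \<beta>]
  note bp = bilinear_tensor_pure_comp[OF vC vC pl pl]
  show ?thesis
  proof (rule crossed_ext[OF vspace_tensor linear_hom_comp[OF comult_crossed_linear pl]
        linear_hom_comp[OF tensor_map_linear[OF vC vC vC vC pl pl] comult_crossed_linear] _ T])
    fix z h assume z: "z \<in> carrier A"
    note bb = bilinear_P_P[OF vspace_tensor bilinear_CC]
    have inner: "tensor_lift (tensor C C) (\<lambda>h1 h2. tensor_pure C C (P (u z1) h1) (P (u z2) h2)) (comult S (h4_v \<beta> h))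
      = tensor_lift (tensor C C) (\<lambda>h1 h2. tensor_pure C C (psi u \<beta> (P z1 h1)) (psi u \<beta> (P z2 h2))) (comult S h)"
      if zz: "z1 \<in> carrier A" "z2 \<in> carrier A" for z1 z2
      unfolding h4_v_comult
        tensor_lift_tensor_map[OF vS vS vS vS vspace_tensor v v bb(1)[OF u'(6)[OF zz(1)] u'(6)[OF zz(2)]] sweedler_comult_closed]
      by (simp add: psi_P u'(1) zz)
    have "comult C (psi u \<beta> (P z h)) = comult_pure (u z) (h4_v \<beta> h)"
      by (simp add: psi_P u'(1,6) z comult_crossed_P)
    also have "\<dots> = tensor_lift (tensor C C) (\<lambda>z1 z2. tensor_lift (tensor C C)
        (\<lambda>h1 h2. tensor_pure C C (P (u z1) h1) (P (u z2) h2)) (comult S (h4_v \<beta> h))) (comult A z)"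
      unfolding comult_pure_def u'(4)[OF z]
      by (rule tensor_lift_tensor_map[OF vA vA vA vA vspace_tensor u'(1,1) bb(3) comult_closed[OF z]])
    also have "\<dots> = tensor_map C C (psi u \<beta>) (psi u \<beta>) (comult C (P z h))"
      unfolding tensor_map_def lift_comult_P[OF vspace_tensor bp z]
      by (rule tensor_lift_cong[OF vA vA vspace_tensor bilinear_P_P(3)[OF vspace_tensor bp] inner comult_closed[OF z]])
    finally show "comult C (psi u \<beta> (P z h)) = tensor_map C C (psi u \<beta>) (psi u \<beta>) (comult C (P z h))" .
  qed
qed

lemma psi_hopf_hom:
  assumes "u \<in> hopf_hom A A" "u a = \<beta>\<^sup>2 \<odot> a"
  shows "psi u \<beta> \<in> hopf_hom C C"
proof -
  note u' = hopf_homD[OF assms(1)]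
  show ?thesis
  proof (rule hopf_homI[OF psi_linear[OF u'(1)] psi_mult[OF assms] _ psi_comult[OF assms(1)]])
    show "psi u \<beta> \<one>\<^bsub>C\<^esub> = \<one>\<^bsub>C\<^esub>"
      by (simp add: crossed_simps(3) psi_P u'(1,3) one_closed h4_v_def)
    show "counit C (psi u \<beta> T) = counit C T" if "T \<in> carrier C" for T
      by (rule crossed_ext[OF vspace_scalars linear_hom_comp[OF counit_crossed_linear psi_linear[OF u'(1)]]
            counit_crossed_linear _ that])
        (simp add: psi_P u'(1,5,6) counit_crossed_P h4_v_def)
  qed
qed

end


section \<open>Every automorphism has the form \<open>u \<otimes> v\<^sub>\<beta>\<close>\<close>

lemma tensor_lift_comult_hopf_hom:
  assumes "prehopf H" "prehopf L" "vspace V" "f \<in> hopf_hom H L" "bilinear L L V B" "x \<in> carrier H"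
  shows "tensor_lift V B (comult L (f x)) = tensor_lift V (\<lambda>y z. B (f y) (f z)) (comult H x)"
  unfolding hopf_homD(4)[OF assms(4,6)]
  by (rule tensor_lift_tensor_map[OF prehopf.vspace prehopf.vspace prehopf.vspace prehopf.vspace assms(3)
        hopf_homD(1) hopf_homD(1) assms(5) prehopf.comult_closed]) (rule assms)+

context crossed_product
begin

definition coordinate :: "('k h4 \<Rightarrow> 'k) \<Rightarrow> _ \<Rightarrow> 'a"
  where "coordinate \<phi> = tensor_lift A (\<lambda>z h. \<phi> h \<odot> z)"

lemma coordinate_linear: "\<phi> \<in> linear_hom S scalars \<Longrightarrow> coordinate \<phi> \<in> linear_hom C A"
  unfolding coordinate_def by (rule linear_lift[OF vA bilinear_coordinate])

lemma coordinate_P: "\<phi> \<in> linear_hom S scalars \<Longrightarrow> z \<in> carrier A \<Longrightarrow> coordinate \<phi> (P z h) = \<phi> h \<odot> z"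
  unfolding coordinate_def by (rule lift_P[OF vA bilinear_coordinate])

lemma one_not_zero: "\<one> \<noteq> \<zero>"
  using linear_hom_zero[OF vA vspace_scalars counit_linear] counit_one by auto

lemma comult_group_like: "comult C (P \<one> h4_g) = tensor_pure C C (P \<one> h4_g) (P \<one> h4_g)"
  and comult_skew_primitive: "comult C (P \<one> h4_x) =
    tensor_pure C C (P \<one> h4_x) (P \<one> e) \<oplus>\<^bsub>tensor C C\<^esub> tensor_pure C C (P \<one> h4_g) (P \<one> h4_x)"
proof -
  note bb = bilinear_P_P[OF vspace_tensor bilinear_CC]
  have c: "comult C (P \<one> h) = tensor_lift (tensor C C) (\<lambda>y1 y2. tensor_pure C C (P \<one> y1) (P \<one> y2)) (comult S h)" for h
    by (simp add: comult_crossed_P one_closed comult_pure_def comult_one tensor_lift_pure[OF vA vA vspace_tensor bb(3)])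
  show "comult C (P \<one> h4_g) = tensor_pure C C (P \<one> h4_g) (P \<one> h4_g)"
    unfolding c tensor_lift_sweedler_comult[OF vspace_tensor bb(1)[OF one_closed one_closed]]
    by (simp add: h4_g_def one_closed)
  show "comult C (P \<one> h4_x) =
    tensor_pure C C (P \<one> h4_x) (P \<one> e) \<oplus>\<^bsub>tensor C C\<^esub> tensor_pure C C (P \<one> h4_g) (P \<one> h4_x)"
    unfolding c tensor_lift_sweedler_comult[OF vspace_tensor bb(1)[OF one_closed one_closed]]
    by (simp add: h4_x_def one_closed)
qed

text \<open>Contracting the first tensor factor with a coordinate turns equations between comultiplications
  into equations between elements of \<open>H\<^sub>4\<close>, that is, between four scalars.\<close>

lemma sweedler_contract:
  assumes "\<phi> \<in> linear_hom S scalars"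
  shows "bilinear S S S (\<lambda>s t. \<phi> s \<odot>\<^bsub>S\<^esub> t)"
    and "tensor_lift S (\<lambda>s t. \<phi> s \<odot>\<^bsub>S\<^esub> t) (tensor_pure S S s t) = \<phi> s \<odot>\<^bsub>S\<^esub> t"
proof -
  show b: "bilinear S S S (\<lambda>s t. \<phi> s \<odot>\<^bsub>S\<^esub> t)"
    by (rule bilinear_precomp[OF bilinear_smult[OF vS] assms linear_hom_id])
  show "tensor_lift S (\<lambda>s t. \<phi> s \<odot>\<^bsub>S\<^esub> t) (tensor_pure S S s t) = \<phi> s \<odot>\<^bsub>S\<^esub> t"
    by (rule tensor_lift_pure[OF vS vS vS b]) simp_all
qed

lemma sweedler_group_like:
  assumes "comult S s = tensor_pure S S s s" "counit S s = 1"
  shows "s = e \<or> s = h4_g"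
proof -
  have *: "tensor_lift S (\<lambda>s t. \<phi> s \<odot>\<^bsub>S\<^esub> t) (comult S s) = \<phi> s \<odot>\<^bsub>S\<^esub> s" if "\<phi> \<in> linear_hom S scalars" for \<phi>
    unfolding assms(1) by (rule sweedler_contract(2)[OF that])
  note c = h4_coordinates_linear(1-4)
  have "co_x s * co_x s = 0" "co_gx s * co_gx s = 0" "co_1 s = co_1 s * co_1 s"
    using *[OF c(1)] *[OF c(2)] *[OF c(3)] *[OF c(4)]
      tensor_lift_sweedler_comult[OF vS sweedler_contract(1)[OF c(1)]]
      tensor_lift_sweedler_comult[OF vS sweedler_contract(1)[OF c(2)]]
      tensor_lift_sweedler_comult[OF vS sweedler_contract(1)[OF c(3)]]
      tensor_lift_sweedler_comult[OF vS sweedler_contract(1)[OF c(4)]]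
    by (simp_all add: h4_g_def h4_x_def h4_gx_def)
  then have "co_x s = 0" "co_gx s = 0" "co_1 s = 0 \<or> co_1 s = 1"
    by auto
  then show ?thesis
    using assms(2) by (cases s) (auto simp: h4_g_def)
qed

lemma sweedler_skew_primitive:
  assumes "comult S s = tensor_pure S S s e \<oplus>\<^bsub>tensor S S\<^esub> tensor_pure S S h4_g s"
  shows "s = H4 (co_1 s) (- co_1 s) (co_x s) 0"
proof -
  have *: "tensor_lift S (\<lambda>s t. \<phi> s \<odot>\<^bsub>S\<^esub> t) (comult S s) = \<phi> s \<odot>\<^bsub>S\<^esub> e \<oplus>\<^bsub>S\<^esub> \<phi> h4_g \<odot>\<^bsub>S\<^esub> s"
    if "\<phi> \<in> linear_hom S scalars" for \<phi>
    unfolding assms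
    by (simp add: linear_hom_add[OF tensor_lift_linear[OF vS vS vS sweedler_contract(1)[OF that]]]
        sweedler_contract(2)[OF that] del: sweedler_simps(2-7))
  note c = h4_coordinates_linear(1-4)
  have "co_gx s = 0" "co_1 s + co_g s = 0"
    using *[OF c(2)] *[OF c(4)] tensor_lift_sweedler_comult[OF vS sweedler_contract(1)[OF c(2)]]
      tensor_lift_sweedler_comult[OF vS sweedler_contract(1)[OF c(4)]]
    by (simp_all add: h4_g_def h4_x_def h4_gx_def add.commute)
  then show ?thesis
    by (cases s) (simp add: eq_neg_iff_add_eq_0 add.commute)
qed

text \<open>Composed with the inclusion of \<open>A\<close> and the projection to \<open>H\<^sub>4\<close>, the map \<open>f\<close> becomes a Hopf map
  from \<open>A\<close> to \<open>H\<^sub>4\<close> and is trivial by assumption. Reassembling \<open>f z\<close> from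
  \<open>f z\<^sub>1 \<otimes> f z\<^sub>2\<close>, the \<open>H\<^sub>4\<close> part of the second factor is therefore the scalar \<open>\<epsilon>(z\<^sub>2)\<close>, and
  \<open>f z\<close> lies in \<open>A\<close>.\<close>

lemma hopf_endo_preserves_A:
  assumes trivial: "\<forall>f \<in> hopf_hom A S. \<forall>z \<in> carrier A. f z = counit A z \<odot>\<^bsub>S\<^esub> e"
    and f: "f \<in> hopf_hom C C" and z: "z \<in> carrier A"
  shows "f (P z e) = P (coproj (f (P z e))) e"
proof -
  have fi: "(\<lambda>z. f (incl z)) \<in> hopf_hom A C"
    by (rule hopf_hom_comp[OF prehopf prehopf_crossed prehopf_crossed incl_hopf_hom f])
  have pfi: "proj (f (incl z)) = counit A z \<odot>\<^bsub>S\<^esub> e" if "z \<in> carrier A" for z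
    by (rule trivial[rule_format, OF hopf_hom_comp[OF prehopf prehopf_crossed prehopf_sweedler fi proj_hopf_hom] that])
  have cfi: "(\<lambda>z. coproj (f (incl z))) \<in> linear_hom A A"
    by (rule linear_hom_comp[OF coproj_linear hopf_homD(1)[OF fi]])
  have w: "(\<lambda>z. P (coproj (f (incl z))) e) \<in> linear_hom A C"
    by (rule linear_hom_bilinear_left[OF bilinear_P cfi]) simp
  have "f (incl z) = tensor_lift C (\<lambda>s t. P (coproj s) (proj t)) (comult C (f (incl z)))"
    by (rule reassemble[symmetric]) (rule hopf_homD(6)[OF fi z])
  also have "\<dots> = tensor_lift C (\<lambda>z1 z2. P (coproj (f (incl z1))) (proj (f (incl z2)))) (comult A z)"
    by (rule tensor_lift_comult_hopf_hom[OF prehopf prehopf_crossed vC fi bilinear_reassemble z])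
  also have "\<dots> = tensor_lift C (\<lambda>z1 z2. counit A z2 \<odot>\<^bsub>C\<^esub> P (coproj (f (incl z1))) e) (comult A z)"
    by (rule tensor_lift_cong[OF vA vA vC bilinear_flip[OF bilinear_precomp[OF bilinear_smult[OF vC] counit_linear w]]
          _ comult_closed[OF z]])
      (simp add: pfi smult_P linear_hom_closed[OF cfi] del: sweedler_simps(3))
  also have "\<dots> = P (coproj (f (incl z))) e"
    by (rule linear_counit_right[OF vC w z])
  finally show ?thesis by (simp add: incl_def)
qed

lemma coproj_incl: "z \<in> carrier A \<Longrightarrow> coproj (P z e) = z"
  by (simp add: coproj_P)

text \<open>The inverse automorphism preserves \<open>A\<close> as well and inverts the restriction. The structure maps
  are compared in the crossed product, into which \<open>A\<close> is embedded by a Hopf map.\<close>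

lemma aut_restricts_to_A:
  assumes trivial: "\<forall>f \<in> hopf_hom A S. \<forall>z \<in> carrier A. f z = counit A z \<odot>\<^bsub>S\<^esub> e"
    and f: "f \<in> carrier (hopf_aut C)"
  shows "(\<lambda>z \<in> carrier A. coproj (f (P z e))) \<in> carrier (hopf_aut A)"
proof -
  interpret G: group "hopf_aut C" by (rule group_hopf_aut[OF prehopf_crossed])
  define f' where "f' = inv\<^bsub>hopf_aut C\<^esub> f"
  have hom: "g \<in> hopf_hom C C" if "g \<in> {f, f'}" for g
    using that f G.inv_closed[OF f] by (auto simp: f'_def carrier_hopf_aut)
  let ?u = "\<lambda>g z. coproj (g (P z e))"
  have u_closed: "?u g z \<in> carrier A" if "g \<in> {f, f'}" "z \<in> carrier A" for g z
    using that hopf_homD(6)[OF hom] linear_hom_closed[OF coproj_linear] by auto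
  have gu: "g (P z e) = P (?u g z) e" if "g \<in> {f, f'}" "z \<in> carrier A" for g z
    by (rule hopf_endo_preserves_A[OF trivial hom[OF that(1)] that(2)])
  have inv1: "?u f (?u f' z) = z" if "z \<in> carrier A" for z
    using gu[of f' z] hopf_aut_inv_apply(2)[OF prehopf_crossed f, of "P z e"] that
    by (simp add: f'_def[symmetric] coproj_P)
  have inv2: "?u f' (?u f z) = z" if "z \<in> carrier A" for z
    using gu[of f z] hopf_aut_inv_apply(1)[OF prehopf_crossed f, of "P z e"] that
    by (simp add: f'_def[symmetric] coproj_P)
  have ff: "f \<in> hopf_hom C C" by (rule hom) simp
  note F = hopf_homD[OF ff]
  have u_lin: "?u f \<in> linear_hom A A"
    using linear_hom_comp[OF coproj_linear linear_hom_comp[OF F(1) incl_linear]] by (simp add: incl_def)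
  have "?u f \<in> hopf_hom A A"
  proof (rule hopf_homI[OF u_lin])
    fix x y assume xy: "x \<in> carrier A" "y \<in> carrier A"
    have "P (?u f (x \<otimes> y)) e = f (P x e \<otimes>\<^bsub>C\<^esub> P y e)"
      by (simp add: crossed_mult_left_A xy gu[symmetric] mult_closed)
    also have "\<dots> = P (?u f x) e \<otimes>\<^bsub>C\<^esub> P (?u f y) e"
      by (simp add: F(2) xy gu[symmetric])
    also have "\<dots> = P (?u f x \<otimes> ?u f y) e"
      by (simp add: crossed_mult_left_A xy u_closed)
    finally show "?u f (x \<otimes> y) = ?u f x \<otimes> ?u f y"
      by (metis coproj_incl u_closed mult_closed xy insertI1)
  next
    show "?u f \<one> = \<one>"
      using F(3) by (simp add: crossed_simps(3) coproj_incl one_closed)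
  next
    fix x assume x: "x \<in> carrier A"
    have iu: "incl (?u f y) = f (incl y)" if "y \<in> carrier A" for y
      using gu[of f y] that by (simp add: incl_def)
    have fi: "(\<lambda>z. f (incl z)) \<in> hopf_hom A C"
      by (rule hopf_hom_comp[OF prehopf prehopf_crossed prehopf_crossed incl_hopf_hom ff])
    note lin_i = incl_linear and lin_fi = hopf_homD(1)[OF fi]
    have cc: "tensor_map A A coproj coproj (tensor_map C C incl incl T) = T"
      if "T \<in> carrier (tensor A A)" for T
      using tensor_map_tensor_map[OF vA vA vC vC vA vA lin_i lin_i coproj_linear coproj_linear that]
        tensor_map_cong[OF vA vA vA vA linear_hom_id linear_hom_id _ _ that, of "\<lambda>z. coproj (incl z)" "\<lambda>z. coproj (incl z)"]
      by (simp add: incl_def coproj_incl tensor_map_id[OF vA vA that])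
    have "tensor_map C C incl incl (comult A (?u f x)) = comult C (f (incl x))"
      using hopf_homD(4)[OF incl_hopf_hom, of "?u f x"] x by (simp add: u_closed iu)
    also have "\<dots> = tensor_map C C (\<lambda>z. f (incl z)) (\<lambda>z. f (incl z)) (comult A x)"
      by (rule hopf_homD(4)[OF fi x])
    also have "\<dots> = tensor_map C C (\<lambda>z. incl (?u f z)) (\<lambda>z. incl (?u f z)) (comult A x)"
      by (rule tensor_map_cong[OF vA vA vC vC linear_hom_comp[OF lin_i u_lin] linear_hom_comp[OF lin_i u_lin]])
        (simp_all add: iu comult_closed x)
    also have "\<dots> = tensor_map C C incl incl (tensor_map A A (?u f) (?u f) (comult A x))"
      by (rule tensor_map_tensor_map[symmetric, OF vA vA vA vA vC vC u_lin u_lin lin_i lin_i comult_closed[OF x]])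
    finally have "tensor_map A A coproj coproj (tensor_map C C incl incl (comult A (?u f x))) =
        tensor_map A A coproj coproj (tensor_map C C incl incl (tensor_map A A (?u f) (?u f) (comult A x)))"
      by (rule arg_cong)
    then show "comult A (?u f x) = tensor_map A A (?u f) (?u f) (comult A x)"
      unfolding cc[OF comult_closed[OF u_closed[OF insertI1 x]]]
        cc[OF linear_hom_closed[OF tensor_map_linear[OF vA vA vA vA u_lin u_lin] comult_closed[OF x]]] .
    show "counit A (?u f x) = counit A x"
      using hopf_homD(5)[OF incl_hopf_hom, of "?u f x"] hopf_homD(5)[OF fi x] x by (simp add: u_closed iu)
  qed
  then show ?thesis
    by (rule restrict_in_hopf_aut[OF prehopf, where g = "?u f'"])
      (simp_all add: u_closed inv1 inv2)
qed

text \<open>It remains to find the images of \<open>g\<close> and \<open>x\<close>. Their projections to \<open>H\<^sub>4\<close> are a group-like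
  element and a skew primitive one. The first is \<open>g\<close>, since otherwise \<open>f g\<close> would lie in
  \<open>A = f(A)\<close>; the second is \<open>p (1 - g) + \<beta> x\<close>, and \<open>x g = - g x\<close> gives \<open>2 p = 0\<close>.
  With \<open>\<gamma>\<close> and \<open>r\<close> for the components of \<open>f g\<close> and \<open>f x\<close> in \<open>A\<close>, reassembling
  \<open>f x\<close> in both orders yields
  \<open>r # 1 + \<gamma> # \<beta> x = 1 # \<beta> x + r # g\<close>. Hence \<open>r = 0\<close>, then \<open>\<beta> \<noteq> 0\<close> by
  injectivity, and \<open>\<gamma> = 1\<close>. Finally \<open>u a = \<beta>\<^sup>2 a\<close> is the image of the relation
  \<open>x\<^sup>2 = a\<close>.\<close>

lemma aut_is_psi:
  assumes two: "(2 :: 'k) \<noteq> 0"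
    and trivial: "\<forall>f \<in> hopf_hom A S. \<forall>z \<in> carrier A. f z = counit A z \<odot>\<^bsub>S\<^esub> e"
    and f: "f \<in> carrier (hopf_aut C)"
  obtains u \<beta> where "u \<in> carrier (hopf_aut A)" "\<beta> \<noteq> 0" "u a = \<beta>\<^sup>2 \<odot> a"
    "\<And>T. T \<in> carrier C \<Longrightarrow> f T = psi u \<beta> T"
proof -
  define u where "u = (\<lambda>z \<in> carrier A. coproj (f (P z e)))"
  have u: "u \<in> carrier (hopf_aut A)"
    unfolding u_def by (rule aut_restricts_to_A[OF trivial f])
  then have u_hom: "u \<in> hopf_hom A A"
    by (simp add: carrier_hopf_aut)
  note u' = hopf_homD[OF u_hom]
  have f_hom: "f \<in> hopf_hom C C"
    using f by (simp add: carrier_hopf_aut)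
  note F = hopf_homD[OF f_hom]
  have f_inj: "inj_on f (carrier C)"
    using f by (auto simp: carrier_hopf_aut Bij_def bij_betw_def)
  have fA: "f (P z e) = P (u z) e" if "z \<in> carrier A" for z
    using hopf_endo_preserves_A[OF trivial f_hom that] that by (simp add: u_def)
  have u_surj: "\<exists>z' \<in> carrier A. u z' = z" if "z \<in> carrier A" for z
  proof -
    have "u ` carrier A = carrier A"
      using u by (simp add: carrier_hopf_aut Bij_def bij_betw_def)
    then show ?thesis
      using that by (metis imageE)
  qed
  \<comment> \<open>As \<open>f\<close> is injective and maps \<open>A\<close> onto \<open>A\<close>, it maps nothing else into \<open>A\<close>.\<close>
  have not_in_A: "f (P \<one> h) \<noteq> P z e"
    if z: "z \<in> carrier A" and \<phi>: "\<phi> \<in> linear_hom S scalars" "\<phi> h = 1" "\<phi> e = 0" for h z \<phi>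
  proof
    assume "f (P \<one> h) = P z e"
    moreover obtain z' where z': "z' \<in> carrier A" "u z' = z"
      using u_surj[OF z] by blast
    ultimately have "f (P \<one> h) = f (P z' e)"
      by (simp add: fA)
    then have "P \<one> h = P z' e"
      using f_inj z' one_closed by (auto dest: inj_onD)
    then have "coordinate \<phi> (P \<one> h) = coordinate \<phi> (P z' e)"
      by simp
    then show False
      using \<phi> z' one_closed one_not_zero by (simp add: coordinate_P)
  qed
  define Fg Fx where "Fg = f (P \<one> h4_g)" and "Fx = f (P \<one> h4_x)"
  define \<gamma> r where "\<gamma> = coproj Fg" and "r = coproj Fx"
  have GX: "Fg \<in> carrier C" "Fx \<in> carrier C" "\<gamma> \<in> carrier A" "r \<in> carrier A"
    unfolding Fg_def Fx_def \<gamma>_def r_def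
    by (simp_all add: F(6) one_closed linear_hom_closed[OF coproj_linear])
  have f_one: "f (P \<one> e) = P \<one> e"
    using F(3) by (simp add: crossed_simps)
  have proj_one: "proj (P \<one> e) = e" "coproj (P \<one> e) = \<one>"
    by (simp_all add: proj_P coproj_P one_closed counit_one)
  have pf: "(\<lambda>T. proj (f T)) \<in> hopf_hom C S"
    by (rule hopf_hom_comp[OF prehopf_crossed prehopf_crossed prehopf_sweedler f_hom proj_hopf_hom])
  note PF = hopf_homD[OF pf]
  interpret SS: vspace "tensor S S" by (rule vspace_tensor)
  note tm = tensor_map_linear[OF vC vC vS vS PF(1) PF(1)] tensor_map_pure[OF vC vC vS vS PF(1) PF(1)]
  have proj_Fg: "proj Fg = h4_g"
  proof -
    have "comult S (proj Fg) = tensor_pure S S (proj Fg) (proj Fg)"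
      using PF(4)[of "P \<one> h4_g"] by (simp add: one_closed comult_group_like tm(2) Fg_def)
    moreover have "counit S (proj Fg) = 1"
      using PF(5)[of "P \<one> h4_g"]
      by (simp add: one_closed counit_crossed_P counit_one Fg_def h4_g_def)
    ultimately have "proj Fg = e \<or> proj Fg = h4_g"
      by (rule sweedler_group_like)
    moreover have "Fg = P \<gamma> (proj Fg)"
      using reassemble[OF GX(1)] tensor_lift_comult_hopf_hom[OF prehopf_crossed prehopf_crossed vC f_hom bilinear_reassemble, of "P \<one> h4_g"]
      by (simp add: one_closed comult_group_like tensor_lift_pure[OF vC vC vC]
          bilinear_precomp[OF bilinear_reassemble F(1) F(1)] \<gamma>_def flip: Fg_def)
    moreover have "f (P \<one> h4_g) \<noteq> P \<gamma> e"
      by (rule not_in_A[OF GX(3) h4_coordinates_linear(2)]) (simp_all add: h4_g_def)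
    ultimately show ?thesis
      unfolding Fg_def by metis
  qed
  \<comment> \<open>The multiple of \<open>1 - g\<close> is excluded by applying \<open>f\<close> to \<open>x g = - g x\<close>.\<close>
  obtain \<beta> where proj_Fx: "proj Fx = H4 0 0 \<beta> 0"
  proof -
    have "comult S (proj Fx) = tensor_pure S S (proj Fx) e \<oplus>\<^bsub>tensor S S\<^esub> tensor_pure S S h4_g (proj Fx)"
      using PF(4)[of "P \<one> h4_x"]
      by (simp add: one_closed comult_skew_primitive tm(2) linear_hom_add[OF tm(1)] f_one proj_one proj_Fg
          flip: Fg_def Fx_def)
    then have Fx: "proj Fx = H4 (co_1 (proj Fx)) (- co_1 (proj Fx)) (co_x (proj Fx)) 0"
      by (rule sweedler_skew_primitive)
    have "proj Fx \<otimes>\<^bsub>S\<^esub> proj Fg = proj (f (P \<one> h4_x \<otimes>\<^bsub>C\<^esub> P \<one> h4_g))"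
      by (simp add: PF(2) one_closed Fg_def Fx_def del: sweedler_simps)
    also have "P \<one> h4_x \<otimes>\<^bsub>C\<^esub> P \<one> h4_g = (- 1) \<odot>\<^bsub>C\<^esub> (P \<one> h4_g \<otimes>\<^bsub>C\<^esub> P \<one> h4_x)"
      by (simp only: crossed_products smult_P one_closed)
    also have "proj (f \<dots>) = (- 1) \<odot>\<^bsub>S\<^esub> (proj Fg \<otimes>\<^bsub>S\<^esub> proj Fx)"
      using crossed_mult_closed[of "P \<one> h4_g" "P \<one> h4_x"]
      by (simp add: PF(2) one_closed Fg_def Fx_def linear_hom_smult[OF PF(1)] del: sweedler_simps)
    finally have "proj Fx \<otimes>\<^bsub>S\<^esub> h4_g = (- 1) \<odot>\<^bsub>S\<^esub> (h4_g \<otimes>\<^bsub>S\<^esub> proj Fx)"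
      by (simp only: proj_Fg)
    then have "co_g (proj Fx) = - co_g (proj Fx)"
      by (simp add: h4_g_def)
    then have "2 * co_g (proj Fx) = 0"
      by (metis add.right_inverse mult_2)
    then have "co_g (proj Fx) = 0"
      using two by simp
    then show ?thesis
      using that Fx by (metis h4.sel(2) neg_equal_0_iff_equal)
  qed
  have bl: "bilinear C C C (\<lambda>s t. P (coproj (f s)) (proj (f t)))"
    by (rule bilinear_precomp[OF bilinear_reassemble F(1) F(1)])
  have X1: "Fx = P r e \<oplus>\<^bsub>C\<^esub> P \<gamma> (proj Fx)"
    using reassemble[OF GX(2)] tensor_lift_comult_hopf_hom[OF prehopf_crossed prehopf_crossed vC f_hom bilinear_reassemble, of "P \<one> h4_x"]
    by (simp add: one_closed comult_skew_primitive tensor_lift_pure[OF vC vC vC bl]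
        linear_hom_add[OF tensor_lift_linear[OF vC vC vC bl]] f_one proj_one \<gamma>_def r_def flip: Fg_def Fx_def)
  have X2: "Fx = P \<one> (proj Fx) \<oplus>\<^bsub>C\<^esub> P r h4_g"
    using reassemble_flipped[OF GX(2)] tensor_lift_comult_hopf_hom[OF prehopf_crossed prehopf_crossed vC f_hom bilinear_flip[OF bilinear_reassemble], of "P \<one> h4_x"]
    by (simp add: one_closed comult_skew_primitive tensor_lift_pure[OF vC vC vC bilinear_flip[OF bl]]
        linear_hom_add[OF tensor_lift_linear[OF vC vC vC bilinear_flip[OF bl]]] f_one proj_one proj_Fg \<gamma>_def r_def flip: Fg_def Fx_def)
  \<comment> \<open>The comparison of \<open>X1\<close> and \<open>X2\<close>, taken in each coordinate of \<open>H\<^sub>4\<close>.\<close>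
  have coord: "\<phi> e \<odot> r \<oplus> \<phi> (proj Fx) \<odot> \<gamma> = \<phi> (proj Fx) \<odot> \<one> \<oplus> \<phi> h4_g \<odot> r" if "\<phi> \<in> linear_hom S scalars" for \<phi>
    using arg_cong[OF X1, of "coordinate \<phi>"] arg_cong[OF X2, of "coordinate \<phi>"] GX one_closed
    by (simp add: linear_hom_add[OF coordinate_linear[OF that]] coordinate_P[OF that])
  have r: "r = \<zero>"
    using coord[OF h4_coordinates_linear(1)] GX one_closed by (simp add: proj_Fx h4_g_def)
  have \<beta>: "\<beta> \<noteq> 0"
  proof
    assume "\<beta> = 0"
    then have "f (P \<one> h4_x) = P r e"
      using X1 GX by (simp add: proj_Fx flip: Fx_def)
    then show False
      using not_in_A[OF GX(4) h4_coordinates_linear(3), of h4_x] by (auto simp: h4_x_def)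
  qed
  have Fx: "Fx = P \<one> (h4_v \<beta> h4_x)"
    using X2 one_closed by (simp add: r proj_Fx h4_v_def h4_x_def)
  have "\<beta> \<odot> \<gamma> = \<beta> \<odot> \<one>"
    using coord[OF h4_coordinates_linear(3)] GX one_closed by (simp add: proj_Fx h4_g_def r)
  then have "inverse \<beta> \<odot> (\<beta> \<odot> \<gamma>) = inverse \<beta> \<odot> (\<beta> \<odot> \<one>)"
    by simp
  then have \<gamma>: "\<gamma> = \<one>"
    using \<beta> GX one_closed by (simp add: A.smult_smult)
  have Fg: "Fg = P \<one> (h4_v \<beta> h4_g)"
    using reassemble[OF GX(1)] tensor_lift_comult_hopf_hom[OF prehopf_crossed prehopf_crossed vC f_hom bilinear_reassemble, of "P \<one> h4_g"]
    by (simp add: one_closed comult_group_like tensor_lift_pure[OF vC vC vC bl]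
        proj_Fg \<gamma> h4_v_def flip: Fg_def \<gamma>_def) (simp add: h4_g_def)
  have GX_mult: "P \<one> (h4_v \<beta> h4_g) \<otimes>\<^bsub>C\<^esub> P \<one> (h4_v \<beta> h4_x) = P \<one> (h4_v \<beta> h4_gx)"
    and XX_mult: "P \<one> (h4_v \<beta> h4_x) \<otimes>\<^bsub>C\<^esub> P \<one> (h4_v \<beta> h4_x) = \<beta>\<^sup>2 \<odot>\<^bsub>C\<^esub> P a e"
  proof -
    have v: "h4_v \<beta> h4_g = h4_g" "h4_v \<beta> h4_x = \<beta> \<odot>\<^bsub>S\<^esub> h4_x" "h4_v \<beta> h4_gx = \<beta> \<odot>\<^bsub>S\<^esub> h4_gx"
      by (simp_all add: h4_v_def h4_g_def h4_x_def h4_gx_def)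
    note m = linear_hom_smult[OF bilinear_right[OF bilinear_crossed_mult]]
      linear_hom_smult[OF bilinear_left[OF bilinear_crossed_mult]]
    show "P \<one> (h4_v \<beta> h4_g) \<otimes>\<^bsub>C\<^esub> P \<one> (h4_v \<beta> h4_x) = P \<one> (h4_v \<beta> h4_gx)"
      by (simp add: v smult_P one_closed m crossed_products del: sweedler_simps)
    show "P \<one> (h4_v \<beta> h4_x) \<otimes>\<^bsub>C\<^esub> P \<one> (h4_v \<beta> h4_x) = \<beta>\<^sup>2 \<odot>\<^bsub>C\<^esub> P a e"
      by (simp add: v smult_P one_closed m crossed_products C.smult_smult power2_eq_square a_closed
          del: sweedler_simps)
  qed
  have f_one_h: "f (P \<one> h) = P \<one> (h4_v \<beta> h)" for h
  proof -
    have l1: "(\<lambda>h. f (P \<one> h)) \<in> linear_hom S C"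
      by (rule linear_hom_comp[OF F(1) bilinear_right[OF bilinear_P one_closed]])
    have l2: "(\<lambda>h. P \<one> (h4_v \<beta> h)) \<in> linear_hom S C"
      by (rule linear_hom_bilinear_right[OF bilinear_P one_closed h4_v_linear])
    have "f (P \<one> h4_gx) = P \<one> (h4_v \<beta> h4_gx)"
      using F(2)[of "P \<one> h4_g" "P \<one> h4_x"] Fg Fx
      by (simp add: one_closed crossed_products Fg_def Fx_def GX_mult)
    moreover have "h4_v \<beta> e = e"
      by (simp add: h4_v_def)
    ultimately show ?thesis
      using sweedler_linear_expand[OF vC l1, of h] sweedler_linear_expand[OF vC l2, of h] Fg Fx f_one
      by (simp add: Fg_def Fx_def)
  qed
  have "f (P z h) = psi u \<beta> (P z h)" if z: "z \<in> carrier A" for z h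
  proof -
    have "f (P z h) = f (P z e \<otimes>\<^bsub>C\<^esub> P \<one> h)"
      by (simp add: crossed_mult_left_A z one_closed mult_one)
    also have "\<dots> = P (u z) e \<otimes>\<^bsub>C\<^esub> P \<one> (h4_v \<beta> h)"
      by (simp add: F(2) z one_closed fA f_one_h)
    also have "\<dots> = psi u \<beta> (P z h)"
      by (simp add: crossed_mult_left_A z one_closed mult_one u'(6) psi_P u'(1))
    finally show ?thesis .
  qed
  then have eq: "f T = psi u \<beta> T" if "T \<in> carrier C" for T
    by (rule crossed_ext[OF vC F(1) psi_linear[OF u'(1)] _ that])
  have "P (u a) e = f (P \<one> h4_x \<otimes>\<^bsub>C\<^esub> P \<one> h4_x)"
    by (simp add: crossed_products fA a_closed)
  also have "\<dots> = \<beta>\<^sup>2 \<odot>\<^bsub>C\<^esub> P a e"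
    using XX_mult Fx by (simp add: F(2) one_closed Fx_def)
  finally have "coproj (P (u a) e) = coproj (P (\<beta>\<^sup>2 \<odot> a) e)"
    by (simp add: smult_P a_closed)
  then have "u a = \<beta>\<^sup>2 \<odot> a"
    by (simp add: coproj_incl u'(6) a_closed)
  with u \<beta> eq show ?thesis
    using that by blast
qed

end


section \<open>The isomorphism of groups\<close>

lemma carrier_units_ground: "carrier (units_of (ground :: 'k::field ring)) = {\<beta>. \<beta> \<noteq> 0}"
proof -
  interpret F: Ring.field "ground :: 'k ring" by (rule field_from_type_algebra)
  show ?thesis
    using F.field_Units by (auto simp: units_of_carrier)
qed

lemma group_units_ground: "group (units_of (ground :: 'k::field ring))"
proof -
  interpret F: Ring.field "ground :: 'k ring" by (rule field_from_type_algebra)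
  show ?thesis by (rule F.units_group)
qed

lemma inv_units_ground:
  assumes "\<beta> \<noteq> (0 :: 'k::field)"
  shows "inv\<^bsub>units_of (ground :: 'k ring)\<^esub> \<beta> = inverse \<beta>"
  by (rule group.inv_equality[OF group_units_ground])
    (use assms in \<open>simp_all add: carrier_units_ground units_of_mult units_of_one\<close>)

context crossed_product
begin

lemma G_carrier_iff:
  "(u, \<beta>) \<in> G_carrier A a \<longleftrightarrow> u \<in> carrier (hopf_aut A) \<and> \<beta> \<noteq> 0 \<and> u a = \<beta>\<^sup>2 \<odot> a"
  by (simp add: G_carrier_def carrier_units_ground)

abbreviation "prod_group \<equiv> hopf_aut A \<times>\<times> units_of (ground :: 'k ring)"

lemma group_prod: "group prod_group"
  by (rule DirProd_group[OF group_hopf_aut[OF prehopf] group_units_ground])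

lemma hopf_autD: "u \<in> carrier (hopf_aut A) \<Longrightarrow> u \<in> hopf_hom A A"
  "u \<in> carrier (hopf_aut A) \<Longrightarrow> u \<in> linear_hom A A"
  by (auto simp: carrier_hopf_aut dest: hopf_homD(1))

lemma inv_in_G_carrier:
  assumes "(u, \<beta>) \<in> G_carrier A a"
  shows "(inv\<^bsub>hopf_aut A\<^esub> u, inverse \<beta>) \<in> G_carrier A a"
proof -
  interpret G: group "hopf_aut A" by (rule group_hopf_aut[OF prehopf])
  have u: "u \<in> carrier (hopf_aut A)" and \<beta>: "\<beta> \<noteq> 0" and ua: "u a = \<beta>\<^sup>2 \<odot> a"
    using assms by (auto simp: G_carrier_iff)
  note u' = G.inv_closed[OF u]
  have ia: "(inv\<^bsub>hopf_aut A\<^esub> u) a \<in> carrier A"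
    by (rule hopf_homD(6)[OF hopf_autD(1)[OF u'] a_closed])
  have "a = (inv\<^bsub>hopf_aut A\<^esub> u) (\<beta>\<^sup>2 \<odot> a)"
    using hopf_aut_inv_apply(1)[OF prehopf u a_closed] by (simp add: ua)
  also have "\<dots> = \<beta>\<^sup>2 \<odot> (inv\<^bsub>hopf_aut A\<^esub> u) a"
    by (rule linear_hom_smult[OF hopf_autD(2)[OF u'] a_closed])
  finally have "(inverse \<beta>)\<^sup>2 \<odot> a = (inverse \<beta>)\<^sup>2 \<odot> (\<beta>\<^sup>2 \<odot> (inv\<^bsub>hopf_aut A\<^esub> u) a)"
    by (rule arg_cong)
  also have "\<dots> = (inv\<^bsub>hopf_aut A\<^esub> u) a"
    using ia \<beta> by (simp add: A.smult_smult power_mult_distrib[symmetric])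
  finally show ?thesis
    using u' \<beta> by (simp add: G_carrier_iff)
qed

lemma subgroup_G_carrier: "subgroup (G_carrier A a) prod_group"
proof (rule group.subgroupI[OF group_prod])
  interpret G: group "hopf_aut A" by (rule group_hopf_aut[OF prehopf])
  show "G_carrier A a \<subseteq> carrier prod_group"
    by (auto simp: G_carrier_iff carrier_units_ground)
  have "(\<lambda>x \<in> carrier A. x) \<in> carrier (hopf_aut A)"
    using G.one_closed by (simp add: one_hopf_aut)
  then have "(\<lambda>x \<in> carrier A. x, 1) \<in> G_carrier A a"
    by (simp add: G_carrier_iff a_closed)
  then show "G_carrier A a \<noteq> {}"
    by blast
next
  fix x assume x: "x \<in> G_carrier A a"
  then show "inv\<^bsub>prod_group\<^esub> x \<in> G_carrier A a"
    using inv_in_G_carrier[of "fst x" "snd x"]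
    by (cases x) (simp add: inv_DirProd[OF group_hopf_aut[OF prehopf] group_units_ground]
        carrier_units_ground G_carrier_iff inv_units_ground)
next
  interpret G: group "hopf_aut A" by (rule group_hopf_aut[OF prehopf])
  fix x y assume x: "x \<in> G_carrier A a" and y: "y \<in> G_carrier A a"
  obtain u \<beta> v \<gamma> where xy: "x = (u, \<beta>)" "y = (v, \<gamma>)"
    by (cases x, cases y) auto
  have uv: "u \<in> carrier (hopf_aut A)" "v \<in> carrier (hopf_aut A)" "u a = \<beta>\<^sup>2 \<odot> a" "v a = \<gamma>\<^sup>2 \<odot> a"
    "\<beta> \<noteq> 0" "\<gamma> \<noteq> 0"
    using x y by (auto simp: xy G_carrier_iff)
  have "(u \<otimes>\<^bsub>hopf_aut A\<^esub> v) a = (\<beta> * \<gamma>)\<^sup>2 \<odot> a"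
    by (simp add: mult_hopf_aut uv compose_def a_closed linear_hom_smult[OF hopf_autD(2)[OF uv(1)]]
        A.smult_smult power_mult_distrib mult.commute)
  then show "x \<otimes>\<^bsub>prod_group\<^esub> y \<in> G_carrier A a"
    using uv by (simp add: xy G_carrier_iff units_of_mult)
qed

definition Psi where "Psi = (\<lambda>(u, \<beta>). restrict (psi u \<beta>) (carrier C))"

lemma psi_closed: "u \<in> linear_hom A A \<Longrightarrow> T \<in> carrier C \<Longrightarrow> psi u \<beta> T \<in> carrier C"
  by (rule linear_hom_closed[OF psi_linear])

lemma Psi_in_hopf_aut:
  assumes "(u, \<beta>) \<in> G_carrier A a"
  shows "Psi (u, \<beta>) \<in> carrier (hopf_aut C)"
proof -
  have u: "u \<in> carrier (hopf_aut A)" and \<beta>: "\<beta> \<noteq> 0" and ua: "u a = \<beta>\<^sup>2 \<odot> a"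
    using assms by (auto simp: G_carrier_iff)
  let ?v = "inv\<^bsub>hopf_aut A\<^esub> u"
  have v: "?v \<in> carrier (hopf_aut A)"
    using inv_in_G_carrier[OF assms] by (simp add: G_carrier_iff)
  have "psi u \<beta> (psi ?v (inverse \<beta>) T) = T" "psi ?v (inverse \<beta>) (psi u \<beta> T) = T"
    if T: "T \<in> carrier C" for T
    using T \<beta> psi_cong[OF linear_hom_id _ T, of "\<lambda>z. u (?v z)" 1]
      psi_cong[OF linear_hom_id _ T, of "\<lambda>z. ?v (u z)" 1]
    by (simp_all add: psi_psi hopf_autD(2) u v psi_id hopf_aut_inv_apply[OF prehopf u])
  then show ?thesis
    unfolding Psi_def prod.case
    by (intro restrict_in_hopf_aut[OF prehopf_crossed psi_hopf_hom[OF hopf_autD(1)[OF u] ua],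
          where g = "psi ?v (inverse \<beta>)"] psi_closed hopf_autD(2) v)
qed

lemma Psi_P: "(u, \<beta>) \<in> G_carrier A a \<Longrightarrow> z \<in> carrier A \<Longrightarrow> Psi (u, \<beta>) (P z h) = P (u z) (h4_v \<beta> h)"
  by (simp add: Psi_def psi_P hopf_autD(2) G_carrier_iff)

lemma Psi_hom: "Psi \<in> hom (prod_group\<lparr>carrier := G_carrier A a\<rparr>) (hopf_aut C)"
proof (rule homI)
  fix x assume "x \<in> carrier (prod_group\<lparr>carrier := G_carrier A a\<rparr>)"
  then show "Psi x \<in> carrier (hopf_aut C)"
    using Psi_in_hopf_aut by (cases x) simp
next
  fix x y assume "x \<in> carrier (prod_group\<lparr>carrier := G_carrier A a\<rparr>)"
    "y \<in> carrier (prod_group\<lparr>carrier := G_carrier A a\<rparr>)"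
  then have x: "x \<in> G_carrier A a" and y: "y \<in> G_carrier A a"
    by simp_all
  interpret GC: group "hopf_aut C" by (rule group_hopf_aut[OF prehopf_crossed])
  obtain u \<beta> v \<gamma> where xy: "x = (u, \<beta>)" "y = (v, \<gamma>)"
    by (cases x, cases y) auto
  have uv: "u \<in> carrier (hopf_aut A)" "v \<in> carrier (hopf_aut A)"
    using x y by (auto simp: xy G_carrier_iff)
  have Pxy: "Psi x \<in> carrier (hopf_aut C)" "Psi y \<in> carrier (hopf_aut C)"
    using Psi_in_hopf_aut x y by (auto simp: xy)
  have m: "x \<otimes>\<^bsub>prod_group\<^esub> y = (compose (carrier A) u v, \<beta> * \<gamma>)"
    by (simp add: xy mult_hopf_aut uv units_of_mult)
  have "Psi (x \<otimes>\<^bsub>prod_group\<^esub> y) = Psi x \<otimes>\<^bsub>hopf_aut C\<^esub> Psi y"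
  proof (rule hopf_aut_eqI[of _ C])
    show "Psi (x \<otimes>\<^bsub>prod_group\<^esub> y) \<in> carrier (hopf_aut C)"
      using Psi_in_hopf_aut subgroup.m_closed[OF subgroup_G_carrier x y] by (simp add: m)
    show "Psi x \<otimes>\<^bsub>hopf_aut C\<^esub> Psi y \<in> carrier (hopf_aut C)"
      by (rule GC.m_closed[OF Pxy])
    fix T assume T: "T \<in> carrier C"
    have "psi (compose (carrier A) u v) (\<beta> * \<gamma>) T = psi (\<lambda>z. u (v z)) (\<beta> * \<gamma>) T"
      by (rule psi_cong[OF linear_hom_comp[OF hopf_autD(2)[OF uv(1)] hopf_autD(2)[OF uv(2)]] _ T])
        (simp add: compose_def)
    then have "psi (compose (carrier A) u v) (\<beta> * \<gamma>) T = psi u \<beta> (psi v \<gamma> T)"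
      by (simp add: psi_psi hopf_autD(2) uv T)
    then show "Psi (x \<otimes>\<^bsub>prod_group\<^esub> y) T = (Psi x \<otimes>\<^bsub>hopf_aut C\<^esub> Psi y) T"
      unfolding mult_hopf_aut[OF Pxy] m
      using T by (simp add: Psi_def xy compose_def psi_closed hopf_autD(2) uv)
  qed
  then show "Psi (x \<otimes>\<^bsub>prod_group\<lparr>carrier := G_carrier A a\<rparr>\<^esub> y) = Psi x \<otimes>\<^bsub>hopf_aut C\<^esub> Psi y"
    by simp
qed

lemma Psi_inj: "inj_on Psi (G_carrier A a)"
proof (rule inj_onI)
  fix x y assume x: "x \<in> G_carrier A a" and y: "y \<in> G_carrier A a" and eq: "Psi x = Psi y"
  obtain u \<beta> v \<gamma> where xy: "x = (u, \<beta>)" "y = (v, \<gamma>)"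
    by (cases x, cases y) auto
  have uv: "u \<in> carrier (hopf_aut A)" "v \<in> carrier (hopf_aut A)"
    using x y by (auto simp: xy G_carrier_iff)
  have P_eq: "P (u z) (h4_v \<beta> h) = P (v z) (h4_v \<gamma> h)" if "z \<in> carrier A" for z h
    using fun_cong[OF eq, of "P z h"] Psi_P[of u \<beta> z h] Psi_P[of v \<gamma> z h] x y that by (simp add: xy)
  have "u = v"
  proof (rule hopf_aut_eqI[OF uv])
    fix z assume z: "z \<in> carrier A"
    have "h4_v c e = e" for c :: 'k
      by (simp add: h4_v_def)
    then have "coproj (P (u z) e) = coproj (P (v z) e)"
      using P_eq[OF z, of e] by simp
    then show "u z = v z"
      using z hopf_homD(6)[OF hopf_autD(1)] uv by (simp add: coproj_incl)
  qed
  moreover have "\<beta> = \<gamma>"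
  proof -
    have one: "u \<one> = \<one>" "v \<one> = \<one>"
      using hopf_homD(3)[OF hopf_autD(1)] uv by auto
    have "co_x (proj (P (u \<one>) (h4_v \<beta> h4_x))) = co_x (proj (P (v \<one>) (h4_v \<gamma> h4_x)))"
      using P_eq[OF one_closed, of h4_x] by simp
    then show ?thesis
      by (simp add: one proj_P one_closed counit_one h4_v_def h4_x_def)
  qed
  ultimately show "x = y"
    by (simp add: xy)
qed

lemma Psi_surj:
  assumes two: "(2 :: 'k) \<noteq> 0"
    and trivial: "\<forall>f \<in> hopf_hom A S. \<forall>z \<in> carrier A. f z = counit A z \<odot>\<^bsub>S\<^esub> e"
  shows "Psi ` G_carrier A a = carrier (hopf_aut C)"
proof
  show "Psi ` G_carrier A a \<subseteq> carrier (hopf_aut C)"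
    using Psi_in_hopf_aut by auto
  show "carrier (hopf_aut C) \<subseteq> Psi ` G_carrier A a"
  proof
    fix f assume f: "f \<in> carrier (hopf_aut C)"
    obtain u \<beta> where u: "u \<in> carrier (hopf_aut A)" "\<beta> \<noteq> 0" "u a = \<beta>\<^sup>2 \<odot> a"
      "\<And>T. T \<in> carrier C \<Longrightarrow> f T = psi u \<beta> T"
      by (rule aut_is_psi[OF two trivial f]) blast
    have G: "(u, \<beta>) \<in> G_carrier A a"
      by (simp add: G_carrier_iff u(1-3))
    have "f = Psi (u, \<beta>)"
      by (rule hopf_aut_eqI[OF f Psi_in_hopf_aut[OF G]]) (simp add: Psi_def u(4))
    then show "f \<in> Psi ` G_carrier A a"
      using G by blast
  qed
qed

end

lemma two_neq_zero_if_CHAR_neq_2: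
  assumes "CHAR('k::field) \<noteq> 2"
  shows "(2 :: 'k) \<noteq> 0"
proof
  assume "(2 :: 'k) = 0"
  then have "CHAR('k) dvd 2"
    using of_nat_eq_0_iff_char_dvd[of 2, where ?'a = 'k] by simp
  then have "CHAR('k) = 1 \<or> CHAR('k) = 2"
    using two_is_prime_nat prime_nat_iff by blast
  then show False
    using assms CHAR_not_1[where ?'a = 'k] by auto
qed

theorem mainTheorem6:
  fixes A :: "('k::field, 'a) hopf" and a :: 'a
  assumes "CHAR('k) \<noteq> 2"
    and "hopf_algebra A"
    and "\<forall>f \<in> hopf_hom A (sweedler :: ('k, 'k h4) hopf).
      \<forall>z \<in> carrier A. f z = counit A z \<odot>\<^bsub>sweedler\<^esub> \<one>\<^bsub>sweedler\<^esub>"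
    and "a \<in> ZP A"
  shows "group (hopf_aut A \<times>\<times> units_of (ground :: 'k ring)) \<and>
    subgroup (G_carrier A a) (hopf_aut A \<times>\<times> units_of (ground :: 'k ring)) \<and>
    group (hopf_aut (crossed A a)) \<and>
    (\<exists>\<psi> \<in> iso ((hopf_aut A \<times>\<times> units_of (ground :: 'k ring))\<lparr>carrier := G_carrier A a\<rparr>)
              (hopf_aut (crossed A a)).
      \<forall>(u, \<beta>) \<in> G_carrier A a. \<forall>z \<in> carrier A. \<forall>h \<in> carrier sweedler.
        \<psi> (u, \<beta>) (tensor_pure A sweedler z h) = tensor_pure A sweedler (u z) (h4_v \<beta> h))"
proof -
  interpret hopf_algebra A by fact
  have a: "a \<in> carrier A"
    "comult A a = tensor_pure A A a \<one>\<^bsub>A\<^esub> \<oplus>\<^bsub>tensor A A\<^esub> tensor_pure A A \<one>\<^bsub>A\<^esub> a"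
    using assms(4) by (auto simp: ZP_def)
  interpret crossed_product A a
    by unfold_locales (use a counit_primitive in auto)
  have trivial: "\<forall>f \<in> hopf_hom A S. \<forall>z \<in> carrier A. f z = counit A z \<odot>\<^bsub>S\<^esub> e"
    using assms(3) by (simp only: sweedler_simps(5))
  have "Psi \<in> iso (prod_group\<lparr>carrier := G_carrier A a\<rparr>) (hopf_aut C)"
    using Psi_hom Psi_inj Psi_surj[OF two_neq_zero_if_CHAR_neq_2[OF assms(1)] trivial]
    by (simp add: iso_def bij_betw_def)
  then show ?thesis
    using group_prod subgroup_G_carrier group_hopf_aut[OF prehopf_crossed] Psi_P by blast
qed

end
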